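(* Let $r\ge 3$ be an integer, $d>0$ a real number, $(d_n)_{n\in\mathbb{N}}$ a sequence of reals with $d_n\to d$, and $p=p(n)=d_n/\binom{n-1}{r-1}$. Let $G=G^r(n,p)$ be the factor graph of $H^r(n,p)$. For each $j\in\mathbb{N}=\{0,1,2,\dots\}$ let $\xi_j$ and $\hat\xi_j$ be the proportion of variable nodes and of factor nodes of $G$, respectively, which have degree $j$ in the reduced core $R_G$ of $G$. Then there exists a function $\varepsilon=\varepsilon(n)=o(1)$ (not depending on $j$) such that, for any constant $j\in\mathbb{N}$, with high probability $$\left|\xi_j-\mathbb{P}\big(\widetilde{\mathrm{Po}}(d\hat\rho_* )=j\big)\right|\le\varepsilon \qquad\text{and}\qquad \left|\hat\xi_j-\mathbb{P}\big(\widetilde{\mathrm{Bi}}(r,\rho_* )=j\big)\right|\le\varepsilon ,$$ where $\rho_*$, $\hat\rho_*$ and the distributions $\widetilde{\mathrm{Po}}$, $\widetilde{\mathrm{Bi}}$ are defined in the context.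
   Context: Asymptotics are as $n\to\infty$; "with high probability" means with probability tending to $1$ as $n\to\infty$; "constant" means not depending on $n$. $H^r(n,p)$ is the random $r$-uniform hypergraph on vertex set $[n]$ in which each $r$-subset of $[n]$ is an edge independently with probability $p$. The factor graph $G(H)$ of a hypergraph $H$ is the bipartite graph with classes $\mathcal V=V(H)$ (variable nodes) and $\mathcal F=E(H)$ (factor nodes), where $v\in\mathcal V$ and $a\in\mathcal F$ are adjacent iff $v\in a$. The reduced core $R_G$ of a factor graph $G$ is the maximal subgraph of $G$ with no nodes of degree $1$; isolated nodes are allowed, so $R_G$ contains all nodes of $G$, i.e. every node of $G$ has a well-defined degree (possibly $0$) in $R_G$. Let $F(x)=\exp(-d(1-x^{r-1}))$ for $x\ge 0$; $\rho_*=\rho_*(r,d)$ is the largest solution $\rho$ of $1-\rho=F(1-\rho)$ (note $\rho=0$ is always a solution), and $\hat\rho_*=1-(1-\rho_* )^{r-1}$. $\widetilde{\mathrm{Po}}(\lambda)$ is the distribution of $X$ with $\mathbb P(X=0)=\mathbb P(\mathrm{Po}(\lambda)\le 1)$, $\mathbb P(X=1)=0$, $\mathbb P(X=j)=\mathbb P(\mathrm{Po}(\lambda)=j)$ for $j\ge2$; $\widetilde{\mathrm{Bi}}(N,q)$ is defined analogously from the binomial distribution $\mathrm{Bi}(N,q)$ (the value $1$ is replaced by $0$). $\mathrm{Po}(0)$ is deterministically $0$. *)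

theory Defs
  imports "HOL-Probability.Probability"
begin

text \<open>
  Edges are sets of vertices, so there are no multiple edges. A graph is represented as a
  hypergraph all of whose edges are two-element sets.
\<close>

record 'v hypergraph =
  verts :: "'v set"
  edges :: "'v set set"

definition deg :: "'v hypergraph \<Rightarrow> 'v \<Rightarrow> nat" where
  "deg G v = card {e \<in> edges G. v \<in> e}"

definition subgraph :: "'v hypergraph \<Rightarrow> 'v hypergraph \<Rightarrow> bool" where
  "subgraph R G \<longleftrightarrow> verts R \<subseteq> verts G \<and> edges R \<subseteq> edges G \<and> \<Union>(edges R) \<subseteq> verts R"

definition r_subsets :: "nat \<Rightarrow> nat \<Rightarrow> nat set set" where
  "r_subsets r n = {e. e \<subseteq> {1..n} \<and> card e = r}"

text \<open>
  Note that \<open>bernoulli_pmf p\<close> clamps \<open>p\<close> to the interval from 0 to 1, so the random hypergraph is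
  defined for every real \<open>p\<close>.
\<close>

definition random_hypergraph :: "nat \<Rightarrow> nat \<Rightarrow> real \<Rightarrow> nat hypergraph pmf" where
  "random_hypergraph r n p =
     map_pmf (\<lambda>f. \<lparr>verts = {1..n}, edges = {e \<in> r_subsets r n. f e}\<rparr>)
       (Pi_pmf (r_subsets r n) False (\<lambda>_. bernoulli_pmf p))"

text \<open>Variable nodes are tagged by \<open>Inl\<close>, factor nodes by \<open>Inr\<close>.\<close>

definition factor_graph :: "'v hypergraph \<Rightarrow> ('v + 'v set) hypergraph" where
  "factor_graph H =
     \<lparr>verts = Inl ` verts H \<union> Inr ` edges H,
      edges = {{Inl v, Inr a} | v a. v \<in> verts H \<and> a \<in> edges H \<and> v \<in> a}\<rparr>"

definition leafless_subgraph :: "'v hypergraph \<Rightarrow> 'v hypergraph \<Rightarrow> bool" where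
  "leafless_subgraph R G \<longleftrightarrow> subgraph R G \<and> (\<forall>v\<in>verts R. deg R v \<noteq> 1)"

definition is_reduced_core :: "'v hypergraph \<Rightarrow> 'v hypergraph \<Rightarrow> bool" where
  "is_reduced_core R G \<longleftrightarrow> leafless_subgraph R G \<and>
     (\<forall>R'. leafless_subgraph R' G \<and> subgraph R R' \<longrightarrow> R' = R)"

definition reduced_core :: "'v hypergraph \<Rightarrow> 'v hypergraph" where
  "reduced_core G = (THE R. is_reduced_core R G)"

lemma is_reduced_core_iff:
  fixes G :: "'v hypergraph"
  assumes fin: "finite (edges G)" and wf: "\<Union>(edges G) \<subseteq> verts G"
  shows "is_reduced_core R G \<longleftrightarrow>
           R = \<lparr>verts = verts G, edges = \<Union>{edges R' | R'. leafless_subgraph R' G}\<rparr>"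
proof -
  define C :: "'v hypergraph" where
    "C = \<lparr>verts = verts G, edges = \<Union>{edges R' | R'. leafless_subgraph R' G}\<rparr>"
  have sub: "subgraph R' C" if "leafless_subgraph R' G" for R'
    using that by (auto simp: leafless_subgraph_def subgraph_def C_def)
  have CG: "subgraph C G"
    using wf by (auto simp: leafless_subgraph_def subgraph_def C_def; blast)
  have finC: "finite (edges C)"
    using CG fin finite_subset by (auto simp: subgraph_def)
  have "deg C v \<noteq> 1" for v
  proof
    assume "deg C v = 1"
    then obtain e where e: "{e \<in> edges C. v \<in> e} = {e}"
      unfolding deg_def by (auto simp: card_1_singleton_iff)
    then obtain R' where R': "leafless_subgraph R' G" "e \<in> edges R'" "v \<in> e"
      by (auto simp: C_def)
    have "edges R' \<subseteq> edges C"
      using sub[OF R'(1)] by (simp add: subgraph_def)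
    then have "{e \<in> edges R'. v \<in> e} = {e}"
      using e R' by blast
    then have "deg R' v = 1"
      by (simp add: deg_def)
    moreover have "v \<in> verts R'"
      using R' by (auto simp: leafless_subgraph_def subgraph_def)
    ultimately show False
      using R'(1) by (simp add: leafless_subgraph_def)
  qed
  then have leafless: "leafless_subgraph C G"
    using CG by (simp add: leafless_subgraph_def)
  have anti: "R' = C" if "subgraph C R'" "subgraph R' C" for R'
    using that by (auto simp: subgraph_def intro!: hypergraph.equality)
  have "is_reduced_core R G \<longleftrightarrow> R = C"
    using leafless sub anti unfolding is_reduced_core_def by metis
  then show ?thesis
    by (simp add: C_def)
qed

lemma is_reduced_core_reduced_core:
  fixes G :: "'v hypergraph"
  assumes "finite (edges G)" "\<Union>(edges G) \<subseteq> verts G"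
  shows "is_reduced_core (reduced_core G) G" and "verts (reduced_core G) = verts G"
  by (simp_all add: reduced_core_def is_reduced_core_iff[OF assms])

definition variable_proportion :: "'v hypergraph \<Rightarrow> nat \<Rightarrow> real" where
  "variable_proportion H j =
     real (card {v \<in> verts H. deg (reduced_core (factor_graph H)) (Inl v) = j}) /
     real (card (verts H))"

text \<open>This is 0 when \<open>H\<close> has no edges, by the convention for division by 0.\<close>

definition factor_proportion :: "'v hypergraph \<Rightarrow> nat \<Rightarrow> real" where
  "factor_proportion H j =
     real (card {a \<in> edges H. deg (reduced_core (factor_graph H)) (Inr a) = j}) /
     real (card (edges H))"

definition core_fun :: "nat \<Rightarrow> real \<Rightarrow> real \<Rightarrow> real" where
  "core_fun r d x = exp (- d * (1 - x ^ (r - 1)))"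

text \<open>The condition \<open>\<rho> \<le> 1\<close> expresses that \<open>core_fun\<close> is only considered on nonnegative arguments.\<close>

definition rho_star :: "nat \<Rightarrow> real \<Rightarrow> real" where
  "rho_star r d = (GREATEST \<rho>. \<rho> \<le> 1 \<and> 1 - \<rho> = core_fun r d (1 - \<rho>))"

definition rho_hat_star :: "nat \<Rightarrow> real \<Rightarrow> real" where
  "rho_hat_star r d = 1 - (1 - rho_star r d) ^ (r - 1)"

lemma rho_star_greatest:
  shows "1 - rho_star r d = core_fun r d (1 - rho_star r d)"
    and "0 \<le> rho_star r d" "rho_star r d \<le> 1"
    and "\<rho> \<le> 1 \<Longrightarrow> 1 - \<rho> = core_fun r d (1 - \<rho>) \<Longrightarrow> \<rho> \<le> rho_star r d"
proof -
  define P where "P \<rho> \<longleftrightarrow> \<rho> \<le> 1 \<and> 1 - \<rho> = core_fun r d (1 - \<rho>)" for \<rho>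
  define S where "S = {\<rho>. 0 \<le> \<rho> \<and> P \<rho>}"
  have P0: "P 0"
    by (simp add: P_def core_fun_def)
  have S_eq: "S = {0..1} \<inter> {\<rho>. 1 - \<rho> = core_fun r d (1 - \<rho>)}"
    by (auto simp: S_def P_def)
  have "closed {\<rho>. 1 - \<rho> = core_fun r d (1 - \<rho>)}"
    unfolding core_fun_def by (intro closed_Collect_eq continuous_intros)
  then have "compact S"
    unfolding S_eq by (intro compact_Int_closed compact_Icc)
  moreover have "S \<noteq> {}"
    using P0 by (auto simp: S_def)
  ultimately obtain m where m: "m \<in> S" "\<forall>\<rho>\<in>S. \<rho> \<le> m"
    using compact_attains_sup by blast
  have Pm: "P m" and "0 \<le> m"
    using m by (auto simp: S_def)
  have max: "\<rho> \<le> m" if "P \<rho>" for \<rho>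
    using m that \<open>0 \<le> m\<close> by (cases "0 \<le> \<rho>") (auto simp: S_def)
  have "rho_star r d = (GREATEST \<rho>. P \<rho>)"
    by (simp add: rho_star_def P_def)
  also have "\<dots> = m"
    using Pm max by (intro Greatest_equality)
  finally have eq: "rho_star r d = m" .
  show "1 - rho_star r d = core_fun r d (1 - rho_star r d)" "0 \<le> rho_star r d" "rho_star r d \<le> 1"
    using Pm \<open>0 \<le> m\<close> by (simp_all add: eq P_def)
  show "\<rho> \<le> rho_star r d" if "\<rho> \<le> 1" "1 - \<rho> = core_fun r d (1 - \<rho>)"
    using max[of \<rho>] that by (simp add: eq P_def)
qed

text \<open>\<open>poisson_pmf\<close> is only specified for positive rates, hence the case distinction.\<close>

definition Po :: "real \<Rightarrow> nat pmf" where
  "Po \<mu> = (if \<mu> = 0 then return_pmf 0 else poisson_pmf \<mu>)"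

definition one_to_zero :: "nat \<Rightarrow> nat" where
  "one_to_zero k = (if k = 1 then 0 else k)"

definition Po_tilde :: "real \<Rightarrow> nat pmf" where
  "Po_tilde \<mu> = map_pmf one_to_zero (Po \<mu>)"

definition Bi_tilde :: "nat \<Rightarrow> real \<Rightarrow> nat pmf" where
  "Bi_tilde N q = map_pmf one_to_zero (binomial_pmf N q)"

lemma pmf_one_to_zero:
  "pmf (map_pmf one_to_zero D) j =
     (if j = 0 then measure_pmf.prob D {..1} else if j = 1 then 0 else pmf D j)"
proof -
  have "one_to_zero -` {j} = (if j = 0 then {..1} else if j = 1 then {} else {j})"
    by (auto simp: one_to_zero_def split: if_splits)
  then show ?thesis
    by (simp add: pmf_map measure_pmf_single)
qed

end

theory Submission
  imports Defs
begin

text \<open>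
  The proof avoids branching processes. Call a vertex big if its component has at least \<open>K\<close>
  vertices. Exposing the edges at a vertex \<open>v\<close> last shows that the proportion of big vertices is
  governed by the map \<open>surv z = 1 - F(1 - z)\<close>: if \<open>v\<close> has an edge meeting a component of size at
  least \<open>K\<close> of the hypergraph without \<open>v\<close>, then the component of \<open>v\<close> has size at least \<open>K + 1\<close>, and
  conversely a very large component of \<open>v\<close> arises, up to small probability, from such an edge. As
  component sizes above \<open>K\<close> are counted by a function with bounded differences, iteration yields
  that the proportion of big vertices is close to \<open>\<rho>\<^sub>*\<close> for large \<open>K\<close>. Holding back the edges at a small
  set of vertices and using them to join the components found before, by a union bound over all
  \<open>2\<^sup>n\<^sup>/\<^sup>K\<close> ways to split these, shows that almost all big vertices lie in one component \<open>L\<close>.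

  An incidence of \<open>v\<close> and \<open>a\<close> is in the reduced core if it lies on a cycle, so if at least two edges
  at \<open>v\<close> meet the giant part \<open>L\<close> of the hypergraph without \<open>v\<close>, all of them are incident to \<open>v\<close> in the
  core. Conversely, unless \<open>v\<close> is near a small dense set of vertices, a walk in the core starting at
  \<open>v\<close> through \<open>a\<close> meets a new vertex in each step, and \<open>a\<close> contains a big vertex. So the core degree of
  \<open>v\<close> is the number of edges at \<open>v\<close> that meet \<open>L\<close>, with 1 replaced by 0; given \<open>L\<close> this number is
  binomial and close to Poisson. The core degree of \<open>a\<close> is similarly the number of vertices of \<open>a\<close>
  in \<open>L\<close>, and concentration follows from second moments.
\<close>

text \<open>The circularity to be broken is that the giant part depends on the very edges whose hits
  on it are counted. Hence it is taken in the hypergraph without the vertex or edge in question, and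
  for second moments without both vertices of a pair. This forces the asymptotic statements to be
  uniform under deleting boundedly many vertices. The sets obtained after different deletions must
  also be interchangeable: big vertices number at most
  \<open>(rho_star r d + \<epsilon>) * n\<close>, and \<open>L\<close>, which stays big when
  vertices are put back, at least \<open>(rho_star r d - \<epsilon>) * n\<close>, so a new edge
  rarely tells them apart. The constants have to be found in a fixed order. Just below its largest
  fixed point, if this is positive, \<open>surv\<close> lies strictly above the identity. That
  strictness pays for the lower mean degree on the vertices kept when a fraction
  \<open>\<delta>\<close> is held back. A split stays unjoined with probability at most
  \<open>exp (- c0 * n)\<close>, where \<open>c0\<close> depends on \<open>\<delta>\<close>; only
  then can \<open>K\<close> be taken so large that the splits are outnumbered. Degrees are treated
  one at a time with a fixed error; a diagonal argument yields one error sequence for all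
  \<open>j\<close>.\<close>

section \<open>Random subsets of a finite set\<close>

text \<open>\<open>rmean\<close> and \<open>rprob\<close> refer to the random subset \<open>E\<close> of \<open>S\<close> that contains each element
  independently with probability \<open>p\<close>; as finite sums they involve no measurability conditions.\<close>

definition rmean :: "'e set \<Rightarrow> real \<Rightarrow> ('e set \<Rightarrow> real) \<Rightarrow> real" where
  "rmean S p g = (\<Sum>E\<in>Pow S. p ^ card E * (1 - p) ^ card (S - E) * g E)"

definition rprob :: "'e set \<Rightarrow> real \<Rightarrow> ('e set \<Rightarrow> bool) \<Rightarrow> real" where
  "rprob S p Q = rmean S p (\<lambda>E. of_bool (Q E))"

lemma rmean_empty [simp]: "rmean {} p g = g {}"
  by (simp add: rmean_def)

lemma rmean_insert:
  assumes "finite S" "e \<notin> S"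
  shows "rmean (insert e S) p g = p * rmean S p (\<lambda>E. g (insert e E)) + (1 - p) * rmean S p g"
proof -
  let ?t = "\<lambda>S E. p ^ card E * (1 - p) ^ card (S - E) * g E"
  have fin: "finite E" "e \<notin> E" if "E \<in> Pow S" for E
    using that assms finite_subset by auto
  have disj: "Pow S \<inter> insert e ` Pow S = {}"
    using assms by auto
  have inj: "inj_on (insert e) (Pow S)"
    using assms by (intro inj_onI) (metis Diff_insert_absorb Pow_iff subsetD)
  have "rmean (insert e S) p g = (\<Sum>E\<in>Pow S \<union> insert e ` Pow S. ?t (insert e S) E)"
    by (simp add: rmean_def Pow_insert)
  also have "\<dots> = (\<Sum>E\<in>Pow S. ?t (insert e S) E) + (\<Sum>E\<in>insert e ` Pow S. ?t (insert e S) E)"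
    using assms disj by (intro sum.union_disjoint) auto
  also have "(\<Sum>E\<in>insert e ` Pow S. ?t (insert e S) E) = (\<Sum>E\<in>Pow S. ?t (insert e S) (insert e E))"
    using inj by (simp add: sum.reindex)
  also have "\<dots> = p * rmean S p (\<lambda>E. g (insert e E))"
  proof -
    have "?t (insert e S) (insert e E) = p * (p ^ card E * (1 - p) ^ card (S - E) * g (insert e E))"
      if "E \<in> Pow S" for E
    proof -
      have "insert e S - insert e E = S - E" using assms by auto
      then show ?thesis using fin[OF that] by simp
    qed
    then show ?thesis unfolding rmean_def sum_distrib_left by (rule sum.cong[OF refl])
  qed
  also have "(\<Sum>E\<in>Pow S. ?t (insert e S) E) = (1 - p) * rmean S p g"
  proof -
    have "?t (insert e S) E = (1 - p) * ?t S E" if "E \<in> Pow S" for E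
    proof -
      have "insert e S - E = insert e (S - E)" using fin[OF that] by auto
      then show ?thesis using assms by simp
    qed
    then show ?thesis unfolding rmean_def sum_distrib_left by (rule sum.cong[OF refl])
  qed
  finally show ?thesis by simp
qed

lemma rmean_add: "rmean S p (\<lambda>E. g E + h E) = rmean S p g + rmean S p h"
  by (simp add: rmean_def sum.distrib distrib_left)

lemma rmean_diff: "rmean S p (\<lambda>E. g E - h E) = rmean S p g - rmean S p h"
  by (simp add: rmean_def sum_subtractf right_diff_distrib)

lemma rmean_cmult: "rmean S p (\<lambda>E. c * g E) = c * rmean S p g"
  by (simp add: rmean_def sum_distrib_left mult_ac)

lemma rmean_sum: "rmean S p (\<lambda>E. \<Sum>i\<in>A. g i E) = (\<Sum>i\<in>A. rmean S p (g i))"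
  unfolding rmean_def sum_distrib_left by (rule sum.swap)

lemma rmean_cong: "(\<And>E. E \<subseteq> S \<Longrightarrow> g E = h E) \<Longrightarrow> rmean S p g = rmean S p h"
  by (auto simp: rmean_def intro!: sum.cong)

lemma rprob_cong: "(\<And>E. E \<subseteq> S \<Longrightarrow> Q E = R E) \<Longrightarrow> rprob S p Q = rprob S p R"
  unfolding rprob_def by (rule rmean_cong) simp

lemma rmean_mono:
  assumes "0 \<le> p" "p \<le> 1" "\<And>E. E \<subseteq> S \<Longrightarrow> g E \<le> h E"
  shows "rmean S p g \<le> rmean S p h"
  unfolding rmean_def using assms by (intro sum_mono mult_left_mono) auto

lemma rmean_const [simp]: "finite S \<Longrightarrow> rmean S p (\<lambda>_. c) = c"
  by (induction S rule: finite_induct) (simp_all add: rmean_insert algebra_simps)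

lemma rmean_nonneg:
  assumes "0 \<le> p" "p \<le> 1" "\<And>E. E \<subseteq> S \<Longrightarrow> 0 \<le> g E"
  shows "0 \<le> rmean S p g"
  unfolding rmean_def using assms by (intro sum_nonneg mult_nonneg_nonneg) auto

lemma rmean_le_const:
  assumes "finite S" "0 \<le> p" "p \<le> 1" "\<And>E. E \<subseteq> S \<Longrightarrow> g E \<le> c"
  shows "rmean S p g \<le> c"
  using rmean_mono[OF assms(2,3), of S g "\<lambda>_. c"] assms by simp

lemma rmean_ge_const:
  assumes "finite S" "0 \<le> p" "p \<le> 1" "\<And>E. E \<subseteq> S \<Longrightarrow> c \<le> g E"
  shows "c \<le> rmean S p g"
  using rmean_mono[OF assms(2,3), of S "\<lambda>_. c" g] assms by simp

text \<open>Independence of disjoint parts of the ground set in the form of Fubini's theorem;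
  exposing some edges after the others always comes down to this.\<close>

lemma rmean_union:
  assumes "finite S" "finite T" "S \<inter> T = {}"
  shows "rmean (S \<union> T) p g = rmean S p (\<lambda>E. rmean T p (\<lambda>F. g (E \<union> F)))"
  using assms(2,3)
proof (induction T arbitrary: g rule: finite_induct)
  case empty
  then show ?case by simp
next
  case (insert e T)
  have "rmean (S \<union> insert e T) p g
      = p * rmean (S \<union> T) p (\<lambda>E. g (insert e E)) + (1 - p) * rmean (S \<union> T) p g"
    using insert assms(1) by (subst Un_insert_right, subst rmean_insert) auto
  also have "\<dots> = rmean S p (\<lambda>E. p * rmean T p (\<lambda>F. g (insert e (E \<union> F)))
                                + (1 - p) * rmean T p (\<lambda>F. g (E \<union> F)))"
    using insert by (simp add: rmean_add rmean_cmult)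
  finally show ?case
    using insert by (simp add: rmean_insert)
qed

lemma rmean_split:
  assumes "finite S" "T \<subseteq> S"
  shows "rmean S p g = rmean (S - T) p (\<lambda>E. rmean T p (\<lambda>F. g (E \<union> F)))"
proof -
  have "S = (S - T) \<union> T" using assms by auto
  then show ?thesis
    using rmean_union[of "S - T" T p g] assms finite_subset by (metis Diff_disjoint Int_commute finite_Diff)
qed

lemma rprob_split:
  assumes "finite S" "T \<subseteq> S"
  shows "rprob S p Q = rmean (S - T) p (\<lambda>E. rprob T p (\<lambda>F. Q (E \<union> F)))"
  unfolding rprob_def by (rule rmean_split[OF assms])

lemma rmean_restrict:
  assumes "finite S" "T \<subseteq> S"
  shows "rmean S p (\<lambda>E. g (E \<inter> T)) = rmean T p g"
proof -
  have "rmean S p (\<lambda>E. g (E \<inter> T)) = rmean (S - T) p (\<lambda>E. rmean T p (\<lambda>F. g ((E \<union> F) \<inter> T)))"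
    by (rule rmean_split[OF assms])
  also have "\<dots> = rmean (S - T) p (\<lambda>E. rmean T p g)"
  proof (intro rmean_cong)
    fix E F assume "E \<subseteq> S - T" "F \<subseteq> T"
    then have "(E \<union> F) \<inter> T = F" by auto
    then show "g ((E \<union> F) \<inter> T) = g F" by simp
  qed
  finally show ?thesis using assms by simp
qed

lemma rprob_restrict:
  assumes "finite S" "T \<subseteq> S"
  shows "rprob S p (\<lambda>E. Q (E \<inter> T)) = rprob T p Q"
  unfolding rprob_def by (rule rmean_restrict[OF assms])

lemma rprob_nonneg: "0 \<le> p \<Longrightarrow> p \<le> 1 \<Longrightarrow> 0 \<le> rprob S p Q"
  unfolding rprob_def by (rule rmean_nonneg) auto

lemma rprob_le_1: "finite S \<Longrightarrow> 0 \<le> p \<Longrightarrow> p \<le> 1 \<Longrightarrow> rprob S p Q \<le> 1"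
  unfolding rprob_def by (rule rmean_le_const) auto

lemma rprob_mono:
  assumes "0 \<le> p" "p \<le> 1" "\<And>E. E \<subseteq> S \<Longrightarrow> Q E \<Longrightarrow> R E"
  shows "rprob S p Q \<le> rprob S p R"
  unfolding rprob_def using assms by (intro rmean_mono) auto

lemma rprob_not: "finite S \<Longrightarrow> rprob S p (\<lambda>E. \<not> Q E) = 1 - rprob S p Q"
  using rmean_diff[of S p "\<lambda>_. 1" "\<lambda>E. of_bool (Q E)"] by (simp add: rprob_def of_bool_not_iff)

lemma rprob_subadd:
  assumes "0 \<le> p" "p \<le> 1" "\<And>E. E \<subseteq> S \<Longrightarrow> Q E \<Longrightarrow> R1 E \<or> R2 E"
  shows "rprob S p Q \<le> rprob S p R1 + rprob S p R2"
  unfolding rprob_def rmean_add[symmetric] using assms by (intro rmean_mono) (auto simp: of_bool_def)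

lemma rprob_union_bound:
  assumes "0 \<le> p" "p \<le> 1" "finite A" "\<And>E. E \<subseteq> S \<Longrightarrow> Q E \<Longrightarrow> \<exists>i\<in>A. R i E"
  shows "rprob S p Q \<le> (\<Sum>i\<in>A. rprob S p (R i))"
  unfolding rprob_def rmean_sum[symmetric]
proof (intro rmean_mono assms)
  fix E assume E: "E \<subseteq> S"
  show "(of_bool (Q E) :: real) \<le> (\<Sum>i\<in>A. of_bool (R i E))"
  proof (cases "Q E")
    case True
    then obtain i where "i \<in> A" "R i E" using assms E by blast
    then have "(of_bool (R i E) :: real) \<le> (\<Sum>i\<in>A. of_bool (R i E))"
      using assms by (intro member_le_sum) auto
    then show ?thesis using \<open>R i E\<close> True by simp
  qed (simp add: sum_nonneg)
qed

lemma rmean_card: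
  assumes "finite A"
  shows "rmean S p (\<lambda>E. real (card {x \<in> A. Q x E})) = (\<Sum>x\<in>A. rprob S p (Q x))"
proof -
  have "real (card {x \<in> A. Q x E}) = (\<Sum>x\<in>A. of_bool (Q x E))" for E
    using assms by (simp add: of_bool_def sum.If_cases Int_def)
  then show ?thesis by (simp add: rprob_def rmean_sum)
qed

lemma rprob_supset:
  assumes "finite S" "F \<subseteq> S"
  shows "rprob S p (\<lambda>E. F \<subseteq> E) = p ^ card F"
proof -
  have "rprob S p (\<lambda>E. F \<subseteq> E) = rprob S p (\<lambda>E. F \<subseteq> E \<inter> F)"
    by (rule rprob_cong) auto
  also have "\<dots> = rprob F p (\<lambda>E. F \<subseteq> E)"
    by (rule rprob_restrict[OF assms])
  also have "\<dots> = (\<Sum>E\<in>Pow F. if E = F then p ^ card F else 0)"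
    unfolding rprob_def rmean_def by (intro sum.cong) auto
  also have "\<dots> = p ^ card F" using assms finite_subset by (subst sum.delta) auto
  finally show ?thesis .
qed

lemma rprob_card_Int:
  assumes "finite S" "H \<subseteq> S"
  shows "rprob S p (\<lambda>E. card (E \<inter> H) = i)
       = real (card H choose i) * p ^ i * (1 - p) ^ (card H - i)"
proof -
  have fin: "finite H" using assms finite_subset by auto
  have "rprob S p (\<lambda>E. card (E \<inter> H) = i) = rprob H p (\<lambda>E. card E = i)"
    by (rule rprob_restrict[OF assms])
  also have "\<dots> = (\<Sum>E\<in>{E. E \<subseteq> H \<and> card E = i}. p ^ i * (1 - p) ^ (card H - i))"
    unfolding rprob_def rmean_def using fin
    by (intro sum.mono_neutral_cong_right) (auto simp: card_Diff_subset finite_subset)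
  finally show ?thesis using n_subsets[OF fin, of i] by simp
qed

lemma rprob_Int_nonempty:
  assumes "finite S" "H \<subseteq> S"
  shows "rprob S p (\<lambda>E. E \<inter> H \<noteq> {}) = 1 - (1 - p) ^ card H"
proof -
  have "rprob S p (\<lambda>E. E \<inter> H \<noteq> {}) = rprob S p (\<lambda>E. \<not> card (E \<inter> H) = 0)"
    using assms by (intro rprob_cong) (auto simp: finite_subset)
  also have "\<dots> = 1 - (1 - p) ^ card H"
    using assms by (simp only: rprob_not rprob_card_Int[OF assms]) simp
  finally show ?thesis .
qed

text \<open>Whether \<open>a\<close> is present is independent of \<open>E - {a}\<close>. A sum over
  the random edges thus becomes a sum over all possible edges, provided that each summand sees only
  the other edges.\<close>

lemma rmean_sum_edges:
  assumes "finite S"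
  shows "rmean S p (\<lambda>E. \<Sum>a\<in>E. h a (E - {a})) = (\<Sum>a\<in>S. p * rmean (S - {a}) p (h a))"
proof -
  have "rmean S p (\<lambda>E. \<Sum>a\<in>E. h a (E - {a})) = rmean S p (\<lambda>E. \<Sum>a\<in>S. if a \<in> E then h a (E - {a}) else 0)"
    using assms by (intro rmean_cong) (simp add: sum.If_cases Int_absorb1)
  also have "\<dots> = (\<Sum>a\<in>S. rmean S p (\<lambda>E. if a \<in> E then h a (E - {a}) else 0))"
    by (rule rmean_sum)
  also have "\<dots> = (\<Sum>a\<in>S. p * rmean (S - {a}) p (h a))"
  proof (rule sum.cong[OF refl])
    fix a assume a: "a \<in> S"
    have eq: "rmean S p (\<lambda>E. if a \<in> E then h a (E - {a}) else 0)
        = p * rmean (S - {a}) p (\<lambda>E. if a \<in> insert a E then h a (insert a E - {a}) else 0)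
          + (1 - p) * rmean (S - {a}) p (\<lambda>E. if a \<in> E then h a (E - {a}) else 0)"
      using rmean_insert[of "S - {a}" a p] a assms by (simp add: insert_absorb)
    have "rmean (S - {a}) p (\<lambda>E. if a \<in> insert a E then h a (insert a E - {a}) else 0) = rmean (S - {a}) p (h a)"
      by (rule rmean_cong) (metis Diff_insert_absorb insertI1 subset_Diff_insert)
    moreover have "rmean (S - {a}) p (\<lambda>E. if a \<in> E then h a (E - {a}) else 0) = rmean (S - {a}) p (\<lambda>_. 0)"
      by (rule rmean_cong) auto
    ultimately show "rmean S p (\<lambda>E. if a \<in> E then h a (E - {a}) else 0) = p * rmean (S - {a}) p (h a)"
      using eq assms by simp
  qed
  finally show ?thesis .
qed

lemma rmean_card_edges:
  assumes "finite S"
  shows "rmean S p (\<lambda>E. real (card E)) = p * real (card S)"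
  using rmean_sum_edges[OF assms, of p "\<lambda>_ _. 1"] assms by simp

section \<open>Markov, Efron-Stein and Chebyshev inequalities\<close>

lemma rmarkov:
  assumes "finite S" "0 \<le> p" "p \<le> 1" "c > 0" "\<And>E. E \<subseteq> S \<Longrightarrow> 0 \<le> g E"
  shows "rprob S p (\<lambda>E. c \<le> g E) \<le> rmean S p g / c"
proof -
  have "rprob S p (\<lambda>E. c \<le> g E) \<le> rmean S p (\<lambda>E. (1 / c) * g E)"
    unfolding rprob_def using assms by (intro rmean_mono) (auto simp: of_bool_def field_simps)
  then show ?thesis by (simp only: rmean_cmult) simp
qed

text \<open>Conditioning on one element splits the variance into the average of two conditional
  variances and \<open>p * (1 - p) * (m1 - m0)\<^sup>2\<close>, where \<open>m1\<close> and
  \<open>m0\<close> differ by at most \<open>c\<close>. The factor \<open>p\<close> is essential: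
  there are about \<open>n ^ r\<close> possible edges, but only order \<open>n\<close> after
  multiplication by \<open>p\<close>.\<close>

lemma rmean_efron_stein:
  assumes "finite S" "0 \<le> p" "p \<le> 1"
    and "\<And>E e. E \<subseteq> S \<Longrightarrow> e \<in> S \<Longrightarrow> e \<notin> E \<Longrightarrow> \<bar>g (insert e E) - g E\<bar> \<le> c"
  shows "rmean S p (\<lambda>E. (g E - rmean S p g)\<^sup>2) \<le> p * real (card S) * c\<^sup>2"
  using assms(1,4)
proof (induction S arbitrary: g rule: finite_induct)
  case empty
  then show ?case by simp
next
  case (insert e S)
  define g1 where "g1 E = g (insert e E)" for E
  define m1 where "m1 = rmean S p g1"
  define m0 where "m0 = rmean S p g"
  have m: "rmean (insert e S) p g = p * m1 + (1 - p) * m0"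
    using insert by (simp add: rmean_insert m1_def m0_def g1_def[abs_def])
  define m where "m = p * m1 + (1 - p) * m0"
  \<comment> \<open>The second moment about \<open>x\<close> is the variance plus the squared
    bias.\<close>
  have v: "rmean S p (\<lambda>E. (u E - x)\<^sup>2) = rmean S p (\<lambda>E. (u E - rmean S p u)\<^sup>2) + (rmean S p u - x)\<^sup>2"
    for u x
  proof -
    define y where "y = rmean S p u"
    have "(u E - x)\<^sup>2 = (u E - y)\<^sup>2 + ((2 * (y - x)) * u E - (2 * (y - x) * y - (y - x)\<^sup>2))" for E
      by (simp add: power2_eq_square algebra_simps)
    then have "rmean S p (\<lambda>E. (u E - x)\<^sup>2) = rmean S p (\<lambda>E. (u E - y)\<^sup>2)
        + (2 * (y - x) * y - (2 * (y - x) * y - (y - x)\<^sup>2))"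
      using insert(1) by (simp only: rmean_add rmean_diff rmean_cmult rmean_const y_def[symmetric])
    then show ?thesis by (simp add: y_def)
  qed
  have c: "c \<ge> 0" using insert(4)[of "{}" e] by simp
  have 1: "rmean S p (\<lambda>E. (g1 E - m1)\<^sup>2) \<le> p * real (card S) * c\<^sup>2"
    unfolding m1_def
  proof (rule insert(3))
    fix E a assume "E \<subseteq> S" "a \<in> S" "a \<notin> E"
    then show "\<bar>g1 (insert a E) - g1 E\<bar> \<le> c"
      using insert(4)[of "insert e E" a] insert(2) by (auto simp: g1_def insert_commute)
  qed
  have 0: "rmean S p (\<lambda>E. (g E - m0)\<^sup>2) \<le> p * real (card S) * c\<^sup>2"
    unfolding m0_def
  proof (rule insert(3))
    fix E a assume "E \<subseteq> S" "a \<in> S" "a \<notin> E"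
    then show "\<bar>g (insert a E) - g E\<bar> \<le> c"
      using insert(4)[of E a] by blast
  qed
  have d: "\<bar>m1 - m0\<bar> \<le> c"
  proof -
    have "m1 - m0 = rmean S p (\<lambda>E. g1 E - g E)" by (simp add: m1_def m0_def rmean_diff)
    moreover have bd: "\<bar>g1 E - g E\<bar> \<le> c" if "E \<subseteq> S" for E
      using insert(4)[of E e] insert(2) that unfolding g1_def by blast
    have "rmean S p (\<lambda>E. g1 E - g E) \<le> c"
      using bd by (intro rmean_le_const insert(1) assms(2,3)) (simp add: abs_le_iff)
    moreover have "- c \<le> rmean S p (\<lambda>E. g1 E - g E)"
      using bd by (intro rmean_ge_const insert(1) assms(2,3)) (smt (verit) abs_le_iff)
    ultimately show ?thesis by auto
  qed
  have "rmean (insert e S) p (\<lambda>E. (g E - m)\<^sup>2)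
      = p * rmean S p (\<lambda>E. (g1 E - m)\<^sup>2) + (1 - p) * rmean S p (\<lambda>E. (g E - m)\<^sup>2)"
    using insert by (simp add: rmean_insert g1_def)
  also have "\<dots> = p * (rmean S p (\<lambda>E. (g1 E - m1)\<^sup>2) + (m1 - m)\<^sup>2)
                + (1 - p) * (rmean S p (\<lambda>E. (g E - m0)\<^sup>2) + (m0 - m)\<^sup>2)"
    by (simp only: v[of g1 m] v[of g m] m1_def[symmetric] m0_def[symmetric])
  also have "\<dots> \<le> p * (p * real (card S) * c\<^sup>2 + (m1 - m)\<^sup>2)
                + (1 - p) * (p * real (card S) * c\<^sup>2 + (m0 - m)\<^sup>2)"
    using 1 0 assms(2,3) by (intro add_mono mult_left_mono) auto
  also have "\<dots> = p * real (card S) * c\<^sup>2 + p * (1 - p) * (m1 - m0)\<^sup>2"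
    unfolding m_def by algebra
  also have "\<dots> \<le> p * real (card S) * c\<^sup>2 + p * 1 * c\<^sup>2"
    using assms(2,3) d by (intro add_left_mono mult_mono) (auto intro!: abs_le_square_iff[THEN iffD1] mult_nonneg_nonneg)
  also have "\<dots> = p * real (card (insert e S)) * c\<^sup>2"
    using insert by (simp add: algebra_simps)
  finally show ?case by (simp add: m m_def)
qed

lemma rchebyshev:
  assumes "finite S" "0 \<le> p" "p \<le> 1" "t > 0" "rmean S p (\<lambda>E. (g E - x)\<^sup>2) \<le> v"
  shows "rprob S p (\<lambda>E. t \<le> \<bar>g E - x\<bar>) \<le> v / t\<^sup>2"
proof -
  have "rprob S p (\<lambda>E. t \<le> \<bar>g E - x\<bar>) \<le> rprob S p (\<lambda>E. t\<^sup>2 \<le> (g E - x)\<^sup>2)"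
    using assms by (intro rprob_mono) (auto simp: abs_le_square_iff[symmetric])
  also have "\<dots> \<le> rmean S p (\<lambda>E. (g E - x)\<^sup>2) / t\<^sup>2"
    using assms by (intro rmarkov) auto
  also have "\<dots> \<le> v / t\<^sup>2" using assms by (intro divide_right_mono) auto
  finally show ?thesis .
qed

section \<open>From probability mass functions to finite sums\<close>

lemma measure_bind_pmf:
  "measure_pmf.prob (bind_pmf M f) X = measure_pmf.expectation M (\<lambda>x. measure_pmf.prob (f x) X)"
proof -
  \<comment> \<open>A probability is the mass of \<open>True\<close> under the image by membership,
    which reduces the claim to \<open>pmf_bind\<close>.\<close>
  have "measure_pmf.prob N X = pmf (map_pmf (\<lambda>x. x \<in> X) N) True" for N
    by (simp add: pmf_map vimage_def)
  then show ?thesis by (simp add: map_bind_pmf pmf_bind)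
qed

lemma prob_Pi_bernoulli:
  assumes "finite S" "0 \<le> p" "p \<le> 1"
  shows "measure_pmf.prob (Pi_pmf S False (\<lambda>_. bernoulli_pmf p)) {f. Q {e \<in> S. f e}} = rprob S p Q"
  using assms(1)
proof (induction S arbitrary: Q rule: finite_induct)
  case empty
  then show ?case by (simp add: rprob_def indicator_def)
next
  case (insert e S)
  have "measure_pmf.prob (Pi_pmf (insert e S) False (\<lambda>_. bernoulli_pmf p)) {f. Q {e' \<in> insert e S. f e'}}
    = measure_pmf.prob (bernoulli_pmf p \<bind> (\<lambda>b. Pi_pmf S False (\<lambda>_. bernoulli_pmf p) \<bind> (\<lambda>f. return_pmf (f(e := b)))))
        {f. Q {e' \<in> insert e S. f e'}}"
    using insert by (simp add: Pi_pmf_insert')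
  also have "\<dots> = measure_pmf.expectation (bernoulli_pmf p) (\<lambda>b.
      measure_pmf.prob (Pi_pmf S False (\<lambda>_. bernoulli_pmf p) \<bind> (\<lambda>f. return_pmf (f(e := b)))) {f. Q {e' \<in> insert e S. f e'}})"
    by (rule measure_bind_pmf)
  also have "\<dots> = p * measure_pmf.prob (Pi_pmf S False (\<lambda>_. bernoulli_pmf p)) {f. Q (insert e {e' \<in> S. f e'})}
      + (1 - p) * measure_pmf.prob (Pi_pmf S False (\<lambda>_. bernoulli_pmf p)) {f. Q {e' \<in> S. f e'}}"
  proof -
    have *: "Pi_pmf S False (\<lambda>_. bernoulli_pmf p) \<bind> (\<lambda>f. return_pmf (f(e := b)))
        = map_pmf (\<lambda>f. f(e := b)) (Pi_pmf S False (\<lambda>_. bernoulli_pmf p))" for b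
      by (simp add: map_pmf_def)
    have 1: "(\<lambda>f. f(e := True)) -` {f. Q {e' \<in> insert e S. f e'}} = {f. Q (insert e {e' \<in> S. f e'})}"
    proof -
      have "{e' \<in> insert e S. (f(e := True)) e'} = insert e {e' \<in> S. f e'}" for f
        using insert by auto
      then show ?thesis by (simp only: vimage_def mem_Collect_eq)
    qed
    have 0: "(\<lambda>f. f(e := False)) -` {f. Q {e' \<in> insert e S. f e'}} = {f. Q {e' \<in> S. f e'}}"
    proof -
      have "{e' \<in> insert e S. (f(e := False)) e'} = {e' \<in> S. f e'}" for f
        using insert by auto
      then show ?thesis by (simp only: vimage_def mem_Collect_eq)
    qed
    define X where "X = {f. Q {e' \<in> insert e S. f e'}}"
    have "measure_pmf.expectation (bernoulli_pmf p) h = p * h True + (1 - p) * h False" for h :: "bool \<Rightarrow> real"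
      using assms(2,3) by (subst integral_measure_pmf[of UNIV]) (simp_all add: UNIV_bool)
    then show ?thesis
      using 1 0 unfolding X_def[symmetric] * by (simp add: measure_map_pmf)
  qed
  also have "\<dots> = rprob (insert e S) p Q"
    using insert.hyps insert.IH[of Q] insert.IH[of "\<lambda>E. Q (insert e E)"] by (simp add: rprob_def rmean_insert)
  finally show ?case .
qed

lemma prob_random_hypergraph:
  assumes "0 \<le> p" "p \<le> 1"
  shows "measure_pmf.prob (random_hypergraph r n p) {H. Q H}
       = rprob (r_subsets r n) p (\<lambda>E. Q \<lparr>verts = {1..n}, edges = E\<rparr>)"
proof -
  have "r_subsets r n \<subseteq> Pow {1..n}" by (auto simp: r_subsets_def)
  then have "finite (r_subsets r n)" using finite_subset by blast
  from prob_Pi_bernoulli[OF this assms, of "\<lambda>E. Q \<lparr>verts = {1..n}, edges = E\<rparr>"] show ?thesis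
    by (simp add: random_hypergraph_def vimage_def)
qed

section \<open>Binomial asymptotics and the fixed point equation\<close>

lemma binomial_le_power: "n choose k \<le> n ^ k"
proof (cases "k \<le> n")
  case True
  then show ?thesis by (rule binomial_le_pow)
qed (simp add: binomial_eq_0)

text \<open>Written as generalised binomial coefficients, the quotient is a product of
  \<open>k\<close> factors that each tend to \<open>t\<close>; this form also covers
  \<open>m x < k\<close>.\<close>

lemma tendsto_binomial_ratio:
  assumes N: "filterlim N at_top G"
    and m: "((\<lambda>x. real (m x) / real (N x)) \<longlongrightarrow> t) G"
  shows "((\<lambda>x. real (m x choose k) / real (N x choose k)) \<longlongrightarrow> t ^ k) G"
proof -
  have N': "filterlim (\<lambda>x. real (N x)) at_top G"
    using N by (rule filterlim_compose[OF filterlim_real_sequentially])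
  have factor: "((\<lambda>x. (real (m x) - real i) / (real (N x) - real i)) \<longlongrightarrow> t) G" for i
  proof -
    have "((\<lambda>x. (real (m x) / real (N x) - real i / real (N x)) / (1 - real i / real (N x))) \<longlongrightarrow> (t - 0) / (1 - 0)) G"
      by (intro tendsto_intros m real_tendsto_divide_at_top[OF tendsto_const N']) simp
    moreover have "\<forall>\<^sub>F x in G. (real (m x) / real (N x) - real i / real (N x)) / (1 - real i / real (N x))
        = (real (m x) - real i) / (real (N x) - real i)"
      using eventually_compose_filterlim[OF eventually_gt_at_top[of i] N]
      by eventually_elim (simp add: field_simps)
    ultimately show ?thesis by (auto elim: tendsto_cong[THEN iffD1, rotated])
  qed
  have eq: "real (m x choose k) / real (N x choose k)
      = (\<Prod>i=0..<k. (real (m x) - real i) / (real (N x) - real i))" for x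
    by (simp add: binomial_gbinomial gbinomial_prod_rev prod_dividef)
  have "((\<lambda>x. \<Prod>i=0..<k. (real (m x) - real i) / (real (N x) - real i)) \<longlongrightarrow> (\<Prod>i=0..<k. t)) G"
    by (intro tendsto_prod factor)
  then show ?thesis by (simp add: eq)
qed

text \<open>Sandwiched by \<open>exp (- (p / (1 - p))) \<le> 1 - p \<le> exp (- p)\<close>. As
  \<open>M\<close> enters only through \<open>p * M\<close>, it may stay bounded when
  \<open>\<mu> = 0\<close>, as happens when the giant part is empty.\<close>

lemma tendsto_one_minus_power:
  assumes p: "(p \<longlongrightarrow> 0) G" "\<forall>\<^sub>F x in G. 0 \<le> p x" and M: "((\<lambda>x. p x * real (M x)) \<longlongrightarrow> \<mu>) G"
  shows "((\<lambda>x. (1 - p x) ^ M x) \<longlongrightarrow> exp (- \<mu>)) G"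
proof (rule tendsto_sandwich)
  have p1: "\<forall>\<^sub>F x in G. p x < 1" using p(1) by (rule order_tendstoD) simp
  show "\<forall>\<^sub>F x in G. exp (- (p x * real (M x) / (1 - p x))) \<le> (1 - p x) ^ M x"
    using p1 p(2)
  proof eventually_elim
    case (elim x)
    have "1 / (1 - p x) = 1 + p x / (1 - p x)" using elim by (simp add: field_simps)
    also have "\<dots> \<le> exp (p x / (1 - p x))" by (rule exp_ge_add_one_self)
    finally have "exp (- (p x / (1 - p x))) \<le> 1 - p x"
      using elim by (simp add: exp_minus field_simps)
    then have "exp (- (p x / (1 - p x))) ^ M x \<le> (1 - p x) ^ M x" by (intro power_mono) auto
    then show ?case by (simp add: exp_of_nat_mult[symmetric] mult_ac)
  qed
  show "\<forall>\<^sub>F x in G. (1 - p x) ^ M x \<le> exp (- (p x * real (M x)))"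
    using p1
  proof eventually_elim
    case (elim x)
    have "(1 - p x) ^ M x \<le> exp (- p x) ^ M x"
      using elim exp_ge_add_one_self[of "- p x"] by (intro power_mono) auto
    then show ?case by (simp add: exp_of_nat_mult[symmetric] mult_ac)
  qed
  have "((\<lambda>x. exp (- (p x * real (M x) / (1 - p x)))) \<longlongrightarrow> exp (- (\<mu> / (1 - 0)))) G"
    by (intro tendsto_intros p M) simp
  then show "((\<lambda>x. exp (- (p x * real (M x) / (1 - p x)))) \<longlongrightarrow> exp (- \<mu>)) G" by simp
  show "((\<lambda>x. exp (- (p x * real (M x)))) \<longlongrightarrow> exp (- \<mu>)) G"
    by (intro tendsto_intros M)
qed

text \<open>The Poisson limit theorem, with \<open>\<mu> = 0\<close> included for the subcritical
  case.\<close>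

lemma tendsto_binomial_poisson:
  assumes p: "(p \<longlongrightarrow> 0) G" "\<forall>\<^sub>F x in G. 0 \<le> p x" and M: "((\<lambda>x. p x * real (M x)) \<longlongrightarrow> \<mu>) G"
  shows "((\<lambda>x. real (M x choose i) * p x ^ i * (1 - p x) ^ (M x - i)) \<longlongrightarrow> \<mu> ^ i / fact i * exp (- \<mu>)) G"
proof -
  have p1: "\<forall>\<^sub>F x in G. p x < 1" using p(1) by (rule order_tendstoD) simp
  have "((\<lambda>x. (\<Prod>j=0..<i. p x * real (M x) - real j * p x) / fact i * (1 - p x) ^ M x / (1 - p x) ^ i)
      \<longlongrightarrow> (\<Prod>j=0..<i. \<mu> - real j * 0) / fact i * exp (- \<mu>) / (1 - 0) ^ i) G"
    by (intro tendsto_intros tendsto_one_minus_power p M) simp_all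
  moreover have "\<forall>\<^sub>F x in G. (\<Prod>j=0..<i. p x * real (M x) - real j * p x) / fact i * (1 - p x) ^ M x / (1 - p x) ^ i
      = real (M x choose i) * p x ^ i * (1 - p x) ^ (M x - i)"
    using p1
  proof eventually_elim
    case (elim x)
    have "(\<Prod>j=0..<i. p x * real (M x) - real j * p x) = (\<Prod>j=0..<i. p x) * (\<Prod>j=0..<i. real (M x) - real j)"
      unfolding prod.distrib[symmetric] by (intro prod.cong) (auto simp: algebra_simps)
    then have *: "(\<Prod>j=0..<i. p x * real (M x) - real j * p x) / fact i = real (M x choose i) * p x ^ i"
      by (simp add: binomial_gbinomial gbinomial_prod_rev)
    show ?case
    proof (cases "i \<le> M x")
      case True
      then have "(1 - p x) ^ M x / (1 - p x) ^ i = (1 - p x) ^ (M x - i)"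
        using elim by (simp add: power_diff)
      then show ?thesis unfolding * by (metis times_divide_eq_right)
    next
      case False
      then show ?thesis unfolding * by (simp add: binomial_eq_0)
    qed
  qed
  ultimately have "((\<lambda>x. real (M x choose i) * p x ^ i * (1 - p x) ^ (M x - i))
      \<longlongrightarrow> (\<Prod>j=0..<i. \<mu> - real j * 0) / fact i * exp (- \<mu>) / (1 - 0) ^ i) G"
    by (rule tendsto_cong[THEN iffD1, rotated])
  then show ?thesis by simp
qed

text \<open>Asymptotic statements refer to a filter on pairs of a vertex set and an edge probability. They
  thereby transfer uniformly to the hypergraphs obtained by deleting a bounded number of vertices.\<close>

definition crit :: "nat \<Rightarrow> real \<Rightarrow> ('a set \<times> real) filter" where
  "crit r d = filtercomap (\<lambda>(V, p). (card V, p * real ((card V - 1) choose (r - 1)))) (at_top \<times>\<^sub>F nhds d)"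

lemma filterlim_crit_iff:
  "filterlim (\<lambda>x. (V x, p x)) (crit r d) G \<longleftrightarrow>
     filterlim (\<lambda>x. card (V x)) at_top G \<and> ((\<lambda>x. p x * real ((card (V x) - 1) choose (r - 1))) \<longlongrightarrow> d) G"
  unfolding crit_def filterlim_filtercomap_iff
  by (auto simp: o_def intro: filterlim_Pair dest: filterlim_compose[OF filterlim_fst] filterlim_compose[OF filterlim_snd])

lemma
  filterlim_crit_card: "filterlim (\<lambda>x. card (fst x)) at_top (crit r d)" and
  tendsto_crit_p: "((\<lambda>x. snd x * real ((card (fst x) - 1) choose (r - 1))) \<longlongrightarrow> d) (crit r d)"
  using filterlim_crit_iff[of fst snd r d "crit r d"] by (auto simp: filterlim_ident)

text \<open>The thresholds see \<open>V\<close> only through its cardinality, so they serve all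
  vertex sets of that size at once. This uniformity is what makes deletion of arbitrary vertices
  possible.\<close>

lemma eventually_crit_iff:
  "eventually P (crit r d) \<longleftrightarrow>
     (\<exists>n \<delta>. \<delta> > 0 \<and> (\<forall>V p. n \<le> card V \<and> \<bar>p * real ((card V - 1) choose (r - 1)) - d\<bar> < \<delta> \<longrightarrow> P (V, p)))"
proof
  assume "eventually P (crit r d)"
  then obtain Q where Q: "eventually Q (at_top \<times>\<^sub>F nhds d)"
      "\<forall>V p. Q (card V, p * real ((card V - 1) choose (r - 1))) \<longrightarrow> P (V, p)"
    unfolding crit_def eventually_filtercomap by auto
  from Q(1) obtain A B where AB: "eventually A at_top" "eventually B (nhds d)" "\<And>x y. A x \<Longrightarrow> B y \<Longrightarrow> Q (x, y)"
    unfolding eventually_prod_filter by auto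
  from AB(1) obtain n where "\<And>x. n \<le> x \<Longrightarrow> A x" unfolding eventually_at_top_linorder by auto
  moreover from AB(2) obtain \<delta> where "\<delta> > 0" "\<And>y. \<bar>y - d\<bar> < \<delta> \<Longrightarrow> B y"
    unfolding eventually_nhds_metric dist_real_def by auto
  ultimately show "\<exists>n \<delta>. \<delta> > 0 \<and> (\<forall>V p. n \<le> card V \<and> \<bar>p * real ((card V - 1) choose (r - 1)) - d\<bar> < \<delta> \<longrightarrow> P (V, p))"
    using AB(3) Q(2) by blast
next
  assume "\<exists>n \<delta>. \<delta> > 0 \<and> (\<forall>V p. n \<le> card V \<and> \<bar>p * real ((card V - 1) choose (r - 1)) - d\<bar> < \<delta> \<longrightarrow> P (V, p))"
  then obtain n \<delta> where nd: "\<delta> > 0" "\<And>V p. n \<le> card V \<Longrightarrow> \<bar>p * real ((card V - 1) choose (r - 1)) - d\<bar> < \<delta> \<Longrightarrow> P (V, p)"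
    by blast
  have "\<forall>\<^sub>F x :: 'a set \<times> real in crit r d. n \<le> card (fst x)"
    using filterlim_crit_card unfolding filterlim_at_top by blast
  moreover have "\<forall>\<^sub>F x :: 'a set \<times> real in crit r d. \<bar>snd x * real ((card (fst x) - 1) choose (r - 1)) - d\<bar> < \<delta>"
    using tendstoD[OF tendsto_crit_p nd(1)] by (simp add: dist_real_def)
  ultimately show "eventually P (crit r d)"
    by eventually_elim (metis nd(2) prod.collapse)
qed

lemma tendsto_shift_ratio:
  assumes "filterlim N at_top G"
  shows "((\<lambda>x. real (N x - i) / real (N x)) \<longlongrightarrow> 1) G"
proof -
  have N': "filterlim (\<lambda>x. real (N x)) at_top G"
    using assms by (rule filterlim_compose[OF filterlim_real_sequentially])
  have "((\<lambda>x. 1 - real i / real (N x)) \<longlongrightarrow> 1 - 0) G"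
    by (intro tendsto_intros real_tendsto_divide_at_top[OF tendsto_const N'])
  moreover have "\<forall>\<^sub>F x in G. 1 - real i / real (N x) = real (N x - i) / real (N x)"
    using eventually_compose_filterlim[OF eventually_gt_at_top[of i] assms]
    by eventually_elim (simp add: field_simps of_nat_diff)
  ultimately show ?thesis by (auto elim: tendsto_cong[THEN iffD1, rotated])
qed

lemma filterlim_minus_const_nat:
  fixes N :: "'x \<Rightarrow> nat"
  assumes "filterlim N at_top G"
  shows "filterlim (\<lambda>x. N x - i) at_top G"
  using filterlim_compose[OF filterlim_minus_const_nat_at_top assms] .

lemma tendsto_mult_choose:
  assumes N: "filterlim N at_top G" and L: "((\<lambda>x. p x * real (N x choose k)) \<longlongrightarrow> d) G"
    and m: "((\<lambda>x. real (m x) / real (N x)) \<longlongrightarrow> t) G"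
  shows "((\<lambda>x. p x * real (m x choose k)) \<longlongrightarrow> d * t ^ k) G"
proof -
  have "((\<lambda>x. p x * real (N x choose k) * (real (m x choose k) / real (N x choose k))) \<longlongrightarrow> d * t ^ k) G"
    by (intro tendsto_mult L tendsto_binomial_ratio N m)
  moreover have "\<forall>\<^sub>F x in G. p x * real (N x choose k) * (real (m x choose k) / real (N x choose k)) = p x * real (m x choose k)"
    using eventually_compose_filterlim[OF eventually_ge_at_top[of k] N]
    by eventually_elim simp
  ultimately show ?thesis by (rule tendsto_cong[THEN iffD1, rotated])
qed

text \<open>Removing \<open>i\<close> vertices changes the normalising binomial coefficient by a
  factor tending to 1, and only the finitely many values \<open>i \<le> m\<close> occur.\<close>

lemma eventually_crit_Diff:
  assumes "eventually P (crit r d)"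
  shows "\<forall>\<^sub>F (V, p) in crit r d. \<forall>X\<subseteq>V. card X \<le> m \<longrightarrow> P (V - X, p)"
proof -
  from assms obtain n \<delta> where nd: "\<delta> > 0"
    "\<And>V p. n \<le> card V \<Longrightarrow> \<bar>p * real ((card V - 1) choose (r - 1)) - d\<bar> < \<delta> \<Longrightarrow> P (V, p)"
    unfolding eventually_crit_iff by blast
  have i: "\<forall>\<^sub>F x :: 'a set \<times> real in crit r d. n \<le> card (fst x) - i \<and> \<bar>snd x * real ((card (fst x) - i - 1) choose (r - 1)) - d\<bar> < \<delta>" for i
  proof (rule eventually_conj)
    show "\<forall>\<^sub>F x :: 'a set \<times> real in crit r d. n \<le> card (fst x) - i"
      using filterlim_minus_const_nat[OF filterlim_crit_card, of i r d] unfolding filterlim_at_top by blast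
    have "((\<lambda>x::'a set \<times> real. snd x * real ((card (fst x) - 1 - i) choose (r - 1))) \<longlongrightarrow> d * 1 ^ (r - 1)) (crit r d)"
      by (rule tendsto_mult_choose[OF filterlim_minus_const_nat[OF filterlim_crit_card] tendsto_crit_p])
         (rule tendsto_shift_ratio[OF filterlim_minus_const_nat[OF filterlim_crit_card]])
    from tendstoD[OF this nd(1)]
    show "\<forall>\<^sub>F x :: 'a set \<times> real in crit r d. \<bar>snd x * real ((card (fst x) - i - 1) choose (r - 1)) - d\<bar> < \<delta>"
      by (simp add: dist_real_def)
  qed
  have "\<forall>\<^sub>F x :: 'a set \<times> real in crit r d. \<forall>i\<in>{..m}. n \<le> card (fst x) - i \<and> \<bar>snd x * real ((card (fst x) - i - 1) choose (r - 1)) - d\<bar> < \<delta>"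
    by (rule eventually_ball_finite) (use i in auto)
  moreover have "\<forall>\<^sub>F x :: 'a set \<times> real in crit r d. 0 < card (fst x)"
    by (rule eventually_compose_filterlim[OF eventually_gt_at_top filterlim_crit_card])
  ultimately show ?thesis
  proof eventually_elim
    case (elim x)
    obtain V p where x: "x = (V, p)" by (cases x)
    show ?case unfolding x prod.case
    proof (intro allI impI)
      fix X assume X: "X \<subseteq> V" "card X \<le> m"
      have "finite V" using elim(2) unfolding x by (simp add: card_gt_0_iff)
      then have "card (V - X) = card V - card X" using X by (meson card_Diff_subset finite_subset)
      then show "P (V - X, p)" using nd(2)[of "V - X" p] elim(1) X x by auto
    qed
  qed
qed

abbreviation admissible :: "nat \<Rightarrow> real \<Rightarrow> 'a set \<Rightarrow> real \<Rightarrow> bool" where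
  "admissible r c V p \<equiv> finite V \<and> 0 < p \<and> p < 1 \<and> p * real (card V) ^ (r - 1) \<le> c"

lemma eventually_crit_bound:
  assumes "r \<ge> 2" "d > 0"
  obtains c where "c > 0"
    "\<forall>\<^sub>F (V :: 'a set, p) in crit r d. admissible r c V p"
proof -
  \<comment> \<open>From \<open>((n - 1) / (r - 1)) ^ (r - 1) \<le> (n - 1) choose (r - 1)\<close>
    and \<open>n / 2 \<le> n - 1\<close>, as \<open>p\<close> times this binomial coefficient is
    eventually below \<open>d + 1\<close>.\<close>
  define c where "c = (2 * real (r - 1)) ^ (r - 1) * (d + 1)"
  have c: "c > 0" using assms by (simp add: c_def)
  have 1: "\<forall>\<^sub>F x :: 'a set \<times> real in crit r d. \<bar>snd x * real ((card (fst x) - 1) choose (r - 1)) - d\<bar> < min d 1"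
    using tendstoD[OF tendsto_crit_p, of "min d 1"] assms by (simp add: dist_real_def)
  \<comment> \<open>Having more than \<open>c\<close> vertices yields \<open>p < 1\<close>, because
    \<open>p * n \<le> p * n ^ (r - 1) \<le> c\<close>.\<close>
  have 2: "\<forall>\<^sub>F x :: 'a set \<times> real in crit r d. max (r + 2) (nat \<lceil>c\<rceil> + 1) \<le> card (fst x)"
    by (rule eventually_compose_filterlim[OF eventually_ge_at_top filterlim_crit_card])
  have "\<forall>\<^sub>F (V :: 'a set, p) in crit r d. admissible r c V p"
    using 1 2
  proof eventually_elim
    case (elim x)
    obtain V p where x: "x = (V, p)" by (cases x)
    define N where "N = card V"
    have N: "N \<ge> r + 2" "real N > c" using elim(2) x unfolding N_def by auto linarith
    have fin: "finite V" using N(1) unfolding N_def by (metis add_2_eq_Suc' card.infinite not_less_eq_eq zero_le)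
    have pC: "p * real ((N - 1) choose (r - 1)) > 0" "p * real ((N - 1) choose (r - 1)) \<le> d + 1"
      using elim(1) assms unfolding x N_def by auto
    have p0: "p > 0" using pC(1) by (simp add: zero_less_mult_iff)
    have "real N ^ (r - 1) = (2 * real (r - 1)) ^ (r - 1) * (real N / (2 * real (r - 1))) ^ (r - 1)"
      using assms by (simp add: power_divide power_mult_distrib)
    also have "\<dots> \<le> (2 * real (r - 1)) ^ (r - 1) * (real (N - 1) / real (r - 1)) ^ (r - 1)"
    proof -
      have "real N / 2 \<le> real (N - 1)" using N by linarith
      then have "real N / 2 / real (r - 1) \<le> real (N - 1) / real (r - 1)" by (intro divide_right_mono) auto
      then show ?thesis by (intro mult_left_mono power_mono) auto
    qed
    also have "\<dots> \<le> (2 * real (r - 1)) ^ (r - 1) * real ((N - 1) choose (r - 1))"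
      using N by (intro mult_left_mono binomial_ge_n_over_k_pow_k) auto
    finally have "p * real N ^ (r - 1) \<le> (2 * real (r - 1)) ^ (r - 1) * (p * real ((N - 1) choose (r - 1)))"
      using p0 by (simp add: mult.left_commute)
    also have "\<dots> \<le> c" unfolding c_def using pC by (intro mult_left_mono) auto
    finally have b: "p * real N ^ (r - 1) \<le> c" .
    have "p * real N \<le> p * real N ^ (r - 1)"
      using p0 N assms by (intro mult_left_mono) (auto intro: self_le_power)
    then have "p * real N < real N * 1" using b N by linarith
    then have "p < 1" using N by (simp add: mult.commute)
    then show ?case using fin p0 b unfolding x N_def by simp
  qed
  with c show thesis by (rule that)
qed

text \<open>The limiting probability that a new vertex lies in an edge meeting a given vertex set of
  density \<open>z\<close>.\<close>

definition surv :: "nat \<Rightarrow> real \<Rightarrow> real \<Rightarrow> real" where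
  "surv r d z = 1 - core_fun r d (1 - z)"

section \<open>The map \<open>surv\<close> on both sides of its largest fixed point\<close>

lemma surv_rho_star: "surv r d (rho_star r d) = rho_star r d"
  using rho_star_greatest(1)[of r d] by (simp add: surv_def)

lemma isCont_surv: "isCont (surv r d) z"
  unfolding surv_def core_fun_def by (intro continuous_intros)

lemma surv_bounds: "d \<ge> 0 \<Longrightarrow> 0 \<le> z \<Longrightarrow> z \<le> 1 \<Longrightarrow> 0 \<le> surv r d z \<and> surv r d z < 1"
  unfolding surv_def core_fun_def by (auto intro!: mult_nonneg_nonneg simp: power_le_one)

text \<open>Otherwise the intermediate value theorem on \<open>{z..1}\<close>, together with
  \<open>surv r d 1 \<le> 1\<close>, gives a fixed point above the largest one.\<close>

lemma surv_less:
  assumes "d > 0" "rho_star r d < z" "z \<le> 1"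
  shows "surv r d z < z"
proof (rule ccontr)
  assume "\<not> surv r d z < z"
  moreover have "surv r d 1 \<le> 1" using surv_bounds[of d 1 r] assms by simp
  moreover have "continuous_on {z..1} (\<lambda>x. x - surv r d x)"
    unfolding surv_def core_fun_def by (intro continuous_intros)
  ultimately have "\<exists>x. z \<le> x \<and> x \<le> 1 \<and> x - surv r d x = 0"
    using assms by (intro IVT') auto
  then obtain x where "z \<le> x" "x \<le> 1" "x = surv r d x" by auto
  then have "x \<le> rho_star r d"
    by (intro rho_star_greatest(4)) (auto simp: surv_def)
  then show False using assms \<open>z \<le> x\<close> by simp
qed

text \<open>The tangent of the exponential at \<open>- (\<theta> * c)\<close> is compared with the
  function at 0, where the inequality is strict, and at \<open>- c\<close>. The convex combination
  of the two tangent values is the value at the point of contact.\<close>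

lemma exp_convex_strict:
  fixes c \<theta> :: real
  assumes "c > 0" "0 < \<theta>" "\<theta> < 1"
  shows "exp (- (\<theta> * c)) < 1 - \<theta> + \<theta> * exp (- c)"
proof -
  define E where "E = exp (- (\<theta> * c))"
  have E: "E > 0" by (simp add: E_def)
  have "1 + \<theta> * c < exp (\<theta> * c)"
    using exp_minus_greater[of "- (\<theta> * c)"] assms by simp
  then have 1: "E * (1 + \<theta> * c) < 1"
    by (simp add: E_def exp_minus field_simps)
  have "1 - (1 - \<theta>) * c \<le> exp (- ((1 - \<theta>) * c))" using exp_ge_add_one_self[of "- ((1 - \<theta>) * c)"] by simp
  then have "E * (1 - (1 - \<theta>) * c) \<le> E * exp (- ((1 - \<theta>) * c))" using E by (intro mult_left_mono) auto
  also have "\<dots> = exp (- c)" by (simp add: E_def exp_add[symmetric] algebra_simps)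
  finally have 2: "E * (1 - (1 - \<theta>) * c) \<le> exp (- c)" .
  have "E = (1 - \<theta>) * (E * (1 + \<theta> * c)) + \<theta> * (E * (1 - (1 - \<theta>) * c))"
    by (simp add: algebra_simps)
  also have "\<dots> < (1 - \<theta>) * 1 + \<theta> * exp (- c)"
    using 1 2 assms by (intro add_less_le_mono mult_strict_left_mono mult_left_mono) auto
  finally show ?thesis by (simp add: E_def)
qed

text \<open>On the unit interval \<open>surv\<close> is concave, vanishes at 0 and fixes
  \<open>rho_star r d\<close>, so it lies above the chord. Convexity of the power gives the weak
  inequality, the exponential the strict one.\<close>

lemma surv_greater:
  assumes "r \<ge> 2" "d > 0" "rho_star r d > 0" "0 < \<theta>" "\<theta> < 1"
  shows "\<theta> * rho_star r d < surv r d (\<theta> * rho_star r d)"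
proof -
  define \<rho> where "\<rho> = rho_star r d"
  define k where "k = r - 1"
  have \<rho>: "0 < \<rho>" "\<rho> \<le> 1" using assms rho_star_greatest(3)[of r d] by (auto simp: \<rho>_def)
  have k: "k \<ge> 1" using assms by (simp add: k_def)
  have conv: "(1 - \<theta> * \<rho>) ^ k \<le> (1 - \<theta>) + \<theta> * (1 - \<rho>) ^ k"
    using k
  proof (induction k rule: dec_induct)
    case base
    then show ?case by (simp add: algebra_simps)
  next
    case (step n)
    have "(1 - \<theta> * \<rho>) ^ Suc n \<le> (1 - \<theta> * \<rho>) * ((1 - \<theta>) + \<theta> * (1 - \<rho>) ^ n)"
      using step \<rho> assms by (auto intro!: mult_left_mono simp: mult_le_one)
    also have "\<dots> = (1 - \<theta>) + \<theta> * (1 - \<rho>) ^ Suc n - \<theta> * (1 - \<theta>) * \<rho> * (1 - (1 - \<rho>) ^ n)"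
      by (simp add: algebra_simps)
    also have "\<dots> \<le> (1 - \<theta>) + \<theta> * (1 - \<rho>) ^ Suc n"
      using \<rho> assms by (auto intro!: mult_nonneg_nonneg simp: power_le_one)
    finally show ?case .
  qed
  define g where "g = 1 - (1 - \<rho>) ^ k"
  have "(1 - \<rho>) ^ k \<le> (1 - \<rho>) ^ 1" using \<rho> k by (intro power_decreasing) auto
  then have g: "g > 0" using \<rho> by (simp add: g_def)
  have fp: "\<rho> = 1 - exp (- (d * g))"
    using surv_rho_star[of r d] by (simp add: surv_def core_fun_def \<rho>_def g_def k_def)
  have "exp (- d * (1 - (1 - \<theta> * \<rho>) ^ k)) \<le> exp (- (\<theta> * (d * g)))"
  proof -
    have "\<theta> * g \<le> 1 - (1 - \<theta> * \<rho>) ^ k" using conv by (simp add: g_def algebra_simps)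
    then have "d * (\<theta> * g) \<le> d * (1 - (1 - \<theta> * \<rho>) ^ k)" using assms by (intro mult_left_mono) auto
    then show ?thesis by (simp add: mult_ac)
  qed
  also have "\<dots> < 1 - \<theta> + \<theta> * exp (- (d * g))"
    using g assms by (intro exp_convex_strict) auto
  also have "\<dots> = 1 - \<theta> * \<rho>" unfolding fp by (simp add: algebra_simps)
  finally show ?thesis by (simp add: surv_def core_fun_def \<rho>_def k_def)
qed

section \<open>Components and exposing a vertex\<close>

text \<open>The reflexive closure makes a vertex without edges a component of size 1.\<close>

definition component :: "'a set set \<Rightarrow> 'a \<Rightarrow> 'a set" where
  "component E v = {u. (v, u) \<in> {(x, y). \<exists>e\<in>E. x \<in> e \<and> y \<in> e}\<^sup>*}"

definition rsub :: "nat \<Rightarrow> 'a set \<Rightarrow> 'a set set" where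
  "rsub r V = {e. e \<subseteq> V \<and> card e = r}"

definition big :: "'a set \<Rightarrow> 'a set set \<Rightarrow> nat \<Rightarrow> 'a set" where
  "big V E K = {v \<in> V. K \<le> card (component E v)}"

lemma component_refl [simp]: "v \<in> component E v"
  by (simp add: component_def)

lemma component_trans: "u \<in> component E v \<Longrightarrow> w \<in> component E u \<Longrightarrow> w \<in> component E v"
  unfolding component_def by (auto intro: rtrancl_trans)

lemma component_sym: "u \<in> component E v \<Longrightarrow> v \<in> component E u"
proof -
  have "sym ({(x, y). \<exists>e\<in>E. x \<in> e \<and> y \<in> e}\<^sup>*)"
    by (rule sym_rtrancl) (auto simp: sym_def)
  then show "u \<in> component E v \<Longrightarrow> v \<in> component E u"
    unfolding component_def by (auto dest: symD)
qed

lemma component_eq: "u \<in> component E v \<Longrightarrow> component E u = component E v"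
  by (blast intro: component_trans component_sym)

lemma component_mono: "E \<subseteq> E' \<Longrightarrow> component E v \<subseteq> component E' v"
  unfolding component_def by (auto elim!: rtrancl_mono[THEN subsetD, rotated])

lemma component_edge: "e \<in> E \<Longrightarrow> x \<in> e \<Longrightarrow> x \<in> component E v \<Longrightarrow> e \<subseteq> component E v"
proof
  fix y assume *: "e \<in> E" "x \<in> e" "x \<in> component E v" "y \<in> e"
  then have "y \<in> component E x" unfolding component_def by blast
  with * show "y \<in> component E v" by (blast intro: component_trans)
qed

text \<open>The induction principle for components: upper bounds on a component are proved by
  exhibiting a set closed under meeting edges, not by following paths.\<close>

lemma component_closed:
  assumes "v \<in> X" "\<And>e. e \<in> E \<Longrightarrow> e \<inter> X \<noteq> {} \<Longrightarrow> e \<subseteq> X"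
  shows "component E v \<subseteq> X"
proof
  fix u assume "u \<in> component E v"
  then have "(v, u) \<in> {(x, y). \<exists>e\<in>E. x \<in> e \<and> y \<in> e}\<^sup>*" by (simp add: component_def)
  then show "u \<in> X" by (induction rule: rtrancl_induct) (use assms in blast)+
qed

lemma component_subset:
  assumes "E \<subseteq> rsub r V" "v \<in> V"
  shows "component E v \<subseteq> V"
  using assms by (intro component_closed) (auto simp: rsub_def)

lemma finite_rsub [simp]: "finite V \<Longrightarrow> finite (rsub r V)"
  by (rule finite_subset[of _ "Pow V"]) (auto simp: rsub_def)

lemma rsub_mono: "U \<subseteq> V \<Longrightarrow> rsub r U \<subseteq> rsub r V"
  by (auto simp: rsub_def)

lemma big_subset: "big V E K \<subseteq> V"
  by (auto simp: big_def)

lemma big_mono: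
  assumes "finite V'" "E' \<subseteq> rsub r V'" "V \<subseteq> V'" "E \<subseteq> E'"
  shows "big V E K \<subseteq> big V' E' K"
proof
  fix v assume v: "v \<in> big V E K"
  \<comment> \<open>Finiteness matters, since an infinite component would have cardinality
    0.\<close>
  have "finite (component E' v)"
    using component_subset[OF assms(2), of v] v assms(1,3) by (auto simp: big_def intro: finite_subset[of _ V'])
  then show "v \<in> big V' E' K"
    using v assms component_mono[OF assms(4), of v] card_mono[of "component E' v" "component E v"]
    by (auto simp: big_def)
qed

text \<open>A vertex that becomes big lay in a component with fewer than \<open>K\<close> vertices
  that meets \<open>e\<close>, and \<open>e\<close> meets at most \<open>r\<close>
  components.\<close>

lemma card_big_insert:
  assumes V: "finite V" "E \<subseteq> rsub r V" "e \<in> rsub r V"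
  shows "card (big V (insert e E) K - big V E K) \<le> r * K"
proof -
  have fe: "finite e" "card e = r" "e \<subseteq> V" using V finite_subset by (auto simp: rsub_def)
  define X where "X = (\<Union>x\<in>{x \<in> e. card (component E x) < K}. component E x)"
  have "big V (insert e E) K - big V E K \<subseteq> X"
  proof
    fix u assume u: "u \<in> big V (insert e E) K - big V E K"
    then have cu: "card (component E u) < K" by (auto simp: big_def)
    have "e \<inter> component E u \<noteq> {}"
    proof
      assume 0: "e \<inter> component E u = {}"
      have "component (insert e E) u \<subseteq> component E u"
        using 0 component_edge[of _ E _ u] by (intro component_closed) auto
      then have "component (insert e E) u = component E u"
        using component_mono[of E "insert e E" u] by auto
      then show False using u by (auto simp: big_def)
    qed
    then obtain x where "x \<in> e" "x \<in> component E u" by auto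
    then show "u \<in> X" using cu component_eq[of x E u] unfolding X_def
      by (intro UN_I[of x]) auto
  qed
  moreover have "finite (component E x)" if "x \<in> e" for x
    using component_subset[OF V(2), of x] fe that V(1) finite_subset by blast
  then have "finite X" using fe by (auto simp: X_def)
  ultimately have "card (big V (insert e E) K - big V E K) \<le> card X" by (rule card_mono[rotated])
  also have "\<dots> \<le> (\<Sum>x\<in>{x \<in> e. card (component E x) < K}. card (component E x))"
    unfolding X_def using fe by (intro card_UN_le) auto
  also have "\<dots> \<le> (\<Sum>x\<in>{x \<in> e. card (component E x) < K}. K)"
    by (intro sum_mono) auto
  also have "\<dots> \<le> r * K"
    using fe card_mono[of e "{x \<in> e. card (component E x) < K}"] by auto
  finally show ?thesis .
qed

lemma card_big_Lipschitz:
  assumes "finite V" "E \<subseteq> rsub r V" "e \<in> rsub r V"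
  shows "\<bar>real (card (big V (insert e E) K)) - real (card (big V E K))\<bar> \<le> real (r * K)"
proof -
  have sub: "big V E K \<subseteq> big V (insert e E) K" using assms by (intro big_mono[where r = r]) auto
  have fin: "finite (big V (insert e E) K)" by (rule finite_subset[OF big_subset assms(1)])
  have "card (big V (insert e E) K - big V E K) = card (big V (insert e E) K) - card (big V E K)"
    using sub fin by (intro card_Diff_subset) (auto intro: finite_subset)
  moreover have "card (big V E K) \<le> card (big V (insert e E) K)" using sub fin by (rule card_mono[rotated])
  ultimately have "card (big V (insert e E) K) \<le> card (big V E K) + r * K"
    using card_big_insert[OF assms, of K] by linarith
  then have "real (card (big V (insert e E) K)) \<le> real (card (big V E K)) + real (r * K)"
    by (metis of_nat_add of_nat_le_iff)
  then show ?thesis using \<open>card (big V E K) \<le> card (big V (insert e E) K)\<close> by (simp del: of_nat_mult)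
qed

section \<open>Counting edges through given vertices\<close>

lemma card_rsub: "finite V \<Longrightarrow> card (rsub r V) = card V choose r"
  unfolding rsub_def by (rule n_subsets)

lemma card_rsub_supset:
  assumes "finite V" "A \<subseteq> V" "card A \<le> r"
  shows "card {e \<in> rsub r V. A \<subseteq> e} = (card V - card A) choose (r - card A)"
proof -
  have fA: "finite A" using assms finite_subset by auto
  have "{e \<in> rsub r V. A \<subseteq> e} = (\<lambda>f. f \<union> A) ` rsub (r - card A) (V - A)"
  proof (intro set_eqI iffI)
    fix e assume e: "e \<in> {e \<in> rsub r V. A \<subseteq> e}"
    then have "e - A \<in> rsub (r - card A) (V - A)"
      using fA by (auto simp: rsub_def card_Diff_subset)
    moreover have "e = (e - A) \<union> A" using e by auto
    ultimately show "e \<in> (\<lambda>f. f \<union> A) ` rsub (r - card A) (V - A)" by blast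
  next
    fix e assume "e \<in> (\<lambda>f. f \<union> A) ` rsub (r - card A) (V - A)"
    then obtain f where f: "e = f \<union> A" "f \<subseteq> V - A" "card f = r - card A" by (auto simp: rsub_def)
    have "finite f" using f(2) assms(1) finite_subset by auto
    moreover have "f \<inter> A = {}" using f(2) by auto
    ultimately have "card e = r" using f fA assms(3) by (simp add: card_Un_disjoint)
    then show "e \<in> {e \<in> rsub r V. A \<subseteq> e}" using f assms by (auto simp: rsub_def)
  qed
  moreover have "inj_on (\<lambda>f. f \<union> A) (rsub (r - card A) (V - A))"
    by (rule inj_onI) (auto simp: rsub_def)
  ultimately show ?thesis
    using assms fA by (simp add: card_image card_rsub card_Diff_subset)
qed

definition star :: "nat \<Rightarrow> 'a set \<Rightarrow> 'a \<Rightarrow> 'a set set" where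
  "star r V v = {e \<in> rsub r V. v \<in> e}"

lemma star_subset: "star r V v \<subseteq> rsub r V"
  by (auto simp: star_def)

lemma finite_star [simp]: "finite V \<Longrightarrow> finite (star r V v)"
  by (simp add: star_def)

lemma rsub_minus_star: "rsub r V - star r V v = rsub r (V - {v})"
  by (auto simp: rsub_def star_def)

lemma card_star: "finite V \<Longrightarrow> v \<in> V \<Longrightarrow> r \<ge> 1 \<Longrightarrow> card (star r V v) = (card V - 1) choose (r - 1)"
  using card_rsub_supset[of V "{v}" r] by (simp add: star_def)

text \<open>The number of \<open>k\<close>-subsets of an \<open>N\<close>-set that meet a given \<open>b\<close>-subset.\<close>

definition hits :: "nat \<Rightarrow> nat \<Rightarrow> nat \<Rightarrow> nat" where
  "hits k N b = (N choose k) - ((N - b) choose k)"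

lemma hits_mono: "b \<le> b' \<Longrightarrow> hits k N b \<le> hits k N b'"
  unfolding hits_def by (intro diff_le_mono2 binomial_right_mono) auto

lemma card_star_hits:
  assumes "finite V" "v \<in> V" "T \<subseteq> V - {v}" "r \<ge> 1"
  shows "card {e \<in> star r V v. e \<inter> T \<noteq> {}} = hits (r - 1) (card V - 1) (card T)"
proof -
  have fT: "finite T" using assms finite_subset by auto
  have "{e \<in> star r V v. e \<inter> T \<noteq> {}} = star r V v - star r (V - T) v"
    by (auto simp: star_def rsub_def)
  moreover have "star r (V - T) v \<subseteq> star r V v" by (auto simp: star_def rsub_def)
  ultimately have "card {e \<in> star r V v. e \<inter> T \<noteq> {}} = card (star r V v) - card (star r (V - T) v)"
    using assms by (simp add: card_Diff_subset)
  moreover have "card (star r (V - T) v) = (card V - 1 - card T) choose (r - 1)"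
  proof -
    have "T \<subseteq> V" using assms(3) by auto
    then have "card (V - T) = card V - card T" using fT by (rule card_Diff_subset[rotated])
    then show ?thesis using card_star[of "V - T" v r] assms by auto
  qed
  ultimately show ?thesis using assms by (simp add: card_star hits_def)
qed

lemma card_star_hits_le:
  assumes "finite V" "v \<in> V" "T \<subseteq> V - {v}" "r \<ge> 2"
  shows "card {e \<in> star r V v. e \<inter> T \<noteq> {}} \<le> card T * card V ^ (r - 2)"
proof -
  have fT: "finite T" using assms finite_subset by auto
  have "card {e \<in> star r V v. e \<inter> T \<noteq> {}} \<le> card (\<Union>t\<in>T. {e \<in> rsub r V. {v, t} \<subseteq> e})"
    using assms fT by (intro card_mono) (auto simp: star_def)
  also have "\<dots> \<le> (\<Sum>t\<in>T. card {e \<in> rsub r V. {v, t} \<subseteq> e})"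
    using fT by (rule card_UN_le)
  also have "\<dots> \<le> (\<Sum>t\<in>T. card V ^ (r - 2))"
  proof (rule sum_mono)
    fix t assume t: "t \<in> T"
    then have "v \<noteq> t" using assms(3) by auto
    then have c: "card {v, t} = 2" by simp
    have "card {e \<in> rsub r V. {v, t} \<subseteq> e} = (card V - 2) choose (r - 2)"
      using card_rsub_supset[of V "{v, t}" r] assms t c by auto
    also have "\<dots> \<le> (card V - 2) ^ (r - 2)" by (rule binomial_le_power)
    also have "\<dots> \<le> card V ^ (r - 2)" by (intro power_mono) auto
    finally show "card {e \<in> rsub r V. {v, t} \<subseteq> e} \<le> card V ^ (r - 2)" .
  qed
  finally show ?thesis by simp
qed

section \<open>Exposing the edges at a vertex last\<close>

lemma rprob_expose:
  assumes "finite V"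
  shows "rprob (rsub r V) p Q = rmean (rsub r (V - {v})) p (\<lambda>E. rprob (star r V v) p (\<lambda>F. Q (E \<union> F)))"
  using rprob_split[of "rsub r V" "star r V v" p Q] assms star_subset[of r V v]
  by (simp add: rsub_minus_star)

text \<open>The target \<open>T\<close> may depend on all edges that avoid \<open>v\<close>: it is
  fixed before the edges at \<open>v\<close> are drawn, and then only its size matters.\<close>

lemma rprob_expose_hits:
  assumes "finite V" "v \<in> V" "r \<ge> 1" "\<And>E. E \<subseteq> rsub r (V - {v}) \<Longrightarrow> T E \<subseteq> V - {v}"
  shows "rprob (rsub r V) p (\<lambda>E. \<exists>e\<in>E. v \<in> e \<and> e \<inter> T {e \<in> E. v \<notin> e} \<noteq> {})
       = rmean (rsub r (V - {v})) p (\<lambda>E. 1 - (1 - p) ^ hits (r - 1) (card V - 1) (card (T E)))"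
  unfolding rprob_expose[OF assms(1), where v = v]
proof (rule rmean_cong)
  fix E assume E: "E \<subseteq> rsub r (V - {v})"
  have "rprob (star r V v) p (\<lambda>F. \<exists>e\<in>E \<union> F. v \<in> e \<and> e \<inter> T {e \<in> E \<union> F. v \<notin> e} \<noteq> {})
      = rprob (star r V v) p (\<lambda>F. F \<inter> {e \<in> star r V v. e \<inter> T E \<noteq> {}} \<noteq> {})"
  proof (rule rprob_cong)
    fix F assume F: "F \<subseteq> star r V v"
    have eq: "{e \<in> E \<union> F. v \<notin> e} = E" using E F by (auto simp: star_def rsub_def)
    have "v \<notin> e" if "e \<in> E" for e using E that by (auto simp: rsub_def)
    moreover have "v \<in> e" if "e \<in> F" for e using F that by (auto simp: star_def)
    ultimately show "(\<exists>e\<in>E \<union> F. v \<in> e \<and> e \<inter> T {e \<in> E \<union> F. v \<notin> e} \<noteq> {})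
        = (F \<inter> {e \<in> star r V v. e \<inter> T E \<noteq> {}} \<noteq> {})"
      using F unfolding eq by blast
  qed
  also have "\<dots> = 1 - (1 - p) ^ hits (r - 1) (card V - 1) (card (T E))"
    proof -
    have "{e \<in> star r V v. e \<inter> T E \<noteq> {}} \<subseteq> star r V v" by auto
    from rprob_Int_nonempty[OF finite_star[OF assms(1)] this] show ?thesis
      using card_star_hits[OF assms(1,2) assms(4)[OF E] assms(3)] by simp
  qed
  finally show "rprob (star r V v) p (\<lambda>F. \<exists>e\<in>E \<union> F. v \<in> e \<and> e \<inter> T {e \<in> E \<union> F. v \<notin> e} \<noteq> {})
      = 1 - (1 - p) ^ hits (r - 1) (card V - 1) (card (T E))" .
qed

lemma rmean_le_split:
  assumes "finite S" "0 \<le> p" "p \<le> 1" "0 \<le> c"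
    and "\<And>E. E \<subseteq> S \<Longrightarrow> g E \<le> 1" "\<And>E. E \<subseteq> S \<Longrightarrow> Q E \<Longrightarrow> g E \<le> c"
  shows "rmean S p g \<le> rprob S p (\<lambda>E. \<not> Q E) + c"
proof -
  have "rmean S p g \<le> rmean S p (\<lambda>E. of_bool (\<not> Q E) + c)"
    using assms by (intro rmean_mono) (auto simp: of_bool_def add_increasing2)
  then show ?thesis using assms by (simp add: rmean_add rprob_def)
qed

text \<open>The form for exceptional sets: a target of size at most \<open>t\<close> is hit with
  probability at most \<open>p\<close> times the number of edges at \<open>v\<close> that meet it,
  by Bernoulli's inequality.\<close>

lemma rprob_expose_hits_le:
  assumes "finite V" "v \<in> V" "r \<ge> 2" "0 \<le> p" "p \<le> 1" "0 \<le> t"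
    and T: "\<And>E. E \<subseteq> rsub r (V - {v}) \<Longrightarrow> T E \<subseteq> V - {v}"
  shows "rprob (rsub r V) p (\<lambda>E. \<exists>e\<in>E. v \<in> e \<and> e \<inter> T {e \<in> E. v \<notin> e} \<noteq> {})
       \<le> rprob (rsub r (V - {v})) p (\<lambda>E. \<not> real (card (T E)) \<le> t) + p * t * real (card V) ^ (r - 2)"
  (is "?P \<le> _")
proof -
  have "?P = rmean (rsub r (V - {v})) p (\<lambda>E. 1 - (1 - p) ^ hits (r - 1) (card V - 1) (card (T E)))"
    using assms(3) by (intro rprob_expose_hits[OF assms(1,2)] T) auto
  also have "\<dots> \<le> rprob (rsub r (V - {v})) p (\<lambda>E. \<not> real (card (T E)) \<le> t) + p * t * real (card V) ^ (r - 2)"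
  proof (rule rmean_le_split)
    fix E assume E: "E \<subseteq> rsub r (V - {v})" and t: "real (card (T E)) \<le> t"
    let ?h = "hits (r - 1) (card V - 1) (card (T E))"
    have "real ?h \<le> real (card (T E) * card V ^ (r - 2))"
      using card_star_hits_le[OF assms(1,2) T[OF E] assms(3)] card_star_hits[OF assms(1,2) T[OF E]] assms(3)
      by (metis (no_types, lifting) of_nat_le_iff One_nat_def Suc_leD numeral_2_eq_2)
    also have "\<dots> \<le> t * real (card V) ^ (r - 2)" using t by (simp add: mult_right_mono)
    finally have "p * real ?h \<le> p * (t * real (card V) ^ (r - 2))" using assms(4) by (intro mult_left_mono)
    moreover have "1 - (1 - p) ^ ?h \<le> p * real ?h"
      using Bernoulli_inequality[of "- p" ?h] assms(4,5) by (simp add: algebra_simps)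
    ultimately show "1 - (1 - p) ^ ?h \<le> p * t * real (card V) ^ (r - 2)" by (simp add: mult_ac)
  qed (use assms(1-6) in auto)
  finally show ?thesis .
qed

lemma component_expose_ge:
  assumes "finite V" "E \<subseteq> rsub r V" "e \<in> E" "v \<in> e" "e \<inter> big (V - {v}) {e \<in> E. v \<notin> e} K \<noteq> {}"
  shows "v \<in> big V E (Suc K)"
proof -
  let ?E = "{e \<in> E. v \<notin> e}"
  obtain x where x: "x \<in> e" "x \<in> big (V - {v}) ?E K" using assms(5) by auto
  have v: "v \<in> V" using assms by (auto simp: rsub_def)
  have x': "x \<in> V - {v}" "K \<le> card (component ?E x)" using x(2) by (auto simp: big_def)
  have sub: "component ?E x \<subseteq> V - {v}"
    by (rule component_subset[of _ r]) (use assms(2) x' in \<open>auto simp: rsub_def\<close>)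
  have "component ?E x \<subseteq> component E x" by (rule component_mono) auto
  moreover have "v \<in> component E x" using component_edge[OF assms(3) x(1), of x] assms(4) by auto
  ultimately have "insert v (component ?E x) \<subseteq> component E v"
    using component_eq[of v E x] by auto
  moreover have "finite (component E v)" using component_subset[OF assms(2) v] assms(1) finite_subset by blast
  ultimately have "card (insert v (component ?E x)) \<le> card (component E v)" by (rule card_mono[rotated])
  moreover have "card (insert v (component ?E x)) = Suc (card (component ?E x))"
    using sub assms(1) finite_subset by (intro card_insert_disjoint) auto
  ultimately show ?thesis using x' v by (auto simp: big_def)
qed

text \<open>The set \<open>X\<close> of \<open>v\<close> and the components, without
  \<open>v\<close>, of all vertices on its edges is closed under meeting edges. There are at most
  \<open>D\<close> such edges, each with at most \<open>r\<close> further vertices, and every one of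
  these components has at most \<open>K\<close> elements.\<close>

lemma component_expose_le:
  assumes "finite V" "E \<subseteq> rsub r V" "v \<in> V" "card {e \<in> E. v \<in> e} \<le> D"
    and "\<And>e. e \<in> E \<Longrightarrow> v \<in> e \<Longrightarrow> e \<inter> big (V - {v}) {e \<in> E. v \<notin> e} K = {}"
  shows "card (component E v) \<le> 1 + D * (r * K)"
proof -
  let ?E = "{e \<in> E. v \<notin> e}" and ?S = "{e \<in> E. v \<in> e}"
  define X where "X = insert v (\<Union>e\<in>?S. \<Union>x\<in>e - {v}. component ?E x)"
  have finE: "finite E" using assms finite_subset finite_rsub by metis
  have fine: "finite e" "card e = r" if "e \<in> E" for e
    using that assms(1,2) by (auto simp: rsub_def intro: finite_subset[of e V])
  have sub: "component ?E x \<subseteq> V - {v}" if "x \<in> V - {v}" for x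
    by (rule component_subset[of _ r]) (use assms(2) that in \<open>auto simp: rsub_def\<close>)
  have inV: "x \<in> V - {v}" if "e \<in> E" "x \<in> e - {v}" for e x using that assms(2) by (auto simp: rsub_def)
  have "component E v \<subseteq> X"
  proof (rule component_closed)
    show "v \<in> X" by (simp add: X_def)
    fix e assume e: "e \<in> E" "e \<inter> X \<noteq> {}"
    show "e \<subseteq> X"
    proof (cases "v \<in> e")
      case True
      show ?thesis
      proof
        fix x assume "x \<in> e"
        then show "x \<in> X" using True e component_refl[of x ?E] unfolding X_def by blast
      qed
    next
      case False
      then obtain y f x where y: "y \<in> e" "f \<in> ?S" "x \<in> f - {v}" "y \<in> component ?E x"
        using e(2) unfolding X_def by auto
      have "e \<subseteq> component ?E x" using component_edge[of e ?E y x] False e y by auto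
      then show ?thesis using y unfolding X_def by blast
    qed
  qed
  moreover have finX: "finite X"
    unfolding X_def using finE fine sub inV assms(1)
    by (auto intro!: finite_UN_I) (metis (no_types, lifting) DiffI finite_Diff finite_subset singletonD)
  ultimately have "card (component E v) \<le> card X" by (rule card_mono[rotated])
  also have "\<dots> \<le> 1 + card (\<Union>e\<in>?S. \<Union>x\<in>e - {v}. component ?E x)"
    using finX unfolding X_def finite_insert by (simp only: card_insert_if) simp
  also have "card (\<Union>e\<in>?S. \<Union>x\<in>e - {v}. component ?E x) \<le> (\<Sum>e\<in>?S. card (\<Union>x\<in>e - {v}. component ?E x))"
    using finE by (intro card_UN_le) auto
  also have "\<dots> \<le> (\<Sum>e\<in>?S. r * K)"
  proof (rule sum_mono)
    fix e assume e: "e \<in> ?S"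
    have "card (\<Union>x\<in>e - {v}. component ?E x) \<le> (\<Sum>x\<in>e - {v}. card (component ?E x))"
      using fine e by (intro card_UN_le) auto
    also have "\<dots> \<le> (\<Sum>x\<in>e - {v}. K)"
    proof (rule sum_mono)
      fix x assume x: "x \<in> e - {v}"
      then have "x \<notin> big (V - {v}) ?E K" using assms(5)[of e] e by auto
      then show "card (component ?E x) \<le> K" using inV[of e x] e x by (auto simp: big_def)
    qed
    also have "\<dots> \<le> r * K" using fine[of e] e card_mono[of e "e - {v}"] by auto
    finally show "card (\<Union>x\<in>e - {v}. component ?E x) \<le> r * K" .
  qed
  also have "\<dots> \<le> D * (r * K)" using assms(4) by (simp add: mult_right_mono)
  finally show ?thesis by simp
qed

section \<open>Vertices in large components\<close>

definition evt :: "nat \<Rightarrow> real \<Rightarrow> ('a set \<Rightarrow> real \<Rightarrow> bool) \<Rightarrow> bool" where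
  "evt r d P \<longleftrightarrow> (\<forall>\<^sub>F (V, p) in crit r d. P V p)"

lemma evt_mono: "evt r d P \<Longrightarrow> (\<And>V p. P V p \<Longrightarrow> Q V p) \<Longrightarrow> evt r d Q"
  unfolding evt_def by (erule eventually_mono) auto

lemma evt_conj: "evt r d P \<Longrightarrow> evt r d Q \<Longrightarrow> evt r d (\<lambda>V p. P V p \<and> Q V p)"
  unfolding evt_def by (drule (1) eventually_conj) (auto elim: eventually_mono)

lemma evt_elim2:
  "evt r d P \<Longrightarrow> evt r d Q \<Longrightarrow> (\<And>V p. P V p \<Longrightarrow> Q V p \<Longrightarrow> R V p) \<Longrightarrow> evt r d R"
  by (drule (1) evt_conj, erule evt_mono) auto

lemma evt_elim3:
  "evt r d P \<Longrightarrow> evt r d Q \<Longrightarrow> evt r d R \<Longrightarrow> (\<And>V p. P V p \<Longrightarrow> Q V p \<Longrightarrow> R V p \<Longrightarrow> S V p) \<Longrightarrow> evt r d S"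
  by (drule (1) evt_conj, erule (1) evt_elim2) auto

lemma evt_elim4:
  "evt r d P \<Longrightarrow> evt r d Q \<Longrightarrow> evt r d R \<Longrightarrow> evt r d S \<Longrightarrow>
    (\<And>V p. P V p \<Longrightarrow> Q V p \<Longrightarrow> R V p \<Longrightarrow> S V p \<Longrightarrow> T V p) \<Longrightarrow> evt r d T"
  by (drule (1) evt_conj, erule (2) evt_elim3) auto

lemma evt_card: "evt r d (\<lambda>V p. n \<le> card V)"
  unfolding evt_def case_prod_unfold
  by (rule eventually_compose_filterlim[OF eventually_ge_at_top filterlim_crit_card])

lemma evt_card_real: "evt r d (\<lambda>V p. c \<le> real (card V))"
  by (rule evt_mono[OF evt_card[of _ _ "nat \<lceil>c\<rceil>"]]) linarith

lemma evt_tendsto: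
  fixes f :: "'a set \<Rightarrow> real \<Rightarrow> real"
  shows "((\<lambda>x. f (fst x) (snd x)) \<longlongrightarrow> l) (crit r d) \<Longrightarrow> \<epsilon> > 0 \<Longrightarrow> evt r d (\<lambda>V p. \<bar>f V p - l\<bar> < \<epsilon>)"
  unfolding evt_def case_prod_unfold using tendstoD[of "\<lambda>x. f (fst x) (snd x)" l "crit r d" \<epsilon>]
  by (simp add: dist_real_def)

lemma evt_Diff: "evt r d P \<Longrightarrow> evt r d (\<lambda>V p. \<forall>X\<subseteq>V. card X \<le> m \<longrightarrow> P (V - X) p)"
  unfolding evt_def by (drule eventually_crit_Diff[where m = m]) simp

lemma evt_Diff1: "evt r d P \<Longrightarrow> evt r d (\<lambda>V p. \<forall>v\<in>V. P (V - {v}) p)"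
  by (drule evt_Diff[where m = 1], erule evt_mono) auto

lemma evt_bound:
  assumes "r \<ge> 2" "d > 0"
  obtains c where "c > 0"
    "evt r d (\<lambda>(V :: 'a set) p. admissible r c V p)"
  using eventually_crit_bound[OF assms, where ?'a = 'a] unfolding evt_def by blast

lemma tendsto_snd_crit:
  assumes "r \<ge> 2" "d > 0"
  shows "(snd \<longlongrightarrow> 0) (crit r d :: ('a set \<times> real) filter)"
    and "\<forall>\<^sub>F x in (crit r d :: ('a set \<times> real) filter). 0 \<le> snd x"
proof -
  let ?G = "crit r d :: ('a set \<times> real) filter"
  obtain c where c: "evt r d (\<lambda>(V :: 'a set) p. admissible r c V p)"
    by (rule evt_bound[OF assms])
  show p0: "\<forall>\<^sub>F x in ?G. 0 \<le> snd x"
    using c unfolding evt_def by (rule eventually_mono) auto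
  show "(snd \<longlongrightarrow> 0) ?G"
  proof (rule tendsto_sandwich)
    show "\<forall>\<^sub>F x in ?G. 0 \<le> snd x" by (rule p0)
    have "evt r d (\<lambda>(V :: 'a set) p. p \<le> c / real (card V))"
    proof (rule evt_elim2[OF c evt_card[of _ _ 1]])
      fix V :: "'a set" and p
      assume *: "admissible r c V p" "1 \<le> card V"
      have "p * real (card V) \<le> p * real (card V) ^ (r - 1)"
        using * assms by (intro mult_left_mono self_le_power) auto
      then have "p * real (card V) \<le> c" using * by linarith
      then show "p \<le> c / real (card V)" using *(2) by (simp add: field_simps)
    qed
    then show "\<forall>\<^sub>F x in ?G. snd x \<le> c / real (card (fst x))"
      unfolding evt_def case_prod_unfold .
    show "((\<lambda>x. c / real (card (fst x))) \<longlongrightarrow> 0) ?G"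
      by (intro real_tendsto_divide_at_top[OF tendsto_const] filterlim_compose[OF filterlim_real_sequentially filterlim_crit_card])
  qed auto
qed

text \<open>An explicit bound \<open>\<eta>\<close> on the failure probability, rather than a limit,
  leaves a statement about \<open>V\<close> and \<open>p\<close> to which vertex deletion via
  \<open>evt_Diff\<close> and a change of \<open>d\<close> apply directly.\<close>

definition whp :: "nat \<Rightarrow> real \<Rightarrow> ('a set \<Rightarrow> 'a set set \<Rightarrow> bool) \<Rightarrow> bool" where
  "whp r d Q \<longleftrightarrow> (\<forall>\<eta>>0. evt r d (\<lambda>V p. rprob (rsub r V) p (\<lambda>E. \<not> Q V E) \<le> \<eta>))"

lemma whpD: "whp r d Q \<Longrightarrow> \<eta> > 0 \<Longrightarrow> evt r d (\<lambda>V p. rprob (rsub r V) p (\<lambda>E. \<not> Q V E) \<le> \<eta>)"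
  by (simp add: whp_def)

lemma whp_elim2:
  assumes "r \<ge> 2" "d > 0" "whp r d Q1" "whp r d Q2" "evt r d P"
    and "\<And>V p E. P V p \<Longrightarrow> finite V \<Longrightarrow> E \<subseteq> rsub r V \<Longrightarrow> Q1 V E \<Longrightarrow> Q2 V E \<Longrightarrow> R V E"
  shows "whp r d R"
  unfolding whp_def
proof (intro allI impI)
  fix \<eta> :: real assume "\<eta> > 0"
  obtain c where c: "evt r d (\<lambda>(V :: 'a set) p. admissible r c V p)"
    by (rule evt_bound[OF assms(1,2)])
  show "evt r d (\<lambda>V p. rprob (rsub r V) p (\<lambda>E. \<not> R V E) \<le> \<eta>)"
  proof (rule evt_elim4[OF whpD[OF assms(3), of "\<eta> / 2"] whpD[OF assms(4), of "\<eta> / 2"] c assms(5)])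
    fix V :: "'a set" and p
    assume *: "rprob (rsub r V) p (\<lambda>E. \<not> Q1 V E) \<le> \<eta> / 2" "rprob (rsub r V) p (\<lambda>E. \<not> Q2 V E) \<le> \<eta> / 2"
      "admissible r c V p" "P V p"
    have "rprob (rsub r V) p (\<lambda>E. \<not> R V E) \<le> rprob (rsub r V) p (\<lambda>E. \<not> Q1 V E) + rprob (rsub r V) p (\<lambda>E. \<not> Q2 V E)"
      using * assms(6)[of V p] by (intro rprob_subadd) auto
    then show "rprob (rsub r V) p (\<lambda>E. \<not> R V E) \<le> \<eta>" using *(1,2) by linarith
  qed (use \<open>\<eta> > 0\<close> in auto)
qed

text \<open>A target of density \<open>t\<close> is met by a proportion
  \<open>1 - (1 - t) ^ (r - 1)\<close> of the possible edges at \<open>v\<close>, so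
  \<open>p * hits\<close> tends to \<open>d\<close> times this number, which is the exponent in
  \<open>surv r d t\<close>.\<close>

lemma evt_hits:
  assumes "r \<ge> 2" "d > 0" and b: "(\<lambda>N. real (b N) / real N) \<longlonglongrightarrow> t" "\<And>N. b N \<le> N" and "\<epsilon> > 0"
  shows "evt r d (\<lambda>(V :: 'a set) p. \<bar>(1 - (1 - p) ^ hits (r - 1) (card V - 1) (b (card V - 1))) - surv r d t\<bar> < \<epsilon>)"
proof -
  define N where "N x = card (fst x) - 1" for x :: "'a set \<times> real"
  let ?G = "crit r d :: ('a set \<times> real) filter"
  have N: "filterlim N at_top ?G"
    unfolding N_def by (rule filterlim_minus_const_nat[OF filterlim_crit_card])
  note p = tendsto_snd_crit(1)[OF assms(1,2)] and p0 = tendsto_snd_crit(2)[OF assms(1,2)]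
  have pC: "((\<lambda>x. snd x * real (N x choose (r - 1))) \<longlongrightarrow> d) ?G"
    unfolding N_def by (rule tendsto_crit_p)
  have bN: "((\<lambda>x. real (b (N x)) / real (N x)) \<longlongrightarrow> t) ?G"
    by (rule filterlim_compose[OF b(1) N])
  have "((\<lambda>x. real (N x - b (N x)) / real (N x)) \<longlongrightarrow> 1 - t) ?G"
  proof -
    have "((\<lambda>x. 1 - real (b (N x)) / real (N x)) \<longlongrightarrow> 1 - t) ?G" by (intro tendsto_intros bN)
    moreover have "\<forall>\<^sub>F x in ?G. 1 - real (b (N x)) / real (N x) = real (N x - b (N x)) / real (N x)"
      using eventually_compose_filterlim[OF eventually_gt_at_top[of 0] N]
      by eventually_elim (use b(2) in \<open>auto simp: field_simps of_nat_diff\<close>)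
    ultimately show ?thesis by (rule tendsto_cong[THEN iffD1, rotated])
  qed
  then have "((\<lambda>x. snd x * real ((N x - b (N x)) choose (r - 1))) \<longlongrightarrow> d * (1 - t) ^ (r - 1)) ?G"
    by (rule tendsto_mult_choose[OF N pC])
  then have "((\<lambda>x. snd x * real (N x choose (r - 1)) - snd x * real ((N x - b (N x)) choose (r - 1)))
      \<longlongrightarrow> d - d * (1 - t) ^ (r - 1)) ?G"
    by (intro tendsto_diff pC)
  moreover have "snd x * real (N x choose (r - 1)) - snd x * real ((N x - b (N x)) choose (r - 1))
      = snd x * real (hits (r - 1) (N x) (b (N x)))" for x
    unfolding hits_def by (subst of_nat_diff) (auto simp: algebra_simps intro: binomial_right_mono)
  ultimately have "((\<lambda>x. snd x * real (hits (r - 1) (N x) (b (N x)))) \<longlongrightarrow> d * (1 - (1 - t) ^ (r - 1))) ?G"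
    by (simp add: algebra_simps)
  then have "((\<lambda>x. 1 - (1 - snd x) ^ hits (r - 1) (N x) (b (N x))) \<longlongrightarrow> 1 - exp (- (d * (1 - (1 - t) ^ (r - 1))))) ?G"
    by (intro tendsto_diff tendsto_const tendsto_one_minus_power p p0)
  then have "((\<lambda>x. 1 - (1 - snd x) ^ hits (r - 1) (N x) (b (N x))) \<longlongrightarrow> surv r d t) ?G"
    by (simp add: surv_def core_fun_def)
  from evt_tendsto[OF this[unfolded N_def] assms(5)] show ?thesis .
qed

lemma tendsto_nat_ceiling_div:
  assumes "t \<ge> 0"
  shows "(\<lambda>N. real (nat \<lceil>t * real N\<rceil>) / real N) \<longlonglongrightarrow> t"
proof (rule tendsto_sandwich)
  show "\<forall>\<^sub>F N in sequentially. t \<le> real (nat \<lceil>t * real N\<rceil>) / real N"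
    using eventually_gt_at_top[of 0] by eventually_elim (simp add: field_simps, linarith)
  show "\<forall>\<^sub>F N in sequentially. real (nat \<lceil>t * real N\<rceil>) / real N \<le> t + 1 / real N"
    using eventually_gt_at_top[of 0]
  proof eventually_elim
    case (elim N)
    have "0 \<le> t * real N" using assms by simp
    then have "real (nat \<lceil>t * real N\<rceil>) \<le> t * real N + 1" by linarith
    then show ?case using elim by (simp add: field_simps)
  qed
  have "(\<lambda>N. t + 1 / real N) \<longlonglongrightarrow> t + 0" by (intro tendsto_intros lim_1_over_n)
  then show "(\<lambda>N. t + 1 / real N) \<longlonglongrightarrow> t" by simp
qed simp

lemma tendsto_nat_floor_div:
  assumes "t \<ge> 0"
  shows "(\<lambda>N. real (nat \<lfloor>t * real N\<rfloor>) / real N) \<longlonglongrightarrow> t"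
proof (rule tendsto_sandwich)
  show "\<forall>\<^sub>F N in sequentially. t - 1 / real N \<le> real (nat \<lfloor>t * real N\<rfloor>) / real N"
    using eventually_gt_at_top[of 0]
  proof eventually_elim
    case (elim N)
    have "t * real N - 1 \<le> real (nat \<lfloor>t * real N\<rfloor>)" by linarith
    then have "(t * real N - 1) / real N \<le> real (nat \<lfloor>t * real N\<rfloor>) / real N" by (intro divide_right_mono) auto
    then show ?case using elim by (simp add: diff_divide_distrib)
  qed
  show "\<forall>\<^sub>F N in sequentially. real (nat \<lfloor>t * real N\<rfloor>) / real N \<le> t"
    using eventually_gt_at_top[of 0]
  proof eventually_elim
    case (elim N)
    have "0 \<le> t * real N" using assms by simp
    then have "real (nat \<lfloor>t * real N\<rfloor>) \<le> t * real N" by linarith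
    then show ?case using elim by (simp add: field_simps)
  qed
  have "(\<lambda>N. t - 1 / real N) \<longlonglongrightarrow> t - 0" by (intro tendsto_intros lim_1_over_n)
  then show "(\<lambda>N. t - 1 / real N) \<longlonglongrightarrow> t" by simp
qed simp

lemma nat_ceiling_le: "t \<le> 1 \<Longrightarrow> nat \<lceil>t * real N\<rceil> \<le> N"
  by (auto simp: nat_le_iff ceiling_le_iff mult_left_le_one_le mult_left_le intro: order_trans[OF mult_right_mono[of t 1]])

lemma nat_floor_le: "t \<le> 1 \<Longrightarrow> nat \<lfloor>t * real N\<rfloor> \<le> N"
  using nat_ceiling_le[of t N] by linarith

text \<open>One edge changes the count by at most \<open>r * K\<close>, and \<open>p\<close> times
  the number of possible edges is at most \<open>c * n\<close>. The variance is therefore of order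
  \<open>n\<close>, and deviations of order \<open>n\<close> are unlikely; the threshold for
  \<open>card V\<close> is what Chebyshev's inequality asks for.\<close>

lemma evt_big_concentrated:
  assumes "r \<ge> 2" "d > 0" "\<epsilon> > 0" "\<eta> > 0"
  shows "evt r d (\<lambda>V p. rprob (rsub r V) p (\<lambda>E. \<epsilon> * real (card V) \<le>
      \<bar>real (card (big V E K)) - rmean (rsub r V) p (\<lambda>E. real (card (big V E K)))\<bar>) \<le> \<eta>)"
proof -
  obtain c where c: "c > 0" "evt r d (\<lambda>(V :: 'a set) p. admissible r c V p)"
    by (rule evt_bound[OF assms(1,2)])
  show ?thesis
  proof (rule evt_elim2[OF c(2) evt_card_real[of _ _ "c * (real (r * K))\<^sup>2 / (\<epsilon>\<^sup>2 * \<eta>) + 1"]])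
    fix V :: "'a set" and p
    assume *: "admissible r c V p"
      and big: "c * (real (r * K))\<^sup>2 / (\<epsilon>\<^sup>2 * \<eta>) + 1 \<le> real (card V)"
    define n where "n = real (card V)"
    have "0 \<le> c * (real (r * K))\<^sup>2 / (\<epsilon>\<^sup>2 * \<eta>)" using c assms by simp
    then have n: "n \<ge> 1" using big unfolding n_def by linarith
    have "p * real (card (rsub r V)) \<le> p * n ^ r"
      using * binomial_le_power[of "card V" r] unfolding n_def
      by (intro mult_left_mono) (auto simp: card_rsub simp flip: of_nat_power)
    also have "\<dots> = p * n ^ (r - 1) * n" using assms by (cases r) auto
    also have "\<dots> \<le> c * n" using * n by (intro mult_right_mono) (auto simp: n_def)
    finally have pr: "p * real (card (rsub r V)) \<le> c * n" .
    let ?m = "rmean (rsub r V) p (\<lambda>E. real (card (big V E K)))"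
    have "rmean (rsub r V) p (\<lambda>E. (real (card (big V E K)) - ?m)\<^sup>2) \<le> p * real (card (rsub r V)) * (real (r * K))\<^sup>2"
      using * by (intro rmean_efron_stein card_big_Lipschitz) auto
    also have "\<dots> \<le> c * n * (real (r * K))\<^sup>2" using pr by (intro mult_right_mono) auto
    finally have "rprob (rsub r V) p (\<lambda>E. \<epsilon> * n \<le> \<bar>real (card (big V E K)) - ?m\<bar>) \<le> c * n * (real (r * K))\<^sup>2 / (\<epsilon> * n)\<^sup>2"
      using * n assms by (intro rchebyshev) auto
    also have "\<dots> = c * (real (r * K))\<^sup>2 / (\<epsilon>\<^sup>2 * \<eta>) * \<eta> / n"
      using n assms by (simp add: field_simps power2_eq_square)
    also have "\<dots> \<le> n * \<eta> / n"
      using big n assms unfolding n_def by (intro divide_right_mono mult_right_mono) auto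
    also have "\<dots> = \<eta>" using n by simp
    finally show "rprob (rsub r V) p (\<lambda>E. \<epsilon> * real (card V) \<le> \<bar>real (card (big V E K)) - ?m\<bar>) \<le> \<eta>"
      by (simp add: n_def)
  qed
qed

lemma rmean_card_big:
  assumes "finite V"
  shows "rmean (rsub r V) p (\<lambda>E. real (card (big V E K))) = (\<Sum>v\<in>V. rprob (rsub r V) p (\<lambda>E. v \<in> big V E K))"
proof -
  have "big V E K = {v \<in> V. v \<in> big V E K}" for E :: "'a set set" by (auto simp: big_def)
  then show ?thesis using rmean_card[OF assms, of "rsub r V" p "\<lambda>v E. v \<in> big V E K"] by simp
qed

text \<open>If about a proportion \<open>y\<close> of the vertices has level \<open>K\<close>
  without \<open>v\<close>, then \<open>v\<close> reaches level \<open>K + 1\<close> with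
  probability about \<open>surv r d y\<close>, which is at least \<open>y\<close>. The error grows
  in each step, so the induction hypothesis has to hold for every \<open>\<epsilon>\<close>.\<close>

lemma whp_big_ge:
  assumes "r \<ge> 2" "d > 0" "0 \<le> y" "y \<le> 1" "y \<le> surv r d y" "\<epsilon> > 0"
  shows "whp r d (\<lambda>(V :: 'a set) E. (y - \<epsilon>) * real (card V) \<le> real (card (big V E K)))"
  using assms(6)
proof (induction K arbitrary: \<epsilon>)
  case 0
  obtain c where c: "evt r d (\<lambda>(V :: 'a set) p. admissible r c V p)"
    by (rule evt_bound[OF assms(1,2)])
  show ?case unfolding whp_def
  proof (intro allI impI evt_mono[OF c])
    fix V :: "'a set" and p \<eta> :: real
    have "(y - \<epsilon>) * real (card V) \<le> 1 * real (card V)" using assms 0 by (intro mult_right_mono) auto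
    moreover assume "\<eta> > 0"
    ultimately show "rprob (rsub r V) p (\<lambda>E. \<not> (y - \<epsilon>) * real (card V) \<le> real (card (big V E 0))) \<le> \<eta>"
      by (simp add: big_def rprob_def rmean_def)
  qed
next
  case (Suc K)
  obtain c where c: "evt r d (\<lambda>(V :: 'a set) p. admissible r c V p)"
    by (rule evt_bound[OF assms(1,2)])
  show ?case
  proof (cases "y \<le> \<epsilon>")
    case True
    show ?thesis unfolding whp_def
    proof (intro allI impI evt_mono[OF c])
      fix V :: "'a set" and p \<eta> :: real
      have "(y - \<epsilon>) * real (card V) \<le> 0" using True by (simp add: mult_nonpos_nonneg)
      then have *: "(y - \<epsilon>) * real (card V) \<le> real (card (big V E (Suc K)))" for E by (rule order_trans) simp
      assume "\<eta> > 0"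
      with * show "rprob (rsub r V) p (\<lambda>E. \<not> (y - \<epsilon>) * real (card V) \<le> real (card (big V E (Suc K)))) \<le> \<eta>"
        by (simp add: rprob_def rmean_def)
    qed
  next
    case False
    obtain \<delta> where \<delta>: "\<delta> > 0" "\<And>z. \<bar>z - y\<bar> < \<delta> \<Longrightarrow> \<bar>surv r d z - surv r d y\<bar> < \<epsilon> / 4"
      using isCont_surv[where r = r and d = d and z = y] Suc.prems unfolding continuous_at_eps_delta dist_real_def
      by (metis divide_pos_pos zero_less_numeral)
    \<comment> \<open>Close enough to \<open>y\<close> for the continuity of \<open>surv\<close>,
      and nonnegative because \<open>\<epsilon> < y\<close> in this case.\<close>
    define t where "t = y - min (\<delta> / 2) (\<epsilon> / 2)"
    have t: "0 \<le> t" "t \<le> 1" "t < y" using False \<delta>(1) assms Suc.prems by (auto simp: t_def)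
    have st: "surv r d t \<ge> y - \<epsilon> / 4"
    proof -
      have "\<bar>t - y\<bar> < \<delta>" using \<delta>(1) Suc.prems by (simp add: t_def)
      from \<delta>(2)[OF this] show ?thesis using assms(5) by linarith
    qed
    \<comment> \<open>Rounding up is the right direction: an integer that is at least
      \<open>t * N\<close> is at least its ceiling, and \<open>hits\<close> is monotone.\<close>
    define b where "b N = nat \<lceil>t * real N\<rceil>" for N
    have bl: "(\<lambda>N. real (b N) / real N) \<longlonglongrightarrow> t" "\<And>N. b N \<le> N"
      unfolding b_def by (rule tendsto_nat_ceiling_div[OF t(1)], rule nat_ceiling_le[OF t(2)])
    have H: "evt r d (\<lambda>(V :: 'a set) p. \<bar>(1 - (1 - p) ^ hits (r - 1) (card V - 1) (b (card V - 1))) - surv r d t\<bar> < \<epsilon> / 4)"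
      using Suc.prems by (intro evt_hits assms bl) auto
    have IH: "evt r d (\<lambda>(V :: 'a set) p. \<forall>v\<in>V. rprob (rsub r (V - {v})) p
        (\<lambda>E. \<not> t * real (card (V - {v})) \<le> real (card (big (V - {v}) E K))) \<le> \<epsilon> / 4)"
      using evt_Diff1[OF whpD[OF Suc.IH[of "y - t"], of "\<epsilon> / 4"]] t Suc.prems by simp
    \<comment> \<open>Of the four quarters of \<open>\<epsilon>\<close>, three are spent here: on
      the continuity of \<open>surv\<close>, on the convergence in \<open>evt_hits\<close> and on
      the failure of the induction hypothesis. Concentration takes the last.\<close>
    have mean: "evt r d (\<lambda>(V :: 'a set) p. (y - 3 * \<epsilon> / 4) * real (card V) \<le> rmean (rsub r V) p (\<lambda>E. real (card (big V E (Suc K)))))"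
    proof (rule evt_elim3[OF c H IH])
      fix V :: "'a set" and p
      assume *: "admissible r c V p"
        and h: "\<bar>(1 - (1 - p) ^ hits (r - 1) (card V - 1) (b (card V - 1))) - surv r d t\<bar> < \<epsilon> / 4"
        and ih: "\<forall>v\<in>V. rprob (rsub r (V - {v})) p
          (\<lambda>E. \<not> t * real (card (V - {v})) \<le> real (card (big (V - {v}) E K))) \<le> \<epsilon> / 4"
      define q where "q = 1 - (1 - p) ^ hits (r - 1) (card V - 1) (b (card V - 1))"
      have q: "0 \<le> q" "q \<le> 1" using * by (auto simp: q_def power_le_one)
      have "y - 3 * \<epsilon> / 4 \<le> rprob (rsub r V) p (\<lambda>E. v \<in> big V E (Suc K))" if v: "v \<in> V" for v
      proof -
        let ?S = "rsub r (V - {v})"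
        define G where "G E \<longleftrightarrow> t * real (card (V - {v})) \<le> real (card (big (V - {v}) E K))" for E
        have "y - 3 * \<epsilon> / 4 \<le> q - \<epsilon> / 4" using h st unfolding q_def by (auto simp: abs_if split: if_splits)
        also have "\<dots> \<le> q - rprob ?S p (\<lambda>E. \<not> G E)" using ih v unfolding G_def by auto
        also have "\<dots> = rmean ?S p (\<lambda>E. q - of_bool (\<not> G E))"
          using * by (simp add: rmean_diff rprob_def)
        also have "\<dots> \<le> rmean ?S p (\<lambda>E. 1 - (1 - p) ^ hits (r - 1) (card V - 1) (card (big (V - {v}) E K)))"
        proof (rule rmean_mono)
          fix E
          show "q - of_bool (\<not> G E) \<le> 1 - (1 - p) ^ hits (r - 1) (card V - 1) (card (big (V - {v}) E K))"
          proof (cases "G E")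
            case True
            then have "b (card V - 1) \<le> card (big (V - {v}) E K)"
              using v * unfolding b_def G_def by (simp add: nat_le_iff ceiling_le_iff)
            then have "(1 - p) ^ hits (r - 1) (card V - 1) (card (big (V - {v}) E K))
                \<le> (1 - p) ^ hits (r - 1) (card V - 1) (b (card V - 1))"
              using * by (intro power_decreasing hits_mono) auto
            then show ?thesis using True by (simp add: q_def)
          next
            case False
            have "(1 - p) ^ hits (r - 1) (card V - 1) (card (big (V - {v}) E K)) \<le> 1"
              using * by (intro power_le_one) auto
            then show ?thesis using False q by simp
          qed
        qed (use * in auto)
        also have "\<dots> = rprob (rsub r V) p (\<lambda>E. \<exists>e\<in>E. v \<in> e \<and> e \<inter> big (V - {v}) {e \<in> E. v \<notin> e} K \<noteq> {})"
          by (rule rprob_expose_hits[symmetric]) (use * v assms(1) in \<open>auto simp: big_def\<close>)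
        also have "\<dots> \<le> rprob (rsub r V) p (\<lambda>E. v \<in> big V E (Suc K))"
          using * by (intro rprob_mono) (auto intro: component_expose_ge)
        finally show ?thesis .
      qed
      then have "(\<Sum>v\<in>V. y - 3 * \<epsilon> / 4) \<le> (\<Sum>v\<in>V. rprob (rsub r V) p (\<lambda>E. v \<in> big V E (Suc K)))"
        by (intro sum_mono)
      then show "(y - 3 * \<epsilon> / 4) * real (card V) \<le> rmean (rsub r V) p (\<lambda>E. real (card (big V E (Suc K))))"
        using * by (simp add: rmean_card_big mult.commute)
    qed
    show ?thesis unfolding whp_def
    proof (intro allI impI)
      fix \<eta> :: real assume \<eta>: "\<eta> > 0"
      have e4: "\<epsilon> / 4 > 0" using Suc.prems by simp
      show "evt r d (\<lambda>(V :: 'a set) p. rprob (rsub r V) p (\<lambda>E. \<not> (y - \<epsilon>) * real (card V) \<le> real (card (big V E (Suc K)))) \<le> \<eta>)"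
      proof (rule evt_elim3[OF c mean evt_big_concentrated[OF assms(1,2) e4 \<eta>, of "Suc K"]])
        fix V :: "'a set" and p
        let ?m = "rmean (rsub r V) p (\<lambda>E. real (card (big V E (Suc K))))"
        assume *: "admissible r c V p"
          and m: "(y - 3 * \<epsilon> / 4) * real (card V) \<le> ?m"
          and con: "rprob (rsub r V) p (\<lambda>E. \<epsilon> / 4 * real (card V) \<le> \<bar>real (card (big V E (Suc K))) - ?m\<bar>) \<le> \<eta>"
        have "rprob (rsub r V) p (\<lambda>E. \<not> (y - \<epsilon>) * real (card V) \<le> real (card (big V E (Suc K))))
            \<le> rprob (rsub r V) p (\<lambda>E. \<epsilon> / 4 * real (card V) \<le> \<bar>real (card (big V E (Suc K))) - ?m\<bar>)"
        proof (rule rprob_mono)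
          fix E assume "\<not> (y - \<epsilon>) * real (card V) \<le> real (card (big V E (Suc K)))"
          moreover have "(y - \<epsilon>) * real (card V) = (y - 3 * \<epsilon> / 4) * real (card V) - \<epsilon> / 4 * real (card V)"
            by (simp add: algebra_simps)
          ultimately show "\<epsilon> / 4 * real (card V) \<le> \<bar>real (card (big V E (Suc K))) - ?m\<bar>"
            using m by linarith
        qed (use * in auto)
        then show "rprob (rsub r V) p (\<lambda>E. \<not> (y - \<epsilon>) * real (card V) \<le> real (card (big V E (Suc K)))) \<le> \<eta>"
          using con by linarith
      qed
    qed
  qed
qed

lemma rprob_degree_gt_le:
  assumes "finite V" "v \<in> V" "r \<ge> 1" "0 \<le> p" "p \<le> 1"
  shows "rprob (rsub r V) p (\<lambda>E. D < card {e \<in> E. v \<in> e}) \<le> p * real ((card V - 1) choose (r - 1)) / real (Suc D)"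
proof -
  have "rprob (rsub r V) p (\<lambda>E. D < card {e \<in> E. v \<in> e}) = rprob (rsub r V) p (\<lambda>E. D < card (E \<inter> star r V v))"
  proof (rule rprob_cong)
    fix E assume "E \<subseteq> rsub r V"
    then have "{e \<in> E. v \<in> e} = E \<inter> star r V v" by (auto simp: star_def)
    then show "(D < card {e \<in> E. v \<in> e}) = (D < card (E \<inter> star r V v))" by simp
  qed
  also have "\<dots> = rprob (star r V v) p (\<lambda>E. D < card E)"
    using assms(1) by (intro rprob_restrict star_subset) auto
  also have "\<dots> \<le> rprob (star r V v) p (\<lambda>E. real (Suc D) \<le> real (card E))"
    using assms by (intro rprob_mono) auto
  also have "\<dots> \<le> rmean (star r V v) p (\<lambda>E. real (card E)) / real (Suc D)"
    using assms by (intro rmarkov) auto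
  finally show ?thesis using assms by (simp add: rmean_card_edges card_star)
qed

text \<open>For an upper bound all small components attached to \<open>v\<close> together have to
  stay small. The degree of \<open>v\<close> is therefore truncated at \<open>D\<close>, and the
  threshold grows from \<open>K\<close> to \<open>K'\<close>.\<close>

lemma whp_big_le_step:
  assumes "r \<ge> 2" "d > 0" "0 \<le> z" "z \<le> 1" "\<epsilon> > 0"
    and up: "whp r d (\<lambda>(V :: 'a set) E. real (card (big V E K)) \<le> z * real (card V))"
  shows "\<exists>K'. whp r d (\<lambda>(V :: 'a set) E. real (card (big V E K')) \<le> (surv r d z + \<epsilon>) * real (card V))"
proof -
  obtain c where c: "evt r d (\<lambda>(V :: 'a set) p. admissible r c V p)"
    by (rule evt_bound[OF assms(1,2)])
  \<comment> \<open>Chosen for Markov's inequality, as the mean degree is below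
    \<open>d + 1\<close>.\<close>
  define D where "D = nat \<lceil>4 * (d + 1) / \<epsilon>\<rceil>"
  have D: "(d + 1) / real (Suc D) \<le> \<epsilon> / 4"
  proof -
    have "4 * (d + 1) / \<epsilon> \<le> real (Suc D)" unfolding D_def by linarith
    then show ?thesis using assms by (simp add: field_simps)
  qed
  \<comment> \<open>One more than the size allowed by \<open>component_expose_le\<close>.\<close>
  define K' where "K' = 2 + D * (r * K)"
  define b where "b N = nat \<lfloor>z * real N\<rfloor>" for N
  have bl: "(\<lambda>N. real (b N) / real N) \<longlonglongrightarrow> z" "\<And>N. b N \<le> N"
    unfolding b_def by (rule tendsto_nat_floor_div[OF assms(3)], rule nat_floor_le[OF assms(4)])
  have e4: "\<epsilon> / 4 > 0" using assms by simp
  have H: "evt r d (\<lambda>(V :: 'a set) p. \<bar>(1 - (1 - p) ^ hits (r - 1) (card V - 1) (b (card V - 1))) - surv r d z\<bar> < \<epsilon> / 4)"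
    by (intro evt_hits assms bl e4)
  have IH: "evt r d (\<lambda>(V :: 'a set) p. \<forall>v\<in>V. rprob (rsub r (V - {v})) p
      (\<lambda>E. \<not> real (card (big (V - {v}) E K)) \<le> z * real (card (V - {v}))) \<le> \<epsilon> / 4)"
    by (rule evt_Diff1[OF whpD[OF up e4]])
  have deg: "evt r d (\<lambda>(V :: 'a set) p. \<bar>p * real ((card V - 1) choose (r - 1)) - d\<bar> < 1)"
    by (rule evt_tendsto[OF tendsto_crit_p]) simp
  have mean: "evt r d (\<lambda>(V :: 'a set) p. rmean (rsub r V) p (\<lambda>E. real (card (big V E K'))) \<le> (surv r d z + 3 * \<epsilon> / 4) * real (card V))"
  proof (rule evt_elim4[OF c H IH deg])
    fix V :: "'a set" and p
    assume *: "admissible r c V p"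
      and h: "\<bar>(1 - (1 - p) ^ hits (r - 1) (card V - 1) (b (card V - 1))) - surv r d z\<bar> < \<epsilon> / 4"
      and ih: "\<forall>v\<in>V. rprob (rsub r (V - {v})) p
        (\<lambda>E. \<not> real (card (big (V - {v}) E K)) \<le> z * real (card (V - {v}))) \<le> \<epsilon> / 4"
      and dg: "\<bar>p * real ((card V - 1) choose (r - 1)) - d\<bar> < 1"
    define q where "q = 1 - (1 - p) ^ hits (r - 1) (card V - 1) (b (card V - 1))"
    have q: "0 \<le> q" using * by (auto simp: q_def power_le_one)
    have "rprob (rsub r V) p (\<lambda>E. v \<in> big V E K') \<le> surv r d z + 3 * \<epsilon> / 4" if v: "v \<in> V" for v
    proof -
      let ?S = "rsub r (V - {v})"
      have "rprob (rsub r V) p (\<lambda>E. v \<in> big V E K')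
          \<le> rprob (rsub r V) p (\<lambda>E. \<exists>e\<in>E. v \<in> e \<and> e \<inter> big (V - {v}) {e \<in> E. v \<notin> e} K \<noteq> {})
            + rprob (rsub r V) p (\<lambda>E. D < card {e \<in> E. v \<in> e})"
      proof (rule rprob_subadd)
        fix E assume E: "E \<subseteq> rsub r V" "v \<in> big V E K'"
        show "(\<exists>e\<in>E. v \<in> e \<and> e \<inter> big (V - {v}) {e \<in> E. v \<notin> e} K \<noteq> {}) \<or> D < card {e \<in> E. v \<in> e}"
        proof (rule ccontr)
          assume "\<not> ?thesis"
          then have "card (component E v) \<le> 1 + D * (r * K)"
            using * E(1) v by (intro component_expose_le[where V = V]) auto
          then show False using E(2) by (simp add: big_def K'_def)
        qed
      qed (use * in auto)
      also have "rprob (rsub r V) p (\<lambda>E. D < card {e \<in> E. v \<in> e}) \<le> p * real ((card V - 1) choose (r - 1)) / real (Suc D)"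
        using * v assms(1) by (intro rprob_degree_gt_le) auto
      also have "\<dots> \<le> (d + 1) / real (Suc D)"
        using dg by (intro divide_right_mono) auto
      also note D
      also have "rprob (rsub r V) p (\<lambda>E. \<exists>e\<in>E. v \<in> e \<and> e \<inter> big (V - {v}) {e \<in> E. v \<notin> e} K \<noteq> {})
          = rmean ?S p (\<lambda>E. 1 - (1 - p) ^ hits (r - 1) (card V - 1) (card (big (V - {v}) E K)))"
        by (rule rprob_expose_hits) (use * v assms(1) in \<open>auto simp: big_def\<close>)
      also have "\<dots> \<le> rprob ?S p (\<lambda>E. \<not> real (card (big (V - {v}) E K)) \<le> z * real (card (V - {v}))) + q"
      proof (rule rmean_le_split)
        fix E assume le: "real (card (big (V - {v}) E K)) \<le> z * real (card (V - {v}))"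
        have "card (big (V - {v}) E K) \<le> b (card V - 1)"
          using le v * unfolding b_def by (simp add: le_nat_floor)
        then have "(1 - p) ^ hits (r - 1) (card V - 1) (b (card V - 1))
            \<le> (1 - p) ^ hits (r - 1) (card V - 1) (card (big (V - {v}) E K))"
          using * by (intro power_decreasing hits_mono) auto
        then show "1 - (1 - p) ^ hits (r - 1) (card V - 1) (card (big (V - {v}) E K)) \<le> q"
          by (simp add: q_def)
      qed (use * q in auto)
      also have "rprob ?S p (\<lambda>E. \<not> real (card (big (V - {v}) E K)) \<le> z * real (card (V - {v}))) \<le> \<epsilon> / 4"
        using ih v by blast
      also have "q \<le> surv r d z + \<epsilon> / 4" using h unfolding q_def by linarith
      finally show ?thesis by simp
    qed
    then have "(\<Sum>v\<in>V. rprob (rsub r V) p (\<lambda>E. v \<in> big V E K')) \<le> (\<Sum>v\<in>V. surv r d z + 3 * \<epsilon> / 4)"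
      by (intro sum_mono)
    then show "rmean (rsub r V) p (\<lambda>E. real (card (big V E K'))) \<le> (surv r d z + 3 * \<epsilon> / 4) * real (card V)"
      using * by (simp add: rmean_card_big mult.commute)
  qed
  have "whp r d (\<lambda>(V :: 'a set) E. real (card (big V E K')) \<le> (surv r d z + \<epsilon>) * real (card V))"
    unfolding whp_def
  proof (intro allI impI)
    fix \<eta> :: real assume \<eta>: "\<eta> > 0"
    show "evt r d (\<lambda>(V :: 'a set) p. rprob (rsub r V) p (\<lambda>E. \<not> real (card (big V E K')) \<le> (surv r d z + \<epsilon>) * real (card V)) \<le> \<eta>)"
    proof (rule evt_elim3[OF c mean evt_big_concentrated[OF assms(1,2) e4 \<eta>, of K']])
      fix V :: "'a set" and p
      let ?m = "rmean (rsub r V) p (\<lambda>E. real (card (big V E K')))"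
      assume *: "admissible r c V p"
        and m: "?m \<le> (surv r d z + 3 * \<epsilon> / 4) * real (card V)"
        and con: "rprob (rsub r V) p (\<lambda>E. \<epsilon> / 4 * real (card V) \<le> \<bar>real (card (big V E K')) - ?m\<bar>) \<le> \<eta>"
      have "rprob (rsub r V) p (\<lambda>E. \<not> real (card (big V E K')) \<le> (surv r d z + \<epsilon>) * real (card V))
          \<le> rprob (rsub r V) p (\<lambda>E. \<epsilon> / 4 * real (card V) \<le> \<bar>real (card (big V E K')) - ?m\<bar>)"
      proof (rule rprob_mono)
        fix E assume "\<not> real (card (big V E K')) \<le> (surv r d z + \<epsilon>) * real (card V)"
        moreover have "(surv r d z + \<epsilon>) * real (card V) = (surv r d z + 3 * \<epsilon> / 4) * real (card V) + \<epsilon> / 4 * real (card V)"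
          by (simp add: algebra_simps)
        ultimately show "\<epsilon> / 4 * real (card V) \<le> \<bar>real (card (big V E K')) - ?m\<bar>"
          using m by linarith
      qed (use * in auto)
      then show "rprob (rsub r V) p (\<lambda>E. \<not> real (card (big V E K')) \<le> (surv r d z + \<epsilon>) * real (card V)) \<le> \<eta>"
        using con by linarith
    qed
  qed
  then show ?thesis by blast
qed

lemma whp_trivial:
  assumes "r \<ge> 2" "d > 0" "\<And>(V :: 'a set) E. finite V \<Longrightarrow> E \<subseteq> rsub r V \<Longrightarrow> Q V E"
  shows "whp r d Q"
proof -
  obtain c where c: "evt r d (\<lambda>(V :: 'a set) p. admissible r c V p)"
    by (rule evt_bound[OF assms(1,2)])
  show ?thesis unfolding whp_def
  proof (intro allI impI evt_mono[OF c])
    fix V :: "'a set" and p \<eta> :: real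
    assume *: "admissible r c V p" "\<eta> > 0"
    have "rprob (rsub r V) p (\<lambda>E. \<not> Q V E) = rprob (rsub r V) p (\<lambda>_. False)"
      using assms(3)[of V] * by (intro rprob_cong) auto
    then show "rprob (rsub r V) p (\<lambda>E. \<not> Q V E) \<le> \<eta>" using * by (simp add: rprob_def)
  qed
qed

text \<open>The set of \<open>z\<close> such that whp at most \<open>zn\<close> vertices lie in components of at least constant
  size is upward closed and closed under \<open>z \<mapsto> surv z + \<epsilon>\<close>; its infimum is therefore at most the
  largest fixed point of \<open>surv\<close>.\<close>

lemma whp_big_le:
  assumes "r \<ge> 2" "d > 0" "\<epsilon> > 0"
  shows "\<exists>K. whp r d (\<lambda>(V :: 'a set) E. real (card (big V E K)) \<le> (rho_star r d + \<epsilon>) * real (card V))"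
proof -
  define Z where "Z = {z. 0 \<le> z \<and> z \<le> 1 \<and> (\<exists>K. whp r d (\<lambda>(V :: 'a set) E. real (card (big V E K)) \<le> z * real (card V)))}"
  have 1: "1 \<in> Z"
  proof -
    have "whp r d (\<lambda>(V :: 'a set) E. real (card (big V E 0)) \<le> 1 * real (card V))"
      using assms by (intro whp_trivial) (auto intro!: card_mono big_subset)
    then show ?thesis unfolding Z_def by auto
  qed
  have bdd: "bdd_below Z" by (auto simp: Z_def bdd_below_def)
  define s where "s = Inf Z"
  have "0 \<le> s" unfolding s_def
  proof (rule cInf_greatest)
    show "Z \<noteq> {}" using 1 by auto
  qed (auto simp: Z_def)
  moreover have s_le: "s \<le> z" if "z \<in> Z" for z unfolding s_def by (rule cInf_lower[OF that bdd])
  ultimately have s: "0 \<le> s" "s \<le> 1" "\<And>z. z \<in> Z \<Longrightarrow> s \<le> z" using s_le[OF 1] by blast+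
  have "s \<le> rho_star r d"
  proof (rule ccontr)
    assume "\<not> s \<le> rho_star r d"
    then have lt: "surv r d s < s" using surv_less[of d r s] assms s by auto
    \<comment> \<open>A third of the gap: one part covers the continuity of \<open>surv\<close>, one
      the error of \<open>whp_big_le_step\<close>, and the last keeps
      \<open>surv r d z + \<gamma>\<close> strictly below the infimum.\<close>
    define \<gamma> where "\<gamma> = (s - surv r d s) / 3"
    have \<gamma>: "\<gamma> > 0" using lt by (simp add: \<gamma>_def)
    obtain \<delta> where \<delta>: "\<delta> > 0" "\<And>z. \<bar>z - s\<bar> < \<delta> \<Longrightarrow> \<bar>surv r d z - surv r d s\<bar> < \<gamma>"
      using isCont_surv[where r = r and d = d and z = s] \<gamma> unfolding continuous_at_eps_delta dist_real_def by metis
    have "\<exists>z\<in>Z. z < s + \<delta>" using cInf_less_iff[of Z "s + \<delta>"] 1 bdd \<delta>(1) unfolding s_def by auto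
    then obtain z where z: "z \<in> Z" "z < s + \<delta>" by auto
    then have z': "s \<le> z" "0 \<le> z" "z \<le> 1" using s by (auto simp: Z_def)
    from z(1) obtain K where K: "whp r d (\<lambda>(V :: 'a set) E. real (card (big V E K)) \<le> z * real (card V))"
      by (auto simp: Z_def)
    have "\<bar>z - s\<bar> < \<delta>" using z z' by auto
    then have sz: "surv r d z < surv r d s + \<gamma>" using \<delta>(2) by fastforce
    have "s = surv r d s + 3 * \<gamma>" by (simp add: \<gamma>_def field_simps)
    then have lt': "surv r d z + \<gamma> < s" using sz \<gamma> by linarith
    obtain K' where "whp r d (\<lambda>(V :: 'a set) E. real (card (big V E K')) \<le> (surv r d z + \<gamma>) * real (card V))"
      using whp_big_le_step[OF assms(1,2) z'(2,3) \<gamma> K] by blast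
    moreover have "0 \<le> surv r d z" using surv_bounds[of d z r] assms z' by simp
    ultimately have "surv r d z + \<gamma> \<in> Z"
      using lt' s(2) \<gamma> unfolding Z_def by (intro CollectI conjI exI[of _ K']) linarith+
    then show False using s(3) lt' by fastforce
  qed
  then have "\<exists>z\<in>Z. z < rho_star r d + \<epsilon>"
    using cInf_less_iff[of Z "rho_star r d + \<epsilon>"] 1 bdd assms unfolding s_def by auto
  then obtain z K where z: "z < rho_star r d + \<epsilon>" "whp r d (\<lambda>(V :: 'a set) E. real (card (big V E K)) \<le> z * real (card V))"
    by (auto simp: Z_def)
  have "whp r d (\<lambda>(V :: 'a set) E. real (card (big V E K)) \<le> (rho_star r d + \<epsilon>) * real (card V))"
    by (rule whp_elim2[OF assms(1,2) z(2) z(2) evt_card[of _ _ 0]])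
      (use z(1) in \<open>auto elim!: order_trans intro!: mult_right_mono\<close>)
  then show ?thesis by blast
qed

section \<open>The giant component\<close>

lemma component_subset_big:
  assumes "E \<subseteq> rsub r V" "x \<in> big V E K"
  shows "component E x \<subseteq> big V E K"
proof
  fix y assume y: "y \<in> component E x"
  have "x \<in> V" using assms(2) by (simp add: big_def)
  then have "y \<in> V" using component_subset[OF assms(1)] y by blast
  then show "y \<in> big V E K" using assms(2) component_eq[OF y] by (simp add: big_def)
qed

text \<open>Take a smallest union \<open>X\<close> of components of \<open>E\<close> with at least \<open>s\<close> big vertices: there are
  fewer than \<open>s\<close> big vertices outside \<open>X\<close>, and in \<open>X\<close> outside any one of its components.\<close>

lemma component_merge:
  fixes s :: real
  assumes "finite V" "E1 \<subseteq> rsub r U" "U \<subseteq> V" "E1 \<subseteq> E" "0 < s" "s \<le> real (card (big U E1 K))"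
    and cross: "\<And>X. X \<subseteq> big U E1 K \<Longrightarrow> (\<And>x. x \<in> X \<Longrightarrow> component E1 x \<subseteq> X) \<Longrightarrow>
      s \<le> real (card X) \<Longrightarrow> s \<le> real (card (big U E1 K - X)) \<Longrightarrow>
      \<exists>e\<in>E. e \<inter> X \<noteq> {} \<and> e \<inter> (big U E1 K - X) \<noteq> {}"
  shows "\<exists>v\<in>U. real (card (big U E1 K)) - 2 * s \<le> real (card (component E v \<inter> big U E1 K))"
proof -
  define B where "B = big U E1 K"
  have finB: "finite B" unfolding B_def by (rule finite_subset[OF big_subset finite_subset[OF assms(3,1)]])
  define W where "W = {X. X \<subseteq> B \<and> (\<forall>x\<in>X. component E x \<inter> B \<subseteq> X) \<and> s \<le> real (card X)}"
  have "B \<in> W" using assms(6) by (auto simp: W_def B_def)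
  then obtain X where X: "X \<in> W" "\<And>Y. Y \<in> W \<Longrightarrow> card X \<le> card Y"
    using ex_has_least_nat[of "\<lambda>X. X \<in> W" B card] by blast
  have XB: "X \<subseteq> B" and Xc: "\<And>x. x \<in> X \<Longrightarrow> component E x \<inter> B \<subseteq> X" and Xs: "s \<le> real (card X)"
    using X(1) by (auto simp: W_def)
  have finX: "finite X" by (rule finite_subset[OF XB finB])
  have rest: "real (card (B - X)) < s"
  proof (rule ccontr)
    assume "\<not> real (card (B - X)) < s"
    then have "s \<le> real (card (B - X))" by simp
    moreover have "component E1 x \<subseteq> X" if "x \<in> X" for x
      using component_subset_big[OF assms(2), of x K] component_mono[OF assms(4), of x] Xc[OF that] that XB
      unfolding B_def by blast
    ultimately obtain e where e: "e \<in> E" "e \<inter> X \<noteq> {}" "e \<inter> (B - X) \<noteq> {}"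
      using cross[OF XB[unfolded B_def] _ Xs] unfolding B_def by blast
    then obtain x y where "x \<in> e" "x \<in> X" "y \<in> e" "y \<in> B - X" by auto
    then show False using component_edge[of e E x x] Xc[of x] e by auto
  qed
  have "X \<noteq> {}" using Xs assms(5) by auto
  then obtain v where v: "v \<in> X" by auto
  define Q where "Q = component E v \<inter> B"
  have Q: "Q \<subseteq> X" "v \<in> Q" using Xc[OF v] v XB by (auto simp: Q_def)
  have "card (X - Q) < card X" using Q v finX by (intro psubset_card_mono) auto
  then have "X - Q \<notin> W" using X(2)[of "X - Q"] by auto
  moreover have "component E x \<inter> B \<subseteq> X - Q" if "x \<in> X - Q" for x
  proof
    fix y assume y: "y \<in> component E x \<inter> B"
    then have "y \<in> X" using Xc[of x] that by auto
    moreover have "y \<notin> Q"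
    proof
      assume "y \<in> Q"
      then have "x \<in> component E v" using y component_sym[of y E x] component_trans[of y E v x] by (auto simp: Q_def)
      then show False using that XB by (auto simp: Q_def)
    qed
    ultimately show "y \<in> X - Q" by simp
  qed
  ultimately have XQ: "real (card (X - Q)) < s" using XB by (auto simp: W_def)
  have "card B \<le> card (Q \<union> (X - Q) \<union> (B - X))" using finB XB Q by (intro card_mono) (auto intro: finite_subset)
  also have "\<dots> \<le> card Q + card (X - Q) + card (B - X)"
    by (meson add_le_mono1 card_Un_le le_trans)
  finally have "real (card B) - 2 * s \<le> real (card Q)" using XQ rest by linarith
  moreover have "v \<in> U" using v XB by (auto simp: B_def big_def)
  ultimately show ?thesis unfolding B_def Q_def by blast
qed

text \<open>A closed set is determined by the components it contains. Each component has at least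
  \<open>K\<close> vertices, so there are at most \<open>card U div K\<close> of them.\<close>

lemma card_closed_sets_le:
  assumes "finite U" "E \<subseteq> rsub r U" "K > 0"
  shows "card {X. X \<subseteq> big U E K \<and> (\<forall>x\<in>X. component E x \<subseteq> X)} \<le> 2 ^ (card U div K)"
proof -
  define B where "B = big U E K"
  have finB: "finite B" unfolding B_def by (rule finite_subset[OF big_subset assms(1)])
  define C where "C = component E ` B"
  have finC: "finite C" using finB by (simp add: C_def)
  have sub: "component E x \<subseteq> B" if "x \<in> B" for x
    using component_subset_big[OF assms(2)] that unfolding B_def by blast
  have "K * card C = (\<Sum>c\<in>C. K)" by simp
  also have "\<dots> \<le> (\<Sum>c\<in>C. card c)"
    by (intro sum_mono) (auto simp: C_def B_def big_def)
  also have "\<dots> = card (\<Union>C)"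
  proof (rule card_Union_disjoint[symmetric])
    show "pairwise disjnt C"
    proof (rule pairwiseI)
      fix c c' assume "c \<in> C" "c' \<in> C" "c \<noteq> c'"
      then obtain x y where xy: "c = component E x" "c' = component E y" by (auto simp: C_def)
      show "disjnt c c'"
      proof (rule ccontr)
        assume "\<not> disjnt c c'"
        then obtain z where "z \<in> component E x" "z \<in> component E y" using xy by (auto simp: disjnt_def)
        then have "c = c'" using xy component_eq by metis
        then show False using \<open>c \<noteq> c'\<close> by simp
      qed
    qed
    show "finite c" if "c \<in> C" for c using that by (auto simp: C_def intro: finite_subset[OF sub finB])
  qed
  also have "\<dots> \<le> card U"
    using assms(1) sub big_subset[of U E K] unfolding B_def[symmetric] by (intro card_mono) (auto simp: C_def)
  finally have "card C \<le> card U div K" using assms(3) by (simp add: less_eq_div_iff_mult_less_eq mult.commute)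
  have "card {X. X \<subseteq> B \<and> (\<forall>x\<in>X. component E x \<subseteq> X)} \<le> card (Pow C)"
  proof (rule card_inj_on_le)
    show "inj_on (\<lambda>X. component E ` X) {X. X \<subseteq> B \<and> (\<forall>x\<in>X. component E x \<subseteq> X)}"
    proof (rule inj_onI)
      fix X Y assume *: "X \<in> {X. X \<subseteq> B \<and> (\<forall>x\<in>X. component E x \<subseteq> X)}"
        "Y \<in> {X. X \<subseteq> B \<and> (\<forall>x\<in>X. component E x \<subseteq> X)}" "component E ` X = component E ` Y"
      have "X = \<Union>(component E ` X)" using *(1) component_refl by fastforce
      moreover have "Y = \<Union>(component E ` Y)" using *(2) component_refl by fastforce
      ultimately show "X = Y" using *(3) by simp
    qed
  qed (use finC in \<open>auto simp: C_def\<close>)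
  also have "\<dots> = 2 ^ card C" by (rule card_Pow[OF finC])
  also have "\<dots> \<le> 2 ^ (card U div K)" using \<open>card C \<le> card U div K\<close> by (intro power_increasing) auto
  finally show ?thesis by (simp add: B_def)
qed

text \<open>Double counting of triples in \<open>X\<close>, \<open>Y\<close> and
  \<open>V - U\<close> inside an edge: each triple lies in \<open>(n - 3) choose (r - 3)\<close>
  edges, and an edge contains at most \<open>r ^ 3\<close> triples. The third vertex marks the edge
  as held back, and \<open>r \<ge> 3\<close> makes room for it.\<close>

lemma card_crossing_ge:
  assumes "finite V" "r \<ge> 3" "U \<subseteq> V" "X \<subseteq> U" "Y \<subseteq> U" "X \<inter> Y = {}"
  shows "card X * card Y * card (V - U) * ((card V - 3) choose (r - 3))
       \<le> r ^ 3 * card {e \<in> rsub r V - rsub r U. e \<inter> X \<noteq> {} \<and> e \<inter> Y \<noteq> {}}"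
proof -
  define H where "H = {e \<in> rsub r V - rsub r U. e \<inter> X \<noteq> {} \<and> e \<inter> Y \<noteq> {}}"
  define T where "T = X \<times> Y \<times> (V - U)"
  define P where "P t e \<longleftrightarrow> (case t of (x, y, z) \<Rightarrow> {x, y, z} \<subseteq> e)" for t :: "'a \<times> 'a \<times> 'a" and e
  have finU: "finite U" by (rule finite_subset[OF assms(3,1)])
  have fin: "finite X" "finite Y" "finite V"
    using finite_subset[OF assms(4) finU] finite_subset[OF assms(5) finU] assms(1) by auto
  have finT: "finite T" and finH: "finite H" using fin by (auto simp: T_def H_def)
  have "card X * card Y * card (V - U) * ((card V - 3) choose (r - 3)) = (\<Sum>t\<in>T. ((card V - 3) choose (r - 3)))"
    by (simp add: T_def card_cartesian_product mult.assoc)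
  also have "\<dots> = (\<Sum>t\<in>T. card {e \<in> H. P t e})"
  proof (rule sum.cong[OF refl])
    fix t assume "t \<in> T"
    then obtain x y z where t: "t = (x, y, z)" "x \<in> X" "y \<in> Y" "z \<in> V" "z \<notin> U" by (auto simp: T_def)
    have "{e \<in> H. P t e} = {e \<in> rsub r V. {x, y, z} \<subseteq> e}"
      using t by (auto simp: H_def P_def rsub_def)
    moreover have "x \<noteq> y" "x \<noteq> z" "y \<noteq> z" using t assms by auto
    then have "card {x, y, z} = 3" by simp
    moreover have "{x, y, z} \<subseteq> V" using t assms by auto
    ultimately show "(card V - 3) choose (r - 3) = card {e \<in> H. P t e}"
      using card_rsub_supset[of V "{x, y, z}" r] assms by simp
  qed
  also have "\<dots> = (\<Sum>t\<in>T. \<Sum>e\<in>H. of_bool (P t e))"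
    using finH by (simp add: of_bool_def sum.If_cases Int_def)
  also have "\<dots> = (\<Sum>e\<in>H. \<Sum>t\<in>T. of_bool (P t e))" by (rule sum.swap)
  also have "\<dots> = (\<Sum>e\<in>H. card {t \<in> T. P t e})"
    using finT by (simp add: of_bool_def sum.If_cases Int_def)
  also have "\<dots> \<le> (\<Sum>e\<in>H. r ^ 3)"
  proof (rule sum_mono)
    fix e assume "e \<in> H"
    then have e: "card e = r" "finite e" using fin by (auto simp: H_def rsub_def intro: finite_subset[of e V])
    have "card {t \<in> T. P t e} \<le> card (e \<times> e \<times> e)"
      using e by (intro card_mono) (auto simp: P_def)
    also have "\<dots> = r ^ 3" using e by (simp add: card_cartesian_product power3_eq_cube)
    finally show "card {t \<in> T. P t e} \<le> r ^ 3" .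
  qed
  finally show ?thesis by (simp add: H_def mult.commute)
qed

text \<open>Relates the count of crossing edges to the binomial coefficient whose product with
  \<open>p\<close> tends to \<open>d\<close>.\<close>

lemma binomial_le_minus2:
  assumes "r \<ge> 3" "n \<ge> 3"
  shows "(n - 1) choose (r - 1) \<le> n ^ 2 * ((n - 3) choose (r - 3))"
proof -
  have step: "Suc m choose Suc k \<le> Suc m * (m choose k)" for m k
  proof -
    have "(Suc m choose Suc k) * 1 \<le> (Suc m choose Suc k) * Suc k" by (intro mult_left_mono) auto
    then show ?thesis by (simp only: Suc_times_binomial_eq mult_1_right)
  qed
  define m where "m = n - 3"
  define k where "k = r - 3"
  have m: "n = Suc (Suc (Suc m))" and k: "r = Suc (Suc (Suc k))" using assms by (auto simp: m_def k_def)
  have "Suc (Suc m) choose Suc (Suc k) \<le> Suc (Suc m) * (Suc m choose Suc k)" by (rule step)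
  also have "\<dots> \<le> Suc (Suc m) * (Suc m * (m choose k))" by (intro mult_left_mono step) simp
  also have "\<dots> \<le> n ^ 2 * (m choose k)" unfolding m power2_eq_square mult.assoc
    by (intro mult_mono) auto
  finally show ?thesis by (simp add: m k)
qed

text \<open>If nearly all big vertices are not joined, \<open>component_merge\<close> yields a
  closed set \<open>X\<close> that no held-back edge connects to the other big vertices.
  \<open>\<kappa>\<close> bounds from below the mean number of held-back edges that would do
  so.\<close>

lemma rprob_no_merge_le:
  assumes "finite V" "r \<ge> 3" "U \<subseteq> V" "E1 \<subseteq> rsub r U" "K > 0" "0 \<le> p" "p \<le> 1" "0 < s"
    and \<kappa>: "\<kappa> * r ^ 3 \<le> p * (s\<^sup>2 * real (card (V - U)) * real ((card V - 3) choose (r - 3)))"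
    and "s \<le> real (card (big U E1 K))"
  shows "rprob (rsub r V - rsub r U) p (\<lambda>F. \<not> (\<exists>v\<in>U. real (card (big U E1 K)) - 2 * s \<le> real (card (component (E1 \<union> F) v))))
       \<le> 2 ^ (card U div K) * exp (- \<kappa>)"
proof -
  let ?T = "rsub r V - rsub r U" and ?B = "big U E1 K"
  have finU: "finite U" by (rule finite_subset[OF assms(3,1)])
  have finB: "finite ?B" by (rule finite_subset[OF big_subset finU])
  have finT: "finite ?T" using assms by simp
  define XX where "XX = {X. X \<subseteq> ?B \<and> (\<forall>x\<in>X. component E1 x \<subseteq> X)}"
  define XS where "XS = {X \<in> XX. s \<le> real (card X) \<and> s \<le> real (card (?B - X))}"
  define H where "H X = {e \<in> ?T. e \<inter> X \<noteq> {} \<and> e \<inter> (?B - X) \<noteq> {}}" for X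
  have finXX: "finite XX" unfolding XX_def using finB by (auto intro: finite_subset[of _ "Pow ?B"])
  have "rprob ?T p (\<lambda>F. \<not> (\<exists>v\<in>U. real (card ?B) - 2 * s \<le> real (card (component (E1 \<union> F) v))))
      \<le> (\<Sum>X\<in>XS. rprob ?T p (\<lambda>F. card (F \<inter> H X) = 0))"
  proof (rule rprob_union_bound)
    fix F assume F: "F \<subseteq> ?T" and no: "\<not> (\<exists>v\<in>U. real (card ?B) - 2 * s \<le> real (card (component (E1 \<union> F) v)))"
    show "\<exists>X\<in>XS. card (F \<inter> H X) = 0"
    proof (rule ccontr)
      assume *: "\<not> ?thesis"
      have "\<exists>v\<in>U. real (card ?B) - 2 * s \<le> real (card (component (E1 \<union> F) v \<inter> ?B))"
      proof (rule component_merge[OF assms(1,4,3) _ assms(8,10)])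
        fix X assume X: "X \<subseteq> ?B" "\<And>x. x \<in> X \<Longrightarrow> component E1 x \<subseteq> X" "s \<le> real (card X)" "s \<le> real (card (?B - X))"
        then have "X \<in> XS" by (auto simp: XS_def XX_def)
        then have "F \<inter> H X \<noteq> {}" using * by (auto simp: card_eq_0_iff)
        then show "\<exists>e\<in>E1 \<union> F. e \<inter> X \<noteq> {} \<and> e \<inter> (?B - X) \<noteq> {}" by (auto simp: H_def)
      qed auto
      then obtain v where v: "v \<in> U" "real (card ?B) - 2 * s \<le> real (card (component (E1 \<union> F) v \<inter> ?B))" by blast
      have "E1 \<union> F \<subseteq> rsub r V" using assms(3,4) F rsub_mono[of U V r] by blast
      then have "finite (component (E1 \<union> F) v)"
        using component_subset[of "E1 \<union> F" r V v] v assms(1,3) by (meson finite_subset subsetD)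
      then have "card (component (E1 \<union> F) v \<inter> ?B) \<le> card (component (E1 \<union> F) v)" by (intro card_mono) auto
      then show False using no v by fastforce
    qed
  qed (use assms finXX in \<open>auto simp: XS_def\<close>)
  also have "\<dots> \<le> (\<Sum>X\<in>XS. exp (- \<kappa>))"
  proof (rule sum_mono)
    fix X assume X: "X \<in> XS"
    have XB: "X \<subseteq> ?B" "s \<le> real (card X)" "s \<le> real (card (?B - X))" using X by (auto simp: XS_def XX_def)
    have HT: "H X \<subseteq> ?T" by (auto simp: H_def)
    have BU: "?B \<subseteq> U" by (rule big_subset)
    have "card X * card (?B - X) * card (V - U) * ((card V - 3) choose (r - 3)) \<le> r ^ 3 * card (H X)"
      unfolding H_def by (rule card_crossing_ge) (use assms XB BU in auto)
    then have "real (card X * card (?B - X) * card (V - U) * ((card V - 3) choose (r - 3))) \<le> real (r ^ 3 * card (H X))"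
      by (simp only: of_nat_le_iff)
    then have c: "real (card X) * real (card (?B - X)) * real (card (V - U)) * real ((card V - 3) choose (r - 3)) \<le> real r ^ 3 * real (card (H X))"
      by simp
    have "s * s \<le> real (card X) * real (card (?B - X))" using XB assms(8) by (intro mult_mono) auto
    then have "s\<^sup>2 * real (card (V - U)) * real ((card V - 3) choose (r - 3))
        \<le> real (card X) * real (card (?B - X)) * real (card (V - U)) * real ((card V - 3) choose (r - 3))"
      unfolding power2_eq_square by (intro mult_right_mono) auto
    with c have "s\<^sup>2 * real (card (V - U)) * real ((card V - 3) choose (r - 3)) \<le> real r ^ 3 * real (card (H X))" by linarith
    then have "p * (s\<^sup>2 * real (card (V - U)) * real ((card V - 3) choose (r - 3))) \<le> p * (real r ^ 3 * real (card (H X)))"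
      using assms by (intro mult_left_mono)
    then have "\<kappa> * r ^ 3 \<le> p * real (card (H X)) * r ^ 3" using \<kappa> by (simp add: mult_ac)
    then have le: "\<kappa> \<le> p * real (card (H X))" using assms by simp
    have "rprob ?T p (\<lambda>F. card (F \<inter> H X) = 0) = (1 - p) ^ card (H X)"
      using rprob_card_Int[OF finT HT, of p 0] by simp
    also have "\<dots> \<le> exp (- p) ^ card (H X)"
      using assms exp_ge_add_one_self[of "- p"] by (intro power_mono) auto
    also have "\<dots> = exp (- (p * real (card (H X))))" by (simp add: exp_of_nat_mult[symmetric] mult_ac)
    also have "\<dots> \<le> exp (- \<kappa>)" using le by simp
    finally show "rprob ?T p (\<lambda>F. card (F \<inter> H X) = 0) \<le> exp (- \<kappa>)" .
  qed
  also have "\<dots> = real (card XS) * exp (- \<kappa>)" by simp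
  also have "\<dots> \<le> 2 ^ (card U div K) * exp (- \<kappa>)"
  proof (intro mult_right_mono)
    have "card XS \<le> card XX" using finXX by (intro card_mono) (auto simp: XS_def)
    also have "\<dots> \<le> 2 ^ (card U div K)" unfolding XX_def by (rule card_closed_sets_le[OF finU assms(4,5)])
    finally show "real (card XS) \<le> 2 ^ (card U div K)" by (metis of_nat_le_iff of_nat_numeral of_nat_power)
  qed simp
  finally show ?thesis .
qed

lemma whp_giant:
  assumes "r \<ge> 3" "d > 0" "\<epsilon> > 0"
  shows "whp r d (\<lambda>(V :: 'a set) E. \<exists>v\<in>V. (rho_star r d - \<epsilon>) * real (card V) \<le> real (card (component E v)))"
proof -
  define \<rho> where "\<rho> = rho_star r d"
  have r2: "r \<ge> 2" using assms by simp
  have tr: "whp r d (\<lambda>(V :: 'a set) E. True)" by (rule whp_trivial[OF r2 assms(2)]) simp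
  show ?thesis
  proof (cases "\<rho> \<le> \<epsilon>")
    case True
    show ?thesis
    proof (rule whp_elim2[OF r2 assms(2) tr tr evt_card[of _ _ 1]])
      fix V :: "'a set" and E and p :: real
      assume "1 \<le> card V"
      then have "V \<noteq> {}" by auto
      moreover have "(rho_star r d - \<epsilon>) * real (card V) \<le> 0" using True by (simp add: \<rho>_def mult_nonpos_nonneg)
      ultimately show "\<exists>v\<in>V. (rho_star r d - \<epsilon>) * real (card V) \<le> real (card (component E v))"
        by (meson all_not_in_conv of_nat_0_le_iff order_trans)
    qed
  next
    case False
    have \<rho>: "\<epsilon> < \<rho>" "\<rho> \<le> 1" "0 < \<rho>" using False assms rho_star_greatest(3)[of r d] by (auto simp: \<rho>_def)
    \<comment> \<open>Slightly below the fixed point, so that \<open>surv r d y\<close> exceeds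
      \<open>y\<close>; this costs at most \<open>\<epsilon> / 4\<close>.\<close>
    define y where "y = (1 - \<epsilon> / 4) * \<rho>"
    have y: "y < surv r d y" "0 \<le> y" "y \<le> 1" "\<rho> - \<epsilon> / 4 \<le> y"
    proof -
      show "y < surv r d y" unfolding y_def \<rho>_def
        using \<rho> assms r2 by (intro surv_greater) (auto simp: \<rho>_def)
      show "0 \<le> y" "y \<le> 1" using \<rho> assms by (auto simp: y_def intro!: mult_le_one)
      have "\<epsilon> / 4 * \<rho> \<le> \<epsilon> / 4" using \<rho> assms by (simp add: mult_left_le)
      then show "\<rho> - \<epsilon> / 4 \<le> y" by (simp add: y_def algebra_simps)
    qed
    \<comment> \<open>Keeping a fraction \<open>1 - \<delta>\<close> of the vertices multiplies
      \<open>d\<close> by \<open>(1 - \<delta>) ^ (r - 1)\<close>. By continuity the strict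
      inequality at \<open>y\<close> survives for small \<open>\<delta>\<close>.\<close>
    have "isCont (\<lambda>\<delta>. surv r (d * (1 - \<delta>) ^ (r - 1)) y) 0"
      unfolding surv_def core_fun_def by (intro continuous_intros)
    then obtain \<gamma> where \<gamma>: "\<gamma> > 0" "\<And>\<delta>. \<bar>\<delta>\<bar> < \<gamma> \<Longrightarrow> \<bar>surv r (d * (1 - \<delta>) ^ (r - 1)) y - surv r d y\<bar> < surv r d y - y"
      using y(1) unfolding continuous_at_eps_delta dist_real_def
      by (metis diff_gt_0_iff_gt diff_zero mult_1_right power_one)
    define \<delta> where "\<delta> = min (\<gamma> / 2) (\<epsilon> / 8)"
    have \<delta>: "0 < \<delta>" "\<delta> \<le> \<epsilon> / 8" "\<delta> < 1" "\<bar>\<delta>\<bar> < \<gamma>" using \<gamma>(1) assms \<rho> by (auto simp: \<delta>_def)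
    define d' where "d' = d * (1 - \<delta>) ^ (r - 1)"
    have d': "d' > 0" "y \<le> surv r d' y"
      using \<gamma>(2)[OF \<delta>(4)] \<delta> assms unfolding d'_def by (auto simp: abs_less_iff)
    define m where "m n = nat \<lceil>(1 - \<delta>) * real n\<rceil>" for n
    have m_le: "m n \<le> n" for n unfolding m_def using \<delta> by (intro nat_ceiling_le) auto
    have m_ge: "(1 - \<delta>) * real n \<le> real (m n)" for n unfolding m_def by linarith
    have m_ub: "real (m n) \<le> (1 - \<delta>) * real n + 1" for n
    proof -
      have "0 \<le> (1 - \<delta>) * real n" using \<delta> by simp
      then show ?thesis unfolding m_def by linarith
    qed
    \<comment> \<open>Fixed as a function of \<open>V\<close>, so that the map from \<open>V\<close>
      to \<open>U V\<close> turns \<open>crit r d\<close> into \<open>crit r d'\<close> and lower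
      bounds for \<open>d'\<close> can be pulled back. An infinite \<open>V\<close> has
      \<open>card V = 0\<close>, which the empty set matches.\<close>
    define U where "U V = (if finite V then SOME U. U \<subseteq> V \<and> card U = m (card V) else {})" for V :: "'a set"
    have U_spec: "U V \<subseteq> V \<and> card (U V) = m (card V)" for V
    proof (cases "finite V")
      case True
      then have "\<exists>U. U \<subseteq> V \<and> card U = m (card V)"
        using obtain_subset_with_card_n[OF m_le[of "card V"]] by metis
      then have "(SOME U. U \<subseteq> V \<and> card U = m (card V)) \<subseteq> V \<and> card (SOME U. U \<subseteq> V \<and> card U = m (card V)) = m (card V)"
        by (rule someI_ex)
      then show ?thesis using True by (simp add: U_def)
    qed (simp add: U_def m_def)
    have m_lim: "filterlim m at_top sequentially" unfolding filterlim_at_top eventually_sequentially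
    proof (intro allI exI impI)
      fix Z n :: nat assume "nat \<lceil>real Z / (1 - \<delta>)\<rceil> \<le> n"
      then have "real Z / (1 - \<delta>) \<le> real n" by linarith
      then have "real Z \<le> (1 - \<delta>) * real n" using \<delta> by (simp add: field_simps)
      then show "Z \<le> m n" using m_ge[of n] by linarith
    qed
    have filt: "filterlim (\<lambda>x :: 'a set \<times> real. (U (fst x), snd x)) (crit r d') (crit r d)"
      unfolding filterlim_crit_iff
    proof
      show "filterlim (\<lambda>x :: 'a set \<times> real. card (U (fst x))) at_top (crit r d)"
        using filterlim_compose[OF m_lim filterlim_crit_card] U_spec by simp
      have "(\<lambda>n. (real (m n) / real n - 1 / real n) / (1 - 1 / real n)) \<longlonglongrightarrow> (1 - \<delta> - 0) / (1 - 0)"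
        unfolding m_def using \<delta> by (intro tendsto_intros tendsto_nat_ceiling_div lim_1_over_n) auto
      moreover have "\<forall>\<^sub>F n in sequentially. (real (m n) / real n - 1 / real n) / (1 - 1 / real n) = real (m n - 1) / real (n - 1)"
        using eventually_gt_at_top[of 1] filterlim_at_top[THEN iffD1, OF m_lim, rule_format, of 1]
        by eventually_elim (simp add: field_simps of_nat_diff)
      ultimately have "(\<lambda>n. real (m n - 1) / real (n - 1)) \<longlonglongrightarrow> 1 - \<delta>"
        by (auto elim: tendsto_cong[THEN iffD1, rotated])
      then have "((\<lambda>x :: 'a set \<times> real. real (m (card (fst x)) - 1) / real (card (fst x) - 1)) \<longlongrightarrow> 1 - \<delta>) (crit r d)"
        by (rule filterlim_compose[OF _ filterlim_crit_card])
      from tendsto_mult_choose[OF filterlim_minus_const_nat[OF filterlim_crit_card] tendsto_crit_p this]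
      show "((\<lambda>x :: 'a set \<times> real. snd x * real ((card (U (fst x)) - 1) choose (r - 1))) \<longlongrightarrow> d') (crit r d)"
        using U_spec by (simp add: d'_def)
    qed
    \<comment> \<open>Merging loses \<open>2 * (\<sigma> * n)\<close>, which is the last quarter of
      \<open>\<epsilon> * n\<close>.\<close>
    define \<sigma> where "\<sigma> = \<epsilon> / 8"
    \<comment> \<open>The exponent in \<open>rprob_no_merge_le\<close> per vertex: at least
      \<open>\<delta> * n / 2\<close> vertices are held back, and
      \<open>p * n\<^sup>2 * ((n - 3) choose (r - 3))\<close> is at least
      \<open>d / 2\<close>.\<close>
    define c0 where "c0 = \<sigma>\<^sup>2 * \<delta> * d / (4 * real r ^ 3)"
    have c0: "c0 > 0" using \<delta> assms by (simp add: c0_def \<sigma>_def)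
    \<comment> \<open>With this choice the \<open>2 ^ (n div K)\<close> splits number at most
      \<open>exp (c0 * n / 2)\<close>, half of the exponent available.\<close>
    define K where "K = nat \<lceil>2 / c0\<rceil>"
    have K: "2 / c0 \<le> real K" unfolding K_def by linarith
    then have "0 < real K" using c0 by (smt (verit) zero_less_divide_iff)
    then have K0: "K > 0" by simp
    obtain c where c: "evt r d (\<lambda>(V :: 'a set) p. admissible r c V p)"
      by (rule evt_bound[OF r2 assms(2)])
    have pd: "evt r d (\<lambda>(V :: 'a set) p. \<bar>p * real ((card V - 1) choose (r - 1)) - d\<bar> < d / 2)"
      by (rule evt_tendsto[OF tendsto_crit_p]) (use assms in simp)
    show ?thesis unfolding whp_def
    proof (intro allI impI)
      fix \<eta> :: real assume \<eta>: "\<eta> > 0"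
      have "evt r d' (\<lambda>(V :: 'a set) p. rprob (rsub r V) p (\<lambda>E. \<not> (y - \<epsilon> / 4) * real (card V) \<le> real (card (big V E K))) \<le> \<eta> / 2)"
        using \<eta> assms by (intro whpD whp_big_ge r2 d' y) auto
      then have low: "evt r d (\<lambda>(V :: 'a set) p. rprob (rsub r (U V)) p (\<lambda>E. \<not> (y - \<epsilon> / 4) * real (card (U V)) \<le> real (card (big (U V) E K))) \<le> \<eta> / 2)"
        using eventually_compose_filterlim[OF _ filt] unfolding evt_def case_prod_unfold by fastforce
      show "evt r d (\<lambda>(V :: 'a set) p. rprob (rsub r V) p (\<lambda>E. \<not> (\<exists>v\<in>V. (rho_star r d - \<epsilon>) * real (card V) \<le> real (card (component E v)))) \<le> \<eta>)"
      \<comment> \<open>The term \<open>2 / \<delta>\<close> absorbs the rounding of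
        \<open>card (U V)\<close>; \<open>4 / (c0 * \<eta>)\<close> brings the final bound
        \<open>2 / (c0 * n)\<close> below \<open>\<eta> / 2\<close>.\<close>
      proof (rule evt_elim4[OF c pd low evt_card_real[of _ _ "3 + 2 / \<delta> + 4 / (c0 * \<eta>)"]])
        fix V :: "'a set" and p
        assume *: "admissible r c V p"
          and pd: "\<bar>p * real ((card V - 1) choose (r - 1)) - d\<bar> < d / 2"
          and low: "rprob (rsub r (U V)) p (\<lambda>E. \<not> (y - \<epsilon> / 4) * real (card (U V)) \<le> real (card (big (U V) E K))) \<le> \<eta> / 2"
          and large: "3 + 2 / \<delta> + 4 / (c0 * \<eta>) \<le> real (card V)"
        define n where "n = real (card V)"
        have pos: "0 \<le> 2 / \<delta>" "0 \<le> 4 / (c0 * \<eta>)" using \<delta> c0 \<eta> by auto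
        have n: "n \<ge> 3" "n \<ge> 2 / \<delta>" "n \<ge> 4 / (c0 * \<eta>)" using large pos unfolding n_def by linarith+
        have n3: "card V \<ge> 3" using n(1) unfolding n_def by simp
        have UV: "U V \<subseteq> V" "card (U V) = m (card V)" using U_spec by auto
        have fU: "finite (U V)" using * by (intro finite_subset[OF UV(1)]) simp
        let ?B = "\<lambda>E. real (card (big (U V) E K))"
        have B_large: "(\<rho> - 3 * \<epsilon> / 4) * n \<le> ?B E" if "(y - \<epsilon> / 4) * real (card (U V)) \<le> ?B E" for E
        proof -
          have "\<rho> - 3 * \<epsilon> / 4 \<le> (\<rho> - \<epsilon> / 2) - \<delta> * (\<rho> - \<epsilon> / 2)"
          proof -
            have "\<delta> * (\<rho> - \<epsilon> / 2) \<le> \<delta> * 1" using \<delta> \<rho> assms by (intro mult_left_mono) auto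
            then show ?thesis using \<delta> assms by (simp add: field_simps)
          qed
          then have "(\<rho> - 3 * \<epsilon> / 4) * n \<le> ((\<rho> - \<epsilon> / 2) - \<delta> * (\<rho> - \<epsilon> / 2)) * n" using n by (intro mult_right_mono) auto
          also have "\<dots> = (\<rho> - \<epsilon> / 2) * ((1 - \<delta>) * n)" by (simp add: field_simps)
          also have "\<dots> \<le> (\<rho> - \<epsilon> / 2) * real (card (U V))"
            using m_ge[of "card V"] UV \<rho> by (intro mult_left_mono) (auto simp: n_def)
          also have "\<dots> \<le> (y - \<epsilon> / 4) * real (card (U V))"
            using y(4) by (intro mult_right_mono) auto
          finally show ?thesis using that by linarith
        qed
        let ?T = "rsub r V - rsub r (U V)"
        have "rprob (rsub r V) p (\<lambda>E. \<not> (\<exists>v\<in>V. (rho_star r d - \<epsilon>) * real (card V) \<le> real (card (component E v))))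
            = rmean (rsub r (U V)) p (\<lambda>E. rprob ?T p (\<lambda>F. \<not> (\<exists>v\<in>V. (\<rho> - \<epsilon>) * n \<le> real (card (component (E \<union> F) v)))))"
          using rprob_split[of "rsub r V" ?T p] * rsub_mono[OF UV(1), of r] by (simp add: double_diff \<rho>_def n_def)
        also have "\<dots> \<le> rprob (rsub r (U V)) p (\<lambda>E. \<not> (y - \<epsilon> / 4) * real (card (U V)) \<le> ?B E) + \<eta> / 2"
        proof (rule rmean_le_split)
          show "finite (rsub r (U V))" using fU by simp
          fix E assume E: "E \<subseteq> rsub r (U V)"
          show "rprob ?T p (\<lambda>F. \<not> (\<exists>v\<in>V. (\<rho> - \<epsilon>) * n \<le> real (card (component (E \<union> F) v)))) \<le> 1"
            using * by (intro rprob_le_1) auto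
          assume good: "(y - \<epsilon> / 4) * real (card (U V)) \<le> ?B E"
          have BE: "(\<rho> - 3 * \<epsilon> / 4) * n \<le> ?B E" by (rule B_large[OF good])
          have "rprob ?T p (\<lambda>F. \<not> (\<exists>v\<in>V. (\<rho> - \<epsilon>) * n \<le> real (card (component (E \<union> F) v))))
              \<le> rprob ?T p (\<lambda>F. \<not> (\<exists>v\<in>U V. ?B E - 2 * (\<sigma> * n) \<le> real (card (component (E \<union> F) v))))"
          proof (rule rprob_mono)
            fix F assume no: "\<not> (\<exists>v\<in>V. (\<rho> - \<epsilon>) * n \<le> real (card (component (E \<union> F) v)))"
            have "(\<rho> - \<epsilon>) * n = (\<rho> - 3 * \<epsilon> / 4) * n - 2 * (\<sigma> * n)" by (simp add: \<sigma>_def algebra_simps)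
            then have "(\<rho> - \<epsilon>) * n \<le> ?B E - 2 * (\<sigma> * n)" using BE by linarith
            then show "\<not> (\<exists>v\<in>U V. ?B E - 2 * (\<sigma> * n) \<le> real (card (component (E \<union> F) v)))"
              using no UV(1) by force
          qed (use * in auto)
          also have "\<dots> \<le> 2 ^ (card (U V) div K) * exp (- (c0 * n))"
          proof (rule rprob_no_merge_le)
            have "(\<epsilon> / 8) * n \<le> (\<rho> - 3 * \<epsilon> / 4) * n" using \<rho> n assms by (intro mult_right_mono) auto
            then show "\<sigma> * n \<le> ?B E" using BE by (simp add: \<sigma>_def)
            show "0 < \<sigma> * n" using assms n by (simp add: \<sigma>_def)
            define C3 where "C3 = real ((card V - 3) choose (r - 3))"
            have "real ((card V - 1) choose (r - 1)) \<le> n\<^sup>2 * C3"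
              using binomial_le_minus2[OF assms(1) n3] unfolding n_def C3_def
              by (metis of_nat_le_iff of_nat_mult of_nat_power)
            then have "p * real ((card V - 1) choose (r - 1)) \<le> p * (n\<^sup>2 * C3)" using * by (intro mult_left_mono) auto
            moreover have "d / 2 \<le> p * real ((card V - 1) choose (r - 1))" using pd by linarith
            ultimately have pC: "d / 2 \<le> p * n\<^sup>2 * C3" by (simp add: mult.assoc)
            have VU: "\<delta> * n / 2 \<le> real (card (V - U V))"
            proof -
              have "card (V - U V) = card V - m (card V)" using UV fU by (simp add: card_Diff_subset)
              then have "real (card (V - U V)) \<ge> \<delta> * n - 1"
                using m_ub[of "card V"] m_le[of "card V"] by (simp add: n_def algebra_simps of_nat_diff)
              moreover have "\<delta> * n \<ge> 2" using n(2) \<delta> by (simp add: field_simps)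
              ultimately show ?thesis by linarith
            qed
            have "c0 * n * real r ^ 3 = \<sigma>\<^sup>2 * (\<delta> * n / 2) * (d / 2)"
              using assms by (simp add: c0_def field_simps)
            also have "\<dots> \<le> \<sigma>\<^sup>2 * real (card (V - U V)) * (p * n\<^sup>2 * C3)"
              using VU pC assms \<delta> n by (intro mult_mono mult_left_mono) auto
            also have "\<dots> = p * ((\<sigma> * n)\<^sup>2 * real (card (V - U V)) * C3)" by (simp add: power_mult_distrib mult_ac)
            finally show "c0 * n * real r ^ 3 \<le> p * ((\<sigma> * n)\<^sup>2 * real (card (V - U V)) * real ((card V - 3) choose (r - 3)))"
              by (simp add: C3_def)
          qed (use * assms UV E K0 in auto)
          also have "\<dots> \<le> exp (c0 * n / 2) * exp (- (c0 * n))"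
          proof (rule mult_right_mono)
            have "(2 :: real) ^ (card (U V) div K) \<le> exp 1 ^ (card (U V) div K)"
              using exp_ge_add_one_self[of 1] by (intro power_mono) auto
            also have "\<dots> = exp (real (card (U V) div K))" by (simp add: exp_of_nat_mult[symmetric])
            also have "\<dots> \<le> exp (c0 * n / 2)"
            proof -
              have "real (card (U V) div K) \<le> real (card (U V)) / real K" by (rule of_nat_div_le_of_nat)
              also have "\<dots> \<le> n / real K" using UV m_le[of "card V"] by (intro divide_right_mono) (auto simp: n_def)
              also have "\<dots> \<le> n / (2 / c0)" using K c0 n K0 by (intro divide_left_mono) (auto intro!: divide_pos_pos mult_pos_pos)
              also have "\<dots> = c0 * n / 2" by simp
              finally show ?thesis by simp
            qed
            finally show "(2 :: real) ^ (card (U V) div K) \<le> exp (c0 * n / 2)" .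
          qed simp
          also have "\<dots> = exp (- (c0 * n / 2))" by (simp add: exp_add[symmetric])
          also have "\<dots> \<le> 1 / (c0 * n / 2)"
          proof -
            have "c0 * n / 2 \<le> exp (c0 * n / 2)" using exp_ge_add_one_self[of "c0 * n / 2"] by linarith
            moreover have "c0 * n / 2 > 0" using c0 n by simp
            ultimately show ?thesis by (simp add: exp_minus divide_simps)
          qed
          also have "\<dots> \<le> \<eta> / 2" using n(3) c0 \<eta> n(1) by (simp add: field_simps)
          finally show "rprob ?T p (\<lambda>F. \<not> (\<exists>v\<in>V. (\<rho> - \<epsilon>) * n \<le> real (card (component (E \<union> F) v)))) \<le> \<eta> / 2" .
        qed (use * \<eta> in auto)
        also have "\<dots> \<le> \<eta>" using low by linarith
        finally show "rprob (rsub r V) p (\<lambda>E. \<not> (\<exists>v\<in>V. (rho_star r d - \<epsilon>) * real (card V) \<le> real (card (component E v)))) \<le> \<eta>" .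
      qed
    qed
  qed
qed

text \<open>If \<open>\<epsilon>\<close> is at least \<open>rho_star r d\<close>, then \<open>L\<close> may be empty; this covers the subcritical
  case.\<close>

definition giantlike :: "nat \<Rightarrow> real \<Rightarrow> real \<Rightarrow> nat \<Rightarrow> 'a set \<Rightarrow> 'a set set \<Rightarrow> bool" where
  "giantlike r d \<epsilon> K V E \<longleftrightarrow> real (card (big V E K)) \<le> (rho_star r d + \<epsilon>) * real (card V) \<and>
     (\<exists>L\<subseteq>big V E K. (\<forall>u\<in>L. \<forall>w\<in>L. w \<in> component E u) \<and> (rho_star r d - \<epsilon>) * real (card V) \<le> real (card L))"

text \<open>A choice of \<open>L\<close> as a function of the edge set alone: applied to the edges
  avoiding a vertex, it is independent of the edges at that vertex. Taking the empty set where
  \<open>giantlike\<close> fails keeps the first two properties unconditional.\<close>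

lemma giant_part_exists:
  obtains L where "\<And>E. L E \<subseteq> big V E K" "\<And>E u w. u \<in> L E \<Longrightarrow> w \<in> L E \<Longrightarrow> w \<in> component E u"
    "\<And>E. giantlike r d \<epsilon> K V E \<Longrightarrow> (rho_star r d - \<epsilon>) * real (card V) \<le> real (card (L E))"
proof -
  have "\<forall>E. \<exists>L. L \<subseteq> big V E K \<and> (\<forall>u\<in>L. \<forall>w\<in>L. w \<in> component E u) \<and>
      (giantlike r d \<epsilon> K V E \<longrightarrow> (rho_star r d - \<epsilon>) * real (card V) \<le> real (card L))"
  proof
    fix E
    show "\<exists>L. L \<subseteq> big V E K \<and> (\<forall>u\<in>L. \<forall>w\<in>L. w \<in> component E u) \<and>
      (giantlike r d \<epsilon> K V E \<longrightarrow> (rho_star r d - \<epsilon>) * real (card V) \<le> real (card L))"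
    proof (cases "giantlike r d \<epsilon> K V E")
      case True
      then show ?thesis unfolding giantlike_def by blast
    next
      case False
      then show ?thesis by (intro exI[of _ "{}"]) auto
    qed
  qed
  from choice[OF this] obtain L where "\<forall>E. L E \<subseteq> big V E K \<and> (\<forall>u\<in>L E. \<forall>w\<in>L E. w \<in> component E u) \<and>
      (giantlike r d \<epsilon> K V E \<longrightarrow> (rho_star r d - \<epsilon>) * real (card V) \<le> real (card (L E)))" ..
  then show thesis by (intro that[of L]) blast+
qed

lemma whp_giantlike:
  assumes "r \<ge> 3" "d > 0" "\<epsilon> > 0"
  shows "\<exists>K. whp r d (giantlike r d \<epsilon> K :: 'a set \<Rightarrow> _)"
proof -
  have r2: "r \<ge> 2" using assms by simp
  obtain K where K: "whp r d (\<lambda>(V :: 'a set) E. real (card (big V E K)) \<le> (rho_star r d + \<epsilon>) * real (card V))"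
    using whp_big_le[OF r2 assms(2,3)] by blast
  have "whp r d (giantlike r d \<epsilon> K :: 'a set \<Rightarrow> _)"
  \<comment> \<open>The threshold ensures that a component with
    \<open>(rho_star r d - \<epsilon>) * n\<close> vertices has at least \<open>K\<close> of them
    and so consists of big vertices.\<close>
  proof (rule whp_elim2[OF r2 assms(2) K whp_giant[OF assms] evt_card_real[of _ _ "real K / (rho_star r d - \<epsilon>)"]])
    fix V :: "'a set" and E and p :: real
    assume V: "finite V" "E \<subseteq> rsub r V" "real K / (rho_star r d - \<epsilon>) \<le> real (card V)"
      and B: "real (card (big V E K)) \<le> (rho_star r d + \<epsilon>) * real (card V)"
      and "\<exists>v\<in>V. (rho_star r d - \<epsilon>) * real (card V) \<le> real (card (component E v))"
    then obtain v where v: "v \<in> V" "(rho_star r d - \<epsilon>) * real (card V) \<le> real (card (component E v))" by blast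
    show "giantlike r d \<epsilon> K V E"
    proof (cases "rho_star r d \<le> \<epsilon>")
      case True
      then have "(rho_star r d - \<epsilon>) * real (card V) \<le> 0" by (simp add: mult_nonpos_nonneg)
      then show ?thesis using B unfolding giantlike_def by (intro conjI exI[of _ "{}"]) auto
    next
      case False
      then have "real K \<le> (rho_star r d - \<epsilon>) * real (card V)" using V(3) by (simp add: field_simps)
      then have "v \<in> big V E K" using v by (simp add: big_def)
      then have "component E v \<subseteq> big V E K" using component_subset_big[OF V(2)] by blast
      moreover have "w \<in> component E u" if "u \<in> component E v" "w \<in> component E v" for u w
        using that component_eq by metis
      ultimately show ?thesis using B v unfolding giantlike_def by (intro conjI exI[of _ "component E v"]) auto
    qed
  qed
  then show ?thesis by blast
qed

section \<open>Cycles and the reduced core\<close>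

definition crosses :: "'x set \<Rightarrow> 'x set \<Rightarrow> bool" where
  "crosses U e \<longleftrightarrow> e \<inter> U \<noteq> {} \<and> \<not> e \<subseteq> U"

text \<open>Bridges are defined by cuts instead of paths: \<open>g\<close> is the only edge that
  leaves some set \<open>U\<close>. In this form they behave well when a leaf edge is
  removed.\<close>

definition bridge :: "'x set set \<Rightarrow> 'x set \<Rightarrow> bool" where
  "bridge F g \<longleftrightarrow> (\<exists>U. crosses U g \<and> (\<forall>h\<in>F. crosses U h \<longrightarrow> h = g))"

text \<open>Deleting a leaf edge does not turn another edge into a bridge, so peeling leaves never
  reaches an edge that is not a bridge.\<close>

lemma nonbridge_survives:
  assumes "finite F" "\<forall>e\<in>F. card e = 2" "g \<in> F" "\<not> bridge F g"
  shows "\<exists>F'\<subseteq>F. g \<in> F' \<and> (\<forall>x. card {e \<in> F'. x \<in> e} \<noteq> 1)"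
  using assms
proof (induction "card F" arbitrary: F rule: less_induct)
  case less
  show ?case
  proof (cases "\<forall>x. card {e \<in> F. x \<in> e} \<noteq> 1")
    case True
    then show ?thesis using less.prems by blast
  next
    case False
    then obtain x h where h: "{e \<in> F. x \<in> e} = {h}" by (auto simp: card_1_singleton_iff)
    have hF: "h \<in> F" "x \<in> h" using h by auto
    have only: "e = h" if "e \<in> F" "x \<in> e" for e using h that by auto
    have gh: "g \<noteq> h"
    proof
      assume "g = h"
      then have "\<not> g \<subseteq> {x}" using less.prems(2,3) card_mono[of "{x}" g] by fastforce
      then have "crosses {x} g" using hF \<open>g = h\<close> by (auto simp: crosses_def)
      moreover have "\<forall>e\<in>F. crosses {x} e \<longrightarrow> e = g" using only \<open>g = h\<close> by (auto simp: crosses_def)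
      ultimately show False using less.prems(4) by (auto simp: bridge_def)
    qed
    have xg: "x \<notin> g" using only[of g] gh less.prems(3) by auto
    have "\<not> bridge (F - {h}) g"
    proof
      assume "bridge (F - {h}) g"
      then obtain U where U: "crosses U g" "\<And>e. e \<in> F \<Longrightarrow> e \<noteq> h \<Longrightarrow> crosses U e \<Longrightarrow> e = g"
        by (auto simp: bridge_def)
      show False
      proof (cases "crosses U h")
        case False
        then have "bridge F g" using U unfolding bridge_def by blast
        then show False using less.prems(4) by simp
      next
        case True
        \<comment> \<open>Moving the leaf \<open>x\<close> to the other side of the cut uncrosses
          \<open>h\<close> and affects no other edge, since \<open>h\<close> is the only edge at
          \<open>x\<close>.\<close>
        define U' where "U' = (if x \<in> U then U - {x} else insert x U)"
        have eq: "crosses U' e \<longleftrightarrow> crosses U e" if "x \<notin> e" for e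
          using that by (auto simp: crosses_def U'_def)
        obtain y where y: "h = {x, y}" "x \<noteq> y"
        proof -
          obtain s t where "h = {s, t}" "s \<noteq> t" using less.prems(2) hF by (auto simp: card_2_iff)
          then show thesis using hF(2) that by auto
        qed
        have "\<not> crosses U' h" using True y by (auto simp: crosses_def U'_def)
        moreover have "crosses U' g" using eq[OF xg] U(1) by simp
        moreover have "e = g" if "e \<in> F" "e \<noteq> h" "crosses U' e" for e
          using U(2)[OF that(1,2)] eq[of e] only[of e] that by auto
        ultimately have "bridge F g" unfolding bridge_def by blast
        then show False using less.prems(4) by simp
      qed
    qed
    moreover have "card (F - {h}) < card F" using less.prems(1) hF(1) by (rule card_Diff1_less)
    ultimately have "\<exists>F'\<subseteq>F - {h}. g \<in> F' \<and> (\<forall>x. card {e \<in> F'. x \<in> e} \<noteq> 1)"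
      using less.prems gh by (intro less.hyps) auto
    then show ?thesis by blast
  qed
qed

section \<open>The reduced core in terms of incidences\<close>

abbreviation core :: "'v set \<Rightarrow> 'v set set \<Rightarrow> ('v + 'v set) hypergraph" where
  "core V E \<equiv> reduced_core (factor_graph \<lparr>verts = V, edges = E\<rparr>)"

definition core_inc :: "'v set \<Rightarrow> 'v set set \<Rightarrow> 'v \<Rightarrow> 'v set \<Rightarrow> bool" where
  "core_inc V E v a \<longleftrightarrow> {Inl v, Inr a} \<in> edges (core V E)"

lemma factor_graph_finite:
  assumes "finite V" "finite E"
  shows "finite (edges (factor_graph \<lparr>verts = V, edges = E\<rparr>))"
proof -
  have "edges (factor_graph \<lparr>verts = V, edges = E\<rparr>) \<subseteq> (\<lambda>(v, a). {Inl v, Inr a}) ` (V \<times> E)"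
    by (auto simp: factor_graph_def)
  then show ?thesis by (rule finite_subset) (use assms in simp)
qed

lemma factor_graph_wf: "\<Union>(edges (factor_graph \<lparr>verts = V, edges = E\<rparr>)) \<subseteq> verts (factor_graph \<lparr>verts = V, edges = E\<rparr>)"
  by (auto simp: factor_graph_def)

lemma core_leafless:
  assumes "finite V" "finite E"
  shows "leafless_subgraph (core V E) (factor_graph \<lparr>verts = V, edges = E\<rparr>)"
    and "verts (core V E) = Inl ` V \<union> Inr ` E"
  using is_reduced_core_reduced_core[OF factor_graph_finite[OF assms] factor_graph_wf]
  by (auto simp: is_reduced_core_def factor_graph_def)

lemma core_incD:
  assumes "finite V" "finite E" "core_inc V E v a"
  shows "v \<in> V" "a \<in> E" "v \<in> a"
  using core_leafless(1)[OF assms(1,2)] assms(3)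
  by (auto simp: leafless_subgraph_def subgraph_def core_inc_def factor_graph_def doubleton_eq_iff)

lemma deg_core_var:
  assumes "finite V" "finite E"
  shows "deg (core V E) (Inl v) = card {a. core_inc V E v a}"
proof -
  have sub: "edges (core V E) \<subseteq> edges (factor_graph \<lparr>verts = V, edges = E\<rparr>)"
    using core_leafless(1)[OF assms] by (auto simp: leafless_subgraph_def subgraph_def)
  have "{e \<in> edges (core V E). Inl v \<in> e} = (\<lambda>a. {Inl v, Inr a}) ` {a. core_inc V E v a}"
  proof
    show "{e \<in> edges (core V E). Inl v \<in> e} \<subseteq> (\<lambda>a. {Inl v, Inr a}) ` {a. core_inc V E v a}"
    proof
      fix e assume e: "e \<in> {e \<in> edges (core V E). Inl v \<in> e}"
      then obtain w a where "e = {Inl w, Inr a}" using sub by (auto simp: factor_graph_def)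
      then show "e \<in> (\<lambda>a. {Inl v, Inr a}) ` {a. core_inc V E v a}" using e by (auto simp: core_inc_def)
    qed
  qed (auto simp: core_inc_def)
  moreover have "inj_on (\<lambda>a. {Inl v, Inr a}) {a. core_inc V E v a}"
    by (rule inj_onI) (auto simp: doubleton_eq_iff)
  ultimately show ?thesis by (simp add: deg_def card_image)
qed

lemma deg_core_factor:
  assumes "finite V" "finite E"
  shows "deg (core V E) (Inr a) = card {v. core_inc V E v a}"
proof -
  have sub: "edges (core V E) \<subseteq> edges (factor_graph \<lparr>verts = V, edges = E\<rparr>)"
    using core_leafless(1)[OF assms] by (auto simp: leafless_subgraph_def subgraph_def)
  have "{e \<in> edges (core V E). Inr a \<in> e} = (\<lambda>v. {Inl v, Inr a}) ` {v. core_inc V E v a}"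
  proof
    show "{e \<in> edges (core V E). Inr a \<in> e} \<subseteq> (\<lambda>v. {Inl v, Inr a}) ` {v. core_inc V E v a}"
    proof
      fix e assume e: "e \<in> {e \<in> edges (core V E). Inr a \<in> e}"
      then obtain w b where "e = {Inl w, Inr b}" using sub by (auto simp: factor_graph_def)
      then show "e \<in> (\<lambda>v. {Inl v, Inr a}) ` {v. core_inc V E v a}" using e by (auto simp: core_inc_def)
    qed
  qed (auto simp: core_inc_def)
  moreover have "inj_on (\<lambda>v. {Inl v, Inr a}) {v. core_inc V E v a}"
    by (rule inj_onI) (auto simp: doubleton_eq_iff)
  ultimately show ?thesis by (simp add: deg_def card_image)
qed

lemma core_deg_neq_1:
  assumes "finite V" "finite E"
  shows "card {a. core_inc V E v a} \<noteq> 1" "card {v. core_inc V E v a} \<noteq> 1"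
proof -
  have nl: "deg (core V E) x \<noteq> 1" for x
  proof (cases "x \<in> verts (core V E)")
    case True
    then show ?thesis using core_leafless(1)[OF assms] by (auto simp: leafless_subgraph_def)
  next
    case False
    moreover have "\<Union>(edges (core V E)) \<subseteq> verts (core V E)"
      using core_leafless(1)[OF assms] by (auto simp: leafless_subgraph_def subgraph_def)
    ultimately have "{e \<in> edges (core V E). x \<in> e} = {}" by auto
    then show ?thesis unfolding deg_def by (metis card.empty zero_neq_one)
  qed
  show "card {a. core_inc V E v a} \<noteq> 1" using nl[of "Inl v"] by (simp add: deg_core_var[OF assms])
  show "card {v. core_inc V E v a} \<noteq> 1" using nl[of "Inr a"] by (simp add: deg_core_factor[OF assms])
qed

lemma core_inc_other_factor:
  assumes "finite V" "finite E" "core_inc V E v a"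
  obtains b where "core_inc V E v b" "b \<noteq> a"
proof -
  have "{b. core_inc V E v b} \<noteq> {a}" using core_deg_neq_1(1)[OF assms(1,2), of v] by auto
  then show thesis using assms(3) that by blast
qed

lemma core_inc_other_var:
  assumes "finite V" "finite E" "core_inc V E v a"
  obtains u where "core_inc V E u a" "u \<noteq> v"
proof -
  have "{u. core_inc V E u a} \<noteq> {v}" using core_deg_neq_1(2)[OF assms(1,2), of a] by auto
  then show thesis using assms(3) that by blast
qed

text \<open>The hypothesis says that no cut separates \<open>v\<close> from \<open>a\<close> while
  respecting all other incidences, so the incidence is not a bridge.
  \<open>nonbridge_survives\<close> then puts it into a leafless subgraph, and the core contains all
  of these.\<close>

lemma core_inc_nonbridge:
  assumes "finite V" "finite E" "v \<in> V" "a \<in> E" "v \<in> a"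
    and conn: "\<And>U. (\<And>x e. x \<in> V \<Longrightarrow> e \<in> E \<Longrightarrow> x \<in> e \<Longrightarrow> (x, e) \<noteq> (v, a) \<Longrightarrow> Inl x \<in> U \<longleftrightarrow> Inr e \<in> U)
      \<Longrightarrow> Inl v \<in> U \<longleftrightarrow> Inr a \<in> U"
  shows "core_inc V E v a"
proof -
  let ?G = "factor_graph \<lparr>verts = V, edges = E\<rparr>"
  let ?g = "{Inl v, Inr a} :: ('a + 'a set) set"
  have "\<not> bridge (edges ?G) ?g"
  proof
    assume "bridge (edges ?G) ?g"
    then obtain U where U: "crosses U ?g" "\<And>h. h \<in> edges ?G \<Longrightarrow> crosses U h \<Longrightarrow> h = ?g"
      by (auto simp: bridge_def)
    have "Inl x \<in> U \<longleftrightarrow> Inr e \<in> U" if "x \<in> V" "e \<in> E" "x \<in> e" "(x, e) \<noteq> (v, a)" for x e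
    proof -
      have "{Inl x, Inr e} \<noteq> ?g" using that by (auto simp: doubleton_eq_iff)
      moreover have "{Inl x, Inr e} \<in> edges ?G" using that by (auto simp: factor_graph_def)
      ultimately have "\<not> crosses U {Inl x, Inr e}" using U(2) by blast
      then show ?thesis by (auto simp: crosses_def)
    qed
    then have "Inl v \<in> U \<longleftrightarrow> Inr a \<in> U" by (rule conn)
    then show False using U(1) by (auto simp: crosses_def)
  qed
  moreover have "?g \<in> edges ?G" using assms by (auto simp: factor_graph_def)
  moreover have "\<forall>e\<in>edges ?G. card e = 2" by (auto simp: factor_graph_def)
  ultimately obtain F where F: "F \<subseteq> edges ?G" "?g \<in> F" "\<And>x. card {e \<in> F. x \<in> e} \<noteq> 1"
    using nonbridge_survives[of "edges ?G" ?g] factor_graph_finite[OF assms(1,2)] by blast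
  have "leafless_subgraph \<lparr>verts = verts ?G, edges = F\<rparr> ?G"
    using F factor_graph_wf[of V E] by (auto simp: leafless_subgraph_def subgraph_def deg_def)
  moreover have "core V E = \<lparr>verts = verts ?G, edges = \<Union>{edges R' | R'. leafless_subgraph R' ?G}\<rparr>"
    using is_reduced_core_reduced_core(1)[OF factor_graph_finite[OF assms(1,2)] factor_graph_wf]
    by (subst (asm) is_reduced_core_iff[OF factor_graph_finite[OF assms(1,2)] factor_graph_wf])
  from arg_cong[OF this, of edges]
  have core_eq: "edges (core V E) = \<Union>{edges R' | R'. leafless_subgraph R' ?G}" by simp
  ultimately have "F \<subseteq> edges (core V E)" unfolding core_eq by (intro Union_upper CollectI exI conjI) auto
  then show ?thesis using F(2) unfolding core_inc_def by blast
qed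

text \<open>The cycle runs through \<open>v\<close>, \<open>a\<close>, \<open>u\<close>, then on to
  \<open>w\<close> by edges that avoid \<open>v\<close>, and back through \<open>b\<close>. The case
  \<open>u = w\<close>, where \<open>a\<close> and \<open>b\<close> share a second vertex, is
  included.\<close>

lemma core_inc_cycle_var:
  assumes "finite V" "finite E" "E \<subseteq> Pow V" "a \<in> E" "b \<in> E" "a \<noteq> b" "v \<in> a" "v \<in> b"
    and "u \<in> a" "u \<noteq> v" "w \<in> b" "w \<noteq> v" "w \<in> component {e \<in> E. v \<notin> e} u"
  shows "core_inc V E v a"
proof (rule core_inc_nonbridge)
  fix U assume U: "\<And>x e. x \<in> V \<Longrightarrow> e \<in> E \<Longrightarrow> x \<in> e \<Longrightarrow> (x, e) \<noteq> (v, a) \<Longrightarrow> Inl x \<in> U \<longleftrightarrow> Inr e \<in> U"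
  have inV: "x \<in> V" if "e \<in> E" "x \<in> e" for x e using that assms(3) by auto
  have "component {e \<in> E. v \<notin> e} u \<subseteq> {x. Inl x \<in> U \<longleftrightarrow> Inl u \<in> U}"
  proof (rule component_closed)
    fix e assume "e \<in> {e \<in> E. v \<notin> e}" "e \<inter> {x. Inl x \<in> U \<longleftrightarrow> Inl u \<in> U} \<noteq> {}"
    then obtain x where x: "e \<in> E" "v \<notin> e" "x \<in> e" "Inl x \<in> U \<longleftrightarrow> Inl u \<in> U" by auto
    then have "Inl y \<in> U \<longleftrightarrow> Inr e \<in> U" if "y \<in> e" for y
      using U[of y e] inV[of e y] that by auto
    then show "e \<subseteq> {x. Inl x \<in> U \<longleftrightarrow> Inl u \<in> U}" using x by blast
  qed simp
  then have "Inl w \<in> U \<longleftrightarrow> Inl u \<in> U" using assms(13) by auto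
  moreover have "Inl u \<in> U \<longleftrightarrow> Inr a \<in> U" using U[of u a] inV[of a u] assms by auto
  moreover have "Inl w \<in> U \<longleftrightarrow> Inr b \<in> U" using U[of w b] inV[of b w] assms by auto
  moreover have "Inl v \<in> U \<longleftrightarrow> Inr b \<in> U" using U[of v b] inV[of b v] assms by auto
  ultimately show "Inl v \<in> U \<longleftrightarrow> Inr a \<in> U" by simp
qed (use assms(1-4,7) in auto)

text \<open>The cycle leaves \<open>a\<close> at \<open>u\<close> and returns at \<open>w\<close>,
  using other edges in between.\<close>

lemma core_inc_cycle_factor:
  assumes "finite V" "finite E" "E \<subseteq> Pow V" "a \<in> E" "u \<in> a" "w \<in> a" "u \<noteq> w" "w \<in> component (E - {a}) u"
  shows "core_inc V E u a"
proof (rule core_inc_nonbridge)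
  fix U assume U: "\<And>x e. x \<in> V \<Longrightarrow> e \<in> E \<Longrightarrow> x \<in> e \<Longrightarrow> (x, e) \<noteq> (u, a) \<Longrightarrow> Inl x \<in> U \<longleftrightarrow> Inr e \<in> U"
  have inV: "x \<in> V" if "e \<in> E" "x \<in> e" for x e using that assms(3) by auto
  have "component (E - {a}) u \<subseteq> {x. Inl x \<in> U \<longleftrightarrow> Inl u \<in> U}"
  proof (rule component_closed)
    fix e assume "e \<in> E - {a}" "e \<inter> {x. Inl x \<in> U \<longleftrightarrow> Inl u \<in> U} \<noteq> {}"
    then obtain x where x: "e \<in> E" "e \<noteq> a" "x \<in> e" "Inl x \<in> U \<longleftrightarrow> Inl u \<in> U" by auto
    then have "Inl y \<in> U \<longleftrightarrow> Inr e \<in> U" if "y \<in> e" for y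
      using U[of y e] inV[of e y] that by auto
    then show "e \<subseteq> {x. Inl x \<in> U \<longleftrightarrow> Inl u \<in> U}" using x by blast
  qed simp
  then have "Inl w \<in> U \<longleftrightarrow> Inl u \<in> U" using assms(8) by auto
  moreover have "Inl w \<in> U \<longleftrightarrow> Inr a \<in> U" using U[of w a] inV[of a w] assms by auto
  ultimately show "Inl u \<in> U \<longleftrightarrow> Inr a \<in> U" by simp
qed (use assms(1-5) in auto)

text \<open>A connected vertex set spanned by \<open>m\<close> edges of size \<open>r\<close> has at most \<open>1 + (r - 1) m\<close>
  elements; \<open>dense\<close> sets fall below this bound and are therefore spanned by a cyclic subhypergraph.\<close>

definition dense :: "nat \<Rightarrow> 'a set set \<Rightarrow> 'a set \<Rightarrow> bool" where
  "dense r E W \<longleftrightarrow> card W \<le> (r - 1) * card {e \<in> E. e \<subseteq> W}"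

text \<open>The size bound is that of the set explored by \<open>K\<close> steps from one edge, each
  adding at most \<open>r - 1\<close> new vertices.\<close>

definition sparse_near :: "nat \<Rightarrow> 'a set \<Rightarrow> 'a set set \<Rightarrow> nat \<Rightarrow> 'a set \<Rightarrow> bool" where
  "sparse_near r V E K A \<longleftrightarrow> (\<forall>W\<subseteq>V. A \<subseteq> W \<longrightarrow> card W \<le> r + (r - 1) * K \<longrightarrow> \<not> dense r E W)"

lemma sparse_near_mono: "sparse_near r V E K A \<Longrightarrow> A \<subseteq> A' \<Longrightarrow> sparse_near r V E K A'"
  unfolding sparse_near_def by blast

text \<open>In the absence of dense sets near \<open>a\<close>, a walk in the core can be continued from \<open>u\<close> away from
  \<open>a\<close>, each step reaching a new vertex.\<close>

lemma core_walk:
  assumes V: "finite V" and E: "E \<subseteq> rsub r V" and r: "r \<ge> 2" and ua: "core_inc V E u a"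
    and sparse: "sparse_near r V E K a"
    and "i \<le> K"
  shows "\<exists>W c x Y. a \<subseteq> W \<and> W \<subseteq> V \<and> card W \<le> r + (r - 1) * i \<and> card W \<le> 1 + (r - 1) * card {e \<in> E. e \<subseteq> W} \<and>
      core_inc V E x c \<and> c \<subseteq> W \<and> (\<forall>e\<in>E. e \<subseteq> W \<and> x \<in> e \<longrightarrow> e = c) \<and> (x = u \<or> x \<notin> a) \<and>
      Y \<subseteq> W \<and> x \<in> Y \<and> Y \<subseteq> component {c \<in> E. c \<noteq> a \<and> c \<inter> a \<subseteq> {u}} u \<and> i < card Y"
proof -
  have finE: "finite E" by (rule finite_subset[OF E]) (simp add: V)
  have sz: "card e = r" "finite e" "e \<subseteq> V" if "e \<in> E" for e
    using that E by (auto simp: rsub_def intro: finite_subset[OF _ V])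
  note inc = core_incD[OF V finE]
  \<comment> \<open>Invariant after \<open>i\<close> steps: \<open>W\<close> is the explored set,
    \<open>c\<close> the last edge, \<open>x\<close> the vertex reached in it, and \<open>Y\<close>
    contains more than \<open>i\<close> visited vertices, reached from \<open>u\<close> without
    meeting the rest of \<open>a\<close>. The lower bound on the edges in \<open>W\<close> is that
    of a hypertree, so a single further coincidence makes the next set dense.\<close>
  show ?thesis
    using \<open>i \<le> K\<close>
  proof (induction i)
    case 0
    have a: "a \<in> E" "u \<in> a" using inc[OF ua] by auto
    have eq: "e = a" if "e \<in> E" "e \<subseteq> a" for e
      using card_subset_eq[of a e] sz[OF a(1)] sz[OF that(1)] that(2) by simp
    have "{e \<in> E. e \<subseteq> a} = {a}" using eq a by auto
    then have "card {e \<in> E. e \<subseteq> a} = 1" by simp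
    then show ?case using sz[OF a(1)] a ua r eq
      by (intro exI[of _ a] exI[of _ a] exI[of _ u] exI[of _ "{u}"]) auto
  next
    case (Suc i)
    then obtain W c x Y where W: "a \<subseteq> W" "W \<subseteq> V" "card W \<le> r + (r - 1) * i" "card W \<le> 1 + (r - 1) * card {e \<in> E. e \<subseteq> W}"
      and c: "core_inc V E x c" "c \<subseteq> W" "\<And>e. e \<in> E \<Longrightarrow> e \<subseteq> W \<Longrightarrow> x \<in> e \<Longrightarrow> e = c" "x = u \<or> x \<notin> a"
      and Y: "Y \<subseteq> W" "x \<in> Y" "Y \<subseteq> component {c \<in> E. c \<noteq> a \<and> c \<inter> a \<subseteq> {u}} u" "i < card Y"
      by (auto simp: Suc_le_eq)
    have finW: "finite W" by (rule finite_subset[OF W(2) V])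
    obtain c' where c': "core_inc V E x c'" "c' \<noteq> c" by (rule core_inc_other_factor[OF V finE c(1)])
    have c'E: "c' \<in> E" "x \<in> c'" using inc[OF c'(1)] by auto
    have xW: "x \<in> W" using Y by auto
    have c'W: "\<not> c' \<subseteq> W" using c(3)[of c'] c'E c'(2) by auto
    define W' where "W' = W \<union> c'"
    have W': "a \<subseteq> W'" "W' \<subseteq> V" using W sz(3)[OF c'E(1)] by (auto simp: W'_def)
    have edges1: "Suc (card {e \<in> E. e \<subseteq> W}) \<le> card {e \<in> E. e \<subseteq> W'}"
    proof -
      have "card (insert c' {e \<in> E. e \<subseteq> W}) \<le> card {e \<in> E. e \<subseteq> W'}"
        using finE c'E by (intro card_mono) (auto simp: W'_def)
      then show ?thesis using finE c'W by simp
    qed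
    have cW': "card W' + card (W \<inter> c') = card W + r"
      using card_Un_Int[OF finW sz(2)[OF c'E(1)]] sz(1)[OF c'E(1)] by (simp add: W'_def)
    have bd: "card W' \<le> r + (r - 1) * Suc i"
    proof -
      have "1 \<le> card (W \<inter> c')" using xW c'E finW by (auto simp: Suc_le_eq card_gt_0_iff)
      then show ?thesis using cW' W(3) r by simp
    qed
    also have "\<dots> \<le> r + (r - 1) * K" using Suc.prems by (intro add_left_mono mult_left_mono) auto
    finally have nd: "\<not> dense r E W'" using sparse W' unfolding sparse_near_def by blast
    \<comment> \<open>The next edge meets the explored set only in \<open>x\<close>; a second common
      vertex would make \<open>W'\<close> dense.\<close>
    have Wc': "W \<inter> c' = {x}"
    proof (rule ccontr)
      assume "W \<inter> c' \<noteq> {x}"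
      then obtain z where "z \<in> W \<inter> c'" "z \<noteq> x" using xW c'E by auto
      then have "card {x, z} \<le> card (W \<inter> c')" using xW c'E finW by (intro card_mono) auto
      then have "card W' + 2 \<le> card W + r" using cW' \<open>z \<noteq> x\<close> by simp
      also have "\<dots> \<le> 1 + (r - 1) * card {e \<in> E. e \<subseteq> W} + r" using W(4) by simp
      also have "\<dots> = (r - 1) * Suc (card {e \<in> E. e \<subseteq> W}) + 2" using r by simp
      also have "\<dots> \<le> (r - 1) * card {e \<in> E. e \<subseteq> W'} + 2" using edges1 by (intro add_right_mono mult_left_mono) auto
      finally show False using nd by (simp add: dense_def)
    qed
    then have cW: "card W' = card W + (r - 1)" using cW' r by simp
    obtain x' where x': "core_inc V E x' c'" "x' \<noteq> x" by (rule core_inc_other_var[OF V finE c'(1)])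
    have x'c: "x' \<in> c'" using inc[OF x'(1)] by auto
    have x'W: "x' \<notin> W" using Wc' x'(2) x'c by auto
    \<comment> \<open>A second edge at \<open>x'\<close> inside \<open>W'\<close> would also make
      \<open>W'\<close> dense. Hence the other core edge at \<open>x'\<close> must leave
      \<open>W'\<close>, and the walk goes on.\<close>
    have uniq: "e = c'" if e: "e \<in> E" "e \<subseteq> W'" "x' \<in> e" for e
    proof (rule ccontr)
      assume "e \<noteq> c'"
      have "\<not> e \<subseteq> W" using x'W e by auto
      have "card (insert e (insert c' {e \<in> E. e \<subseteq> W})) \<le> card {e \<in> E. e \<subseteq> W'}"
        using finE c'E e by (intro card_mono) (auto simp: W'_def)
      then have two: "card {e \<in> E. e \<subseteq> W} + 2 \<le> card {e \<in> E. e \<subseteq> W'}"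
        using finE c'W \<open>e \<noteq> c'\<close> \<open>\<not> e \<subseteq> W\<close> by simp
      have "card W' \<le> 1 + (r - 1) * card {e \<in> E. e \<subseteq> W} + (r - 1)" using W(4) cW by simp
      also have "\<dots> \<le> (r - 1) * (card {e \<in> E. e \<subseteq> W} + 2)" using r by (simp add: algebra_simps)
      also have "\<dots> \<le> (r - 1) * card {e \<in> E. e \<subseteq> W'}" using two by (intro mult_left_mono) auto
      finally show False using nd by (simp add: dense_def)
    qed
    have "card W' \<le> 1 + (r - 1) * card {e \<in> E. e \<subseteq> W} + (r - 1)" using W(4) cW by simp
    also have "\<dots> = 1 + (r - 1) * Suc (card {e \<in> E. e \<subseteq> W})" by simp
    also have "\<dots> \<le> 1 + (r - 1) * card {e \<in> E. e \<subseteq> W'}" using edges1 by (intro add_left_mono mult_left_mono) auto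
    finally have tight: "card W' \<le> 1 + (r - 1) * card {e \<in> E. e \<subseteq> W'}" .
    have "c' \<in> {c \<in> E. c \<noteq> a \<and> c \<inter> a \<subseteq> {u}}"
    proof -
      have "c' \<inter> a \<subseteq> {x}" using Wc' W(1) by blast
      then have "c' \<inter> a \<subseteq> {u}" using c(4) by blast
      then show ?thesis using c'E c'W W(1) by blast
    qed
    from component_edge[OF this c'E(2) subsetD[OF Y(3,2)]]
    have "x' \<in> component {c \<in> E. c \<noteq> a \<and> c \<inter> a \<subseteq> {u}} u"
      using x'c by (rule subsetD)
    then have Y': "insert x' Y \<subseteq> component {c \<in> E. c \<noteq> a \<and> c \<inter> a \<subseteq> {u}} u" using Y by auto
    have "finite Y" by (rule finite_subset[OF Y(1) finW])
    moreover have "x' \<notin> Y" using Y(1) x'W by blast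
    ultimately have cY: "Suc i < card (insert x' Y)" using Y(4) by simp
    show ?case
    proof (intro exI conjI)
      show "a \<subseteq> W'" "W' \<subseteq> V" by (rule W')+
      show "card W' \<le> r + (r - 1) * Suc i" by (rule bd)
      show "card W' \<le> 1 + (r - 1) * card {e \<in> E. e \<subseteq> W'}" by (rule tight)
      show "core_inc V E x' c'" by (rule x'(1))
      show "c' \<subseteq> W'" by (simp add: W'_def)
      show "\<forall>e\<in>E. e \<subseteq> W' \<and> x' \<in> e \<longrightarrow> e = c'" using uniq by blast
      show "x' = u \<or> x' \<notin> a" using x'W W(1) by blast
      show "insert x' Y \<subseteq> W'" using Y(1) x'c by (auto simp: W'_def)
      show "x' \<in> insert x' Y" by simp
    qed (rule Y' cY)+
  qed
qed

text \<open>The restriction to edges that meet \<open>a\<close> at most in \<open>u\<close> serves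
  both kinds of nodes: such edges differ from \<open>a\<close>, and they avoid every other vertex
  \<open>v\<close> of \<open>a\<close>.\<close>

lemma core_inc_component_ge:
  assumes V: "finite V" and E: "E \<subseteq> rsub r V" and r: "r \<ge> 2" and ua: "core_inc V E u a"
    and sparse: "sparse_near r V E K a"
  shows "K \<le> card (component {c \<in> E. c \<noteq> a \<and> c \<inter> a \<subseteq> {u}} u)"
proof -
  from core_walk[OF V E r ua sparse order_refl]
  obtain Y where Y: "Y \<subseteq> component {c \<in> E. c \<noteq> a \<and> c \<inter> a \<subseteq> {u}} u" "K < card Y"
    by (elim exE conjE)
  have finE: "finite E" by (rule finite_subset[OF E]) (simp add: V)
  have "u \<in> V" using core_incD[OF V finE ua] by simp
  then have "component {c \<in> E. c \<noteq> a \<and> c \<inter> a \<subseteq> {u}} u \<subseteq> V"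
    using E by (intro component_subset[of _ r]) auto
  then have "card Y \<le> card (component {c \<in> E. c \<noteq> a \<and> c \<inter> a \<subseteq> {u}} u)"
    using Y V by (intro card_mono) (auto intro: finite_subset)
  then show ?thesis using Y by simp
qed

text \<open>A single candidate incidence cannot survive alone, as degree 1 is excluded in the core;
  this is the source of \<open>one_to_zero\<close>.\<close>

lemma card_eq_one_to_zero:
  assumes "C \<subseteq> A" "2 \<le> card A \<Longrightarrow> A \<subseteq> C" "card C \<noteq> 1" "finite A"
  shows "card C = one_to_zero (card A)"
proof (cases "2 \<le> card A")
  case True
  then show ?thesis using assms(1,2) by (simp add: one_to_zero_def subset_antisym)
next
  case False
  moreover have "card C \<le> card A" using assms(1,4) by (rule card_mono[rotated])
  ultimately show ?thesis using assms(3) by (auto simp: one_to_zero_def)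
qed

lemma deg_core_var_eq:
  assumes V: "finite V" and E: "E \<subseteq> rsub r V" and r: "r \<ge> 2"
    and sparse: "sparse_near r V E K {v}"
    and L: "L \<subseteq> B" "\<And>u w. u \<in> L \<Longrightarrow> w \<in> L \<Longrightarrow> w \<in> component {e \<in> E. v \<notin> e} u"
    and B: "big (V - {v}) {e \<in> E. v \<notin> e} K \<subseteq> B" "v \<notin> B"
    and hit: "\<And>e. e \<in> E \<Longrightarrow> v \<in> e \<Longrightarrow> e \<inter> (B - L) = {}"
  shows "deg (core V E) (Inl v) = one_to_zero (card {e \<in> E. v \<in> e \<and> e \<inter> B \<noteq> {}})"
proof -
  define A where "A = {e \<in> E. v \<in> e \<and> e \<inter> B \<noteq> {}}"
  define C where "C = {a. core_inc V E v a}"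
  have finE: "finite E" by (rule finite_subset[OF E]) (simp add: V)
  have EV: "E \<subseteq> Pow V" using E by (auto simp: rsub_def)
  have finA: "finite A" using finE by (simp add: A_def)
  have "C \<subseteq> A"
  proof
    fix a assume "a \<in> C"
    then have va: "core_inc V E v a" by (simp add: C_def)
    obtain u where u: "core_inc V E u a" "u \<noteq> v" by (rule core_inc_other_var[OF V finE va])
    have a: "a \<in> E" "v \<in> a" "u \<in> a" "u \<in> V" using core_incD[OF V finE va] core_incD[OF V finE u(1)] by auto
    \<comment> \<open>An edge of \<open>?E\<close> meets \<open>a\<close> at most in
      \<open>u\<close> and thus avoids \<open>v\<close>, so \<open>?E\<close> is contained in
      \<open>?E'\<close>.\<close>
    let ?E = "{c \<in> E. c \<noteq> a \<and> c \<inter> a \<subseteq> {u}}" and ?E' = "{e \<in> E. v \<notin> e}"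
    have "K \<le> card (component ?E u)"
      using a(2) by (intro core_inc_component_ge[OF V E r u(1)] sparse_near_mono[OF sparse]) auto
    also have "component ?E' u \<subseteq> V - {v}"
      using a u(2) E by (intro component_subset[of _ r]) (auto simp: rsub_def)
    then have "card (component ?E u) \<le> card (component ?E' u)"
      using V a(2) u(2) by (intro card_mono component_mono) (auto intro: finite_subset)
    finally have "u \<in> big (V - {v}) ?E' K" using a u(2) by (simp add: big_def)
    then show "a \<in> A" using B a by (auto simp: A_def)
  qed
  moreover have "A \<subseteq> C" if ge2: "2 \<le> card A"
  proof
    fix a assume a: "a \<in> A"
    have "A \<noteq> {a}" using ge2 by auto
    then obtain b where b: "b \<in> A" "b \<noteq> a" using a by blast
    obtain u where u: "u \<in> a" "u \<in> B" using a by (auto simp: A_def)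
    obtain w where w: "w \<in> b" "w \<in> B" using b by (auto simp: A_def)
    have uL: "u \<in> L" "w \<in> L" using hit[of a] hit[of b] a b u w by (auto simp: A_def)
    have "core_inc V E v a"
      using a b u w B(2) L(2)[OF uL] by (intro core_inc_cycle_var[OF V finE EV, of a b v u w]) (auto simp: A_def)
    then show "a \<in> C" by (simp add: C_def)
  qed
  moreover have "card C \<noteq> 1" unfolding C_def by (rule core_deg_neq_1[OF V finE])
  ultimately have "card C = one_to_zero (card A)" using finA by (intro card_eq_one_to_zero)
  then show ?thesis using deg_core_var[OF V finE] by (simp add: A_def C_def)
qed

lemma deg_core_factor_eq:
  assumes V: "finite V" and E: "E \<subseteq> rsub r V" and r: "r \<ge> 2" and a: "a \<in> E"
    and sparse: "sparse_near r V E K a"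
    and L: "\<And>u w. u \<in> L \<Longrightarrow> w \<in> L \<Longrightarrow> w \<in> component (E - {a}) u"
    and hit: "a \<inter> (big V (E - {a}) K - L) = {}"
  shows "deg (core V E) (Inr a) = one_to_zero (card (a \<inter> big V (E - {a}) K))"
proof -
  define B where "B = big V (E - {a}) K"
  define A where "A = a \<inter> B"
  define C where "C = {v. core_inc V E v a}"
  have finE: "finite E" by (rule finite_subset[OF E]) (simp add: V)
  have EV: "E \<subseteq> Pow V" using E by (auto simp: rsub_def)
  have finA: "finite A" using a EV V by (auto simp: A_def intro: finite_subset)
  have "C \<subseteq> A"
  proof
    fix u assume "u \<in> C"
    then have u: "core_inc V E u a" by (simp add: C_def)
    have ua: "u \<in> a" "u \<in> V" using core_incD[OF V finE u] by auto
    let ?E = "{c \<in> E. c \<noteq> a \<and> c \<inter> a \<subseteq> {u}}"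
    have "K \<le> card (component ?E u)" by (rule core_inc_component_ge[OF V E r u sparse])
    also have "component (E - {a}) u \<subseteq> V"
      using ua E by (intro component_subset[of _ r]) auto
    then have "card (component ?E u) \<le> card (component (E - {a}) u)"
      using V by (intro card_mono component_mono) (auto intro: finite_subset)
    finally show "u \<in> A" using ua by (simp add: big_def A_def B_def)
  qed
  moreover have "A \<subseteq> C" if ge2: "2 \<le> card A"
  proof
    fix u assume u: "u \<in> A"
    have "A \<noteq> {u}" using ge2 by auto
    then obtain w where w: "w \<in> A" "w \<noteq> u" using u by blast
    have "w \<in> component (E - {a}) u" using u w hit by (intro L) (auto simp: A_def B_def)
    then have "core_inc V E u a"
      using a u w by (intro core_inc_cycle_factor[OF V finE EV, of a u w]) (auto simp: A_def)
    then show "u \<in> C" by (simp add: C_def)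
  qed
  moreover have "card C \<noteq> 1" unfolding C_def by (rule core_deg_neq_1[OF V finE])
  ultimately have "card C = one_to_zero (card A)" using finA by (intro card_eq_one_to_zero)
  then show ?thesis using deg_core_factor[OF V finE] by (simp add: A_def B_def C_def)
qed

section \<open>Degrees of variable nodes\<close>

text \<open>Density of \<open>W\<close> forces a set \<open>F\<close> of edges inside
  \<open>W\<close> with \<open>card W \<le> (r - 1) * card F\<close>, and \<open>p ^ card F\<close>
  is of order \<open>n\<close> to the power \<open>- (r - 1) * card F\<close>. The number of such
  \<open>F\<close> is bounded in terms of \<open>M\<close>.\<close>

lemma evt_dense:
  assumes "r \<ge> 2" "d > 0"
  obtains C where "C > 0" "evt r d (\<lambda>(V :: 'a set) p. \<forall>W\<subseteq>V. card W \<le> M \<longrightarrow>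
      rprob (rsub r V) p (\<lambda>E. dense r E W) \<le> C / real (card V) ^ card W)"
proof -
  obtain c where c: "c > 0" "evt r d (\<lambda>(V :: 'a set) p. admissible r c V p)"
    by (rule evt_bound[OF assms])
  \<comment> \<open>At least 1, so that its power may be raised to the maximal exponent
    \<open>2 ^ M\<close>, a bound for the number of \<open>r\<close>-subsets of
    \<open>W\<close>.\<close>
  define c1 where "c1 = max 1 c"
  define C where "C = 2 ^ (2 ^ M) * c1 ^ (2 ^ M)"
  have "C > 0" by (simp add: C_def c1_def)
  moreover have "evt r d (\<lambda>(V :: 'a set) p. \<forall>W\<subseteq>V. card W \<le> M \<longrightarrow>
      rprob (rsub r V) p (\<lambda>E. dense r E W) \<le> C / real (card V) ^ card W)"
  proof (rule evt_elim2[OF c(2) evt_card[of _ _ 1]], intro allI impI)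
    fix V :: "'a set" and p W
    assume *: "admissible r c V p" "1 \<le> card V"
      and W: "W \<subseteq> V" "card W \<le> M"
    define n where "n = real (card V)"
    have n: "n \<ge> 1" using * by (simp add: n_def)
    have finW: "finite W" using W * by (auto intro: finite_subset)
    define FF where "FF = {F. F \<subseteq> rsub r W \<and> card W \<le> (r - 1) * card F}"
    have finFF: "finite FF" unfolding FF_def using finW by (auto intro: finite_subset[of _ "Pow (rsub r W)"])
    have cW: "card (rsub r W) \<le> 2 ^ M"
    proof -
      have "card (rsub r W) \<le> card (Pow W)" using finW by (intro card_mono) (auto simp: rsub_def)
      also have "\<dots> \<le> 2 ^ M" using finW W by (simp add: card_Pow)
      finally show ?thesis .
    qed
    have "card FF \<le> card (Pow (rsub r W))" using finW by (intro card_mono) (auto simp: FF_def)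
    also have "\<dots> \<le> 2 ^ (2 ^ M)" using finW cW by (simp add: card_Pow)
    finally have cFF: "card FF \<le> 2 ^ (2 ^ M)" .
    have "rprob (rsub r V) p (\<lambda>E. dense r E W) \<le> (\<Sum>F\<in>FF. rprob (rsub r V) p (\<lambda>E. F \<subseteq> E))"
    proof (rule rprob_union_bound)
      fix E assume E: "E \<subseteq> rsub r V" "dense r E W"
      then have "{e \<in> E. e \<subseteq> W} \<in> FF" by (auto simp: FF_def dense_def rsub_def)
      then show "\<exists>F\<in>FF. F \<subseteq> E" by (rule bexI[rotated]) auto
    qed (use * finFF in auto)
    also have "\<dots> \<le> (\<Sum>F\<in>FF. c1 ^ (2 ^ M) / n ^ card W)"
    proof (rule sum_mono)
      fix F assume F: "F \<in> FF"
      have FV: "F \<subseteq> rsub r V" using F rsub_mono[OF W(1), of r] by (auto simp: FF_def)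
      have cF: "card F \<le> 2 ^ M"
        using F finW cW card_mono[of "rsub r W" F] by (auto simp: FF_def)
      have "rprob (rsub r V) p (\<lambda>E. F \<subseteq> E) = p ^ card F" using * by (intro rprob_supset FV) auto
      also have "\<dots> \<le> (c1 / n ^ (r - 1)) ^ card F"
        using * n by (intro power_mono) (auto simp: field_simps n_def c1_def)
      also have "\<dots> = c1 ^ card F / n ^ ((r - 1) * card F)" by (simp add: power_divide power_mult)
      also have "\<dots> \<le> c1 ^ (2 ^ M) / n ^ card W"
        using n F cF by (intro frac_le power_increasing) (auto simp: c1_def FF_def)
      finally show "rprob (rsub r V) p (\<lambda>E. F \<subseteq> E) \<le> c1 ^ (2 ^ M) / n ^ card W" .
    qed
    also have "\<dots> = real (card FF) * (c1 ^ (2 ^ M) / n ^ card W)" by simp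
    also have "\<dots> \<le> 2 ^ (2 ^ M) * (c1 ^ (2 ^ M) / n ^ card W)"
    proof (intro mult_right_mono)
      show "real (card FF) \<le> 2 ^ 2 ^ M" using cFF by (metis of_nat_le_iff of_nat_numeral of_nat_power)
    qed (use n in \<open>auto simp: c1_def\<close>)
    finally show "rprob (rsub r V) p (\<lambda>E. dense r E W) \<le> C / real (card V) ^ card W"
      by (simp add: C_def n_def)
  qed
  ultimately show thesis by (rule that)
qed

text \<open>At most \<open>n ^ (k - 1)\<close> sets of size \<open>k\<close> contain
  \<open>v\<close>, one factor \<open>n\<close> short of compensating the density bound, so the
  union bound is of order \<open>1 / n\<close>.\<close>

lemma evt_sparse_near:
  assumes "r \<ge> 2" "d > 0" "\<epsilon> > 0"
  shows "evt r d (\<lambda>(V :: 'a set) p. \<forall>v\<in>V. rprob (rsub r V) p (\<lambda>E. \<not> sparse_near r V E K {v}) \<le> \<epsilon>)"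
proof -
  define M where "M = r + (r - 1) * K"
  obtain c where c: "c > 0" "evt r d (\<lambda>(V :: 'a set) p. admissible r c V p)"
    by (rule evt_bound[OF assms(1,2)])
  obtain C where C: "C > 0" "evt r d (\<lambda>(V :: 'a set) p. \<forall>W\<subseteq>V. card W \<le> M \<longrightarrow>
      rprob (rsub r V) p (\<lambda>E. dense r E W) \<le> C / real (card V) ^ card W)"
    by (rule evt_dense[OF assms(1,2)])
  show ?thesis
  proof (rule evt_elim4[OF c(2) C(2) evt_card[of _ _ 1] evt_card_real[of _ _ "real M * C / \<epsilon>"]], rule ballI)
    fix V :: "'a set" and p v
    assume *: "admissible r c V p" "1 \<le> card V"
      and d: "\<forall>W\<subseteq>V. card W \<le> M \<longrightarrow> rprob (rsub r V) p (\<lambda>E. dense r E W) \<le> C / real (card V) ^ card W"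
      and large: "real M * C / \<epsilon> \<le> real (card V)" and v: "v \<in> V"
    define n where "n = real (card V)"
    have n: "n \<ge> 1" using * by (simp add: n_def)
    define A where "A k = {W \<in> rsub k V. {v} \<subseteq> W}" for k
    have finA: "finite (A k)" for k using * by (simp add: A_def)
    have "rprob (rsub r V) p (\<lambda>E. \<not> sparse_near r V E K {v})
        \<le> (\<Sum>x\<in>(SIGMA k:{1..M}. A k). rprob (rsub r V) p (\<lambda>E. dense r E (snd x)))"
    proof (rule rprob_union_bound)
      fix E assume "\<not> sparse_near r V E K {v}"
      then obtain W where W: "W \<subseteq> V" "v \<in> W" "card W \<le> M" "dense r E W"
        by (auto simp: sparse_near_def M_def)
      have "finite W" using W(1) * by (auto intro: finite_subset)
      then have "card W \<noteq> 0" using W(2) by auto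
      then have "(card W, W) \<in> (SIGMA k:{1..M}. A k)" using W by (auto simp: A_def rsub_def)
      then show "\<exists>x\<in>(SIGMA k:{1..M}. A k). dense r E (snd x)" by (rule bexI[rotated]) (simp add: W)
    qed (use * finA in auto)
    also have "\<dots> = (\<Sum>k\<in>{1..M}. \<Sum>W\<in>A k. rprob (rsub r V) p (\<lambda>E. dense r E W))"
      using finA by (subst sum.Sigma) (auto simp: case_prod_unfold)
    also have "\<dots> \<le> (\<Sum>k\<in>{1..M}. C / n)"
    proof (rule sum_mono)
      fix k assume k: "k \<in> {1..M}"
      have "(\<Sum>W\<in>A k. rprob (rsub r V) p (\<lambda>E. dense r E W)) \<le> (\<Sum>W\<in>A k. C / n ^ k)"
        using d k by (intro sum_mono) (auto simp: A_def rsub_def n_def)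
      also have "\<dots> = real (card (A k)) * (C / n ^ k)" by simp
      also have "\<dots> \<le> n ^ (k - 1) * (C / n ^ k)"
      proof (intro mult_right_mono)
        have "card (A k) = (card V - 1) choose (k - 1)"
          using card_rsub_supset[of V "{v}" k] * v k by (simp add: A_def)
        also have "\<dots> \<le> (card V - 1) ^ (k - 1)" by (rule binomial_le_power)
        also have "\<dots> \<le> card V ^ (k - 1)" by (intro power_mono) auto
        finally show "real (card (A k)) \<le> n ^ (k - 1)" by (simp add: n_def flip: of_nat_power)
      qed (use C n in auto)
      also have "\<dots> = C / n" using k n by (cases k) auto
      finally show "(\<Sum>W\<in>A k. rprob (rsub r V) p (\<lambda>E. dense r E W)) \<le> C / n" .
    qed
    also have "\<dots> = real M * C / n" by simp
    also have "\<dots> \<le> \<epsilon>" using large n assms by (simp add: n_def field_simps)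
    finally show "rprob (rsub r V) p (\<lambda>E. \<not> sparse_near r V E K {v}) \<le> \<epsilon>" .
  qed
qed

text \<open>Stands in for the core degree of \<open>v\<close>. With \<open>w\<close> removed as
  well, the counts for \<open>v\<close> and for \<open>w\<close> are conditionally independent;
  edges containing both vertices are dropped because they are rare.\<close>

definition big_hits :: "'a set \<Rightarrow> nat \<Rightarrow> 'a \<Rightarrow> 'a \<Rightarrow> 'a set set \<Rightarrow> nat" where
  "big_hits V K v w E =
     card {e \<in> E. v \<in> e \<and> w \<notin> e \<and> e \<inter> big (V - {v, w}) {e \<in> E. v \<notin> e \<and> w \<notin> e} K \<noteq> {}}"

text \<open>The candidates for \<open>v\<close> are the big vertices without \<open>v\<close>, those
  without \<open>v\<close> and \<open>w\<close>, and the giant part \<open>L\<close> of the latter.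
  These sets decrease in this order, so if no edge at \<open>v\<close> meets \<open>w\<close> or the
  difference of the first and the last, all three counts agree. The bound adds
  \<open>\<epsilon>\<close> for dense sets, \<open>2 * \<epsilon>\<close> for the two giants and
  \<open>3 * c * \<epsilon>\<close> for hitting the difference.\<close>

lemma rprob_deg_core_var_neq:
  assumes V: "finite V" "v \<in> V" "w \<in> V" "v \<noteq> w" and r: "r \<ge> 3" and p: "0 < p" "p < 1"
    and \<epsilon>: "0 < \<epsilon>" "3 + 2 * \<epsilon> \<le> \<epsilon> * real (card V)" and b: "p * real (card V) ^ (r - 1) \<le> c"
    and sp: "rprob (rsub r V) p (\<lambda>E. \<not> sparse_near r V E K {v}) \<le> \<epsilon>"
    and g1: "rprob (rsub r (V - {v})) p (\<lambda>E. \<not> giantlike r d \<epsilon> K (V - {v}) E) \<le> \<epsilon>"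
    and g2: "rprob (rsub r (V - {v, w})) p (\<lambda>E. \<not> giantlike r d \<epsilon> K (V - {v, w}) E) \<le> \<epsilon>"
  shows "rprob (rsub r V) p (\<lambda>E. deg (core V E) (Inl v) \<noteq> one_to_zero (big_hits V K v w E)) \<le> (3 + 3 * c) * \<epsilon>"
proof -
  define n where "n = real (card V)"
  obtain L where L: "\<And>E. L E \<subseteq> big (V - {v, w}) E K" "\<And>E u x. u \<in> L E \<Longrightarrow> x \<in> L E \<Longrightarrow> x \<in> component E u"
    "\<And>E. giantlike r d \<epsilon> K (V - {v, w}) E \<Longrightarrow> (rho_star r d - \<epsilon>) * real (card (V - {v, w})) \<le> real (card (L E))"
    using giant_part_exists[where V = "V - {v, w}" and K = K and \<epsilon> = \<epsilon> and r = r and d = d] by metis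
  \<comment> \<open>Determined by the edges that avoid \<open>v\<close>, as required for exposing
    the edges at \<open>v\<close> afterwards.\<close>
  define T where "T E = insert w (big (V - {v}) E K - L {e \<in> E. w \<notin> e})" for E
  have "rprob (rsub r V) p (\<lambda>E. deg (core V E) (Inl v) \<noteq> one_to_zero (big_hits V K v w E))
      \<le> rprob (rsub r V) p (\<lambda>E. \<not> sparse_near r V E K {v})
        + rprob (rsub r V) p (\<lambda>E. \<exists>e\<in>E. v \<in> e \<and> e \<inter> T {e \<in> E. v \<notin> e} \<noteq> {})"
  proof (rule rprob_subadd)
    fix E assume E: "E \<subseteq> rsub r V" and ne: "deg (core V E) (Inl v) \<noteq> one_to_zero (big_hits V K v w E)"
    show "\<not> sparse_near r V E K {v} \<or> (\<exists>e\<in>E. v \<in> e \<and> e \<inter> T {e \<in> E. v \<notin> e} \<noteq> {})"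
    proof (rule ccontr)
      assume "\<not> ?thesis"
      then have s: "sparse_near r V E K {v}" and nt: "\<And>e. e \<in> E \<Longrightarrow> v \<in> e \<Longrightarrow> e \<inter> T {e \<in> E. v \<notin> e} = {}" by auto
      define Ev where "Ev = {e \<in> E. v \<notin> e}"
      define E0 where "E0 = {e \<in> E. v \<notin> e \<and> w \<notin> e}"
      have E0: "{e \<in> Ev. w \<notin> e} = E0" by (auto simp: Ev_def E0_def)
      have nt': "w \<notin> e" "e \<inter> (big (V - {v}) Ev K - L E0) = {}" if "e \<in> E" "v \<in> e" for e
        using nt[OF that] unfolding T_def E0 Ev_def[symmetric] by auto
      have EvV: "Ev \<subseteq> rsub r (V - {v})" using E by (auto simp: Ev_def rsub_def)
      have "L E0 \<subseteq> big (V - {v, w}) E0 K" by (rule L(1))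
      moreover have sub: "big (V - {v, w}) E0 K \<subseteq> big (V - {v}) Ev K"
        using V EvV by (intro big_mono[where r = r]) (auto simp: E0_def Ev_def)
      ultimately have LB: "L E0 \<subseteq> big (V - {v}) Ev K" by simp
      have cE: "component E0 u \<subseteq> component Ev u" for u
        by (rule component_mono) (auto simp: E0_def Ev_def)
      have "deg (core V E) (Inl v) = one_to_zero (card {e \<in> E. v \<in> e \<and> e \<inter> big (V - {v}) Ev K \<noteq> {}})"
      proof (rule deg_core_var_eq[OF V(1) E _ s, of "L E0"])
        show "2 \<le> r" using r by simp
        show "L E0 \<subseteq> big (V - {v}) Ev K" by (rule LB)
        show "x \<in> component {e \<in> E. v \<notin> e} u" if "u \<in> L E0" "x \<in> L E0" for u x
          using L(2)[OF that] cE[of u] unfolding Ev_def by blast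
        show "big (V - {v}) {e \<in> E. v \<notin> e} K \<subseteq> big (V - {v}) Ev K" by (simp add: Ev_def)
        show "v \<notin> big (V - {v}) Ev K" by (simp add: big_def)
      qed (use nt' in auto)
      also have "{e \<in> E. v \<in> e \<and> e \<inter> big (V - {v}) Ev K \<noteq> {}}
          = {e \<in> E. v \<in> e \<and> w \<notin> e \<and> e \<inter> big (V - {v, w}) E0 K \<noteq> {}}"
        using nt' sub \<open>L E0 \<subseteq> big (V - {v, w}) E0 K\<close> by blast
      finally show False using ne by (simp add: big_hits_def E0_def)
    qed
  qed (use p in auto)
  also have "rprob (rsub r V) p (\<lambda>E. \<exists>e\<in>E. v \<in> e \<and> e \<inter> T {e \<in> E. v \<notin> e} \<noteq> {})
      \<le> rprob (rsub r (V - {v})) p (\<lambda>E. \<not> real (card (T E)) \<le> 3 * \<epsilon> * n) + p * (3 * \<epsilon> * n) * real (card V) ^ (r - 2)"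
  proof (rule rprob_expose_hits_le)
    show "T E \<subseteq> V - {v}" for E using V by (auto simp: T_def big_def)
    show "0 \<le> 3 * \<epsilon> * n" using \<epsilon>(1) by (simp add: n_def)
  qed (use V r p in auto)
  also have "p * (3 * \<epsilon> * n) * real (card V) ^ (r - 2) = 3 * \<epsilon> * (p * n ^ (r - 1))"
  proof -
    have "n ^ (r - 1) = n * n ^ (r - 2)" using r by (simp add: power_Suc[symmetric] Suc_diff_le[symmetric] numeral_2_eq_2 del: power_Suc)
    then show ?thesis by (simp add: n_def)
  qed
  also have "\<dots> \<le> 3 * \<epsilon> * c" using b \<epsilon>(1) by (intro mult_left_mono) (auto simp: n_def)
  also have "rprob (rsub r (V - {v})) p (\<lambda>E. \<not> real (card (T E)) \<le> 3 * \<epsilon> * n)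
      \<le> rprob (rsub r (V - {v})) p (\<lambda>E. \<not> giantlike r d \<epsilon> K (V - {v}) E)
        + rprob (rsub r (V - {v})) p (\<lambda>E. \<not> giantlike r d \<epsilon> K (V - {v, w}) (E \<inter> rsub r (V - {v, w})))"
  proof (rule rprob_subadd)
    fix E assume E: "E \<subseteq> rsub r (V - {v})" and le: "\<not> real (card (T E)) \<le> 3 * \<epsilon> * n"
    show "\<not> giantlike r d \<epsilon> K (V - {v}) E \<or> \<not> giantlike r d \<epsilon> K (V - {v, w}) (E \<inter> rsub r (V - {v, w}))"
    proof (rule ccontr)
      assume "\<not> ?thesis"
      then have 1: "giantlike r d \<epsilon> K (V - {v}) E" and 2: "giantlike r d \<epsilon> K (V - {v, w}) (E \<inter> rsub r (V - {v, w}))" by auto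
      define E0 where "E0 = {e \<in> E. w \<notin> e}"
      have E0: "E \<inter> rsub r (V - {v, w}) = E0" using E by (auto simp: E0_def rsub_def)
      let ?B = "big (V - {v}) E K"
      have "L E0 \<subseteq> big (V - {v, w}) E0 K" by (rule L(1))
      also have "\<dots> \<subseteq> ?B" using V E by (intro big_mono[where r = r]) (auto simp: E0_def)
      finally have LB: "L E0 \<subseteq> ?B" .
      have finB: "finite ?B" by (rule finite_subset[OF big_subset]) (simp add: V)
      have "card (T E) \<le> Suc (card (?B - L E0))" unfolding T_def E0_def[symmetric] using finB by (simp add: card_insert_if)
      also have "card (?B - L E0) = card ?B - card (L E0)" using LB finB by (intro card_Diff_subset) (auto intro: finite_subset)
      finally have "real (card (T E)) \<le> 1 + (real (card ?B) - real (card (L E0)))"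
        using card_mono[OF finB LB] by linarith
      moreover have "real (card ?B) \<le> (rho_star r d + \<epsilon>) * (n - 1)"
      proof -
        have "card {v} \<le> card V" using V by (intro card_mono) auto
        then have "real (card (V - {v})) = n - 1" using V by (simp add: n_def of_nat_diff)
        then show ?thesis using 1 by (simp add: giantlike_def)
      qed
      moreover have "(rho_star r d - \<epsilon>) * (n - 2) \<le> real (card (L E0))"
      proof -
        have "card {v, w} \<le> card V" using V by (intro card_mono) auto
        then have "real (card (V - {v, w})) = n - 2" using V by (simp add: card_Diff_subset n_def of_nat_diff)
        then show ?thesis using L(3)[of E0] 2 E0 by simp
      qed
      moreover have "1 + ((rho_star r d + \<epsilon>) * (n - 1) - (rho_star r d - \<epsilon>) * (n - 2)) = 1 + rho_star r d + 2 * \<epsilon> * n - 3 * \<epsilon>"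
        by (simp add: algebra_simps)
      moreover have "1 + rho_star r d + 2 * \<epsilon> * n - 3 * \<epsilon> \<le> 3 * \<epsilon> * n" using rho_star_greatest(3)[of r d] \<epsilon> by (simp add: n_def)
      ultimately show False using le by linarith
    qed
  qed (use p in auto)
  also have "rprob (rsub r (V - {v})) p (\<lambda>E. \<not> giantlike r d \<epsilon> K (V - {v, w}) (E \<inter> rsub r (V - {v, w})))
      = rprob (rsub r (V - {v, w})) p (\<lambda>E. \<not> giantlike r d \<epsilon> K (V - {v, w}) E)"
    using V by (intro rprob_restrict rsub_mono) auto
  finally show ?thesis using sp g1 g2 by (simp add: algebra_simps)
qed

lemma evt_deg_core_var_neq:
  assumes r: "r \<ge> 3" "d > 0" and \<epsilon>: "\<epsilon> > 0"
    and c: "evt r d (\<lambda>(V :: 'a set) p. admissible r c V p)"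
    and G: "whp r d (giantlike r d \<epsilon> K :: 'a set \<Rightarrow> _)"
  shows "evt r d (\<lambda>(V :: 'a set) p. \<forall>v\<in>V. \<forall>w\<in>V. v \<noteq> w \<longrightarrow>
    rprob (rsub r V) p (\<lambda>E. deg (core V E) (Inl v) \<noteq> one_to_zero (big_hits V K v w E)) \<le> (3 + 3 * c) * \<epsilon>)"
proof -
  have "evt r d (\<lambda>(V :: 'a set) p. \<forall>v\<in>V. rprob (rsub r V) p (\<lambda>E. \<not> sparse_near r V E K {v}) \<le> \<epsilon>)"
    using r \<epsilon> by (intro evt_sparse_near) auto
  note ev = evt_conj[OF this evt_conj[OF evt_card_real[of _ _ "(3 + 2 * \<epsilon>) / \<epsilon>"] evt_Diff[OF whpD[OF G \<epsilon>], of 2]]]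
  show ?thesis
  proof (rule evt_elim2[OF c ev], intro ballI impI)
    fix V :: "'a set" and p v w
    assume *: "admissible r c V p"
      and **: "(\<forall>v\<in>V. rprob (rsub r V) p (\<lambda>E. \<not> sparse_near r V E K {v}) \<le> \<epsilon>) \<and>
        (3 + 2 * \<epsilon>) / \<epsilon> \<le> real (card V) \<and>
        (\<forall>X\<subseteq>V. card X \<le> 2 \<longrightarrow> rprob (rsub r (V - X)) p (\<lambda>E. \<not> giantlike r d \<epsilon> K (V - X) E) \<le> \<epsilon>)"
      and vw: "v \<in> V" "w \<in> V" "v \<noteq> w"
    have X: "{v} \<subseteq> V \<and> card {v} \<le> 2" "{v, w} \<subseteq> V \<and> card {v, w} \<le> 2" using vw by auto
    have large: "3 + 2 * \<epsilon> \<le> \<epsilon> * real (card V)" using ** \<epsilon> by (simp add: field_simps)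
    have sp: "rprob (rsub r V) p (\<lambda>E. \<not> sparse_near r V E K {v}) \<le> \<epsilon>"
      using conjunct1[OF **] vw(1) by (rule bspec)
    note gl = conjunct2[OF conjunct2[OF **], rule_format]
    show "rprob (rsub r V) p (\<lambda>E. deg (core V E) (Inl v) \<noteq> one_to_zero (big_hits V K v w E)) \<le> (3 + 3 * c) * \<epsilon>"
      by (rule rprob_deg_core_var_neq[OF _ vw r(1) _ _ \<epsilon> large _ sp
            gl[OF conjunct1[OF X(1)] conjunct2[OF X(1)]] gl[OF conjunct1[OF X(2)] conjunct2[OF X(2)]]])
        (use * in simp_all)
  qed
qed

section \<open>The law of the number of hits\<close>

definition preim :: "nat \<Rightarrow> nat set" where
  "preim j = (if j = 0 then {0, 1} else if j = 1 then {} else {j})"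

lemma one_to_zero_eq_iff: "one_to_zero k = j \<longleftrightarrow> k \<in> preim j"
  by (auto simp: one_to_zero_def preim_def)

lemma finite_preim [simp]: "finite (preim j)"
  by (simp add: preim_def)

lemma pmf_one_to_zero_sum: "pmf (map_pmf one_to_zero D) j = (\<Sum>i\<in>preim j. pmf D i)"
proof -
  have "one_to_zero -` {j} = preim j" by (simp add: vimage_def one_to_zero_eq_iff)
  then show ?thesis by (simp add: pmf_map measure_measure_pmf_finite)
qed

text \<open>The mass at \<open>j\<close> of the binomial distribution with
  \<open>hits (r - 1) N b\<close> trials, its value 1 moved to 0.\<close>

definition hit_prob :: "nat \<Rightarrow> nat \<Rightarrow> nat \<Rightarrow> nat \<Rightarrow> real \<Rightarrow> real" where
  "hit_prob r j N b p = (\<Sum>i\<in>preim j. real (hits (r - 1) N b choose i) * p ^ i * (1 - p) ^ (hits (r - 1) N b - i))"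

lemma rprob_hits_star:
  assumes "finite V" "v \<in> V" "T \<subseteq> V - {v}" "r \<ge> 1" 
  shows "rprob (star r V v) p (\<lambda>F. one_to_zero (card {e \<in> F. e \<inter> T \<noteq> {}}) = j) = hit_prob r j (card V - 1) (card T) p"
proof -
  define H where "H = {e \<in> star r V v. e \<inter> T \<noteq> {}}"
  have H: "H \<subseteq> star r V v" by (auto simp: H_def)
  have "rprob (star r V v) p (\<lambda>F. one_to_zero (card {e \<in> F. e \<inter> T \<noteq> {}}) = j)
      = rprob (star r V v) p (\<lambda>F. card (F \<inter> H) \<in> preim j)"
  proof (rule rprob_cong)
    fix F assume "F \<subseteq> star r V v"
    then have "{e \<in> F. e \<inter> T \<noteq> {}} = F \<inter> H" by (auto simp: H_def)
    then show "(one_to_zero (card {e \<in> F. e \<inter> T \<noteq> {}}) = j) = (card (F \<inter> H) \<in> preim j)"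
      by (simp add: one_to_zero_eq_iff)
  qed
  also have "\<dots> = (\<Sum>i\<in>preim j. rprob (star r V v) p (\<lambda>F. card (F \<inter> H) = i))"
    unfolding rprob_def rmean_sum[symmetric] by (rule rmean_cong) (simp add: of_bool_def)
  also have "\<dots> = hit_prob r j (card V - 1) (card T) p"
    using rprob_card_Int[OF finite_star[OF assms(1)] H, of p] card_star_hits[OF assms]
    by (simp add: hit_prob_def H_def)
  finally show ?thesis .
qed

text \<open>The edges avoiding both vertices, those at \<open>v\<close> only and those at
  \<open>w\<close> only are independent families. Given the first, the other two yield independent
  hit counts of the same law, whence the square.\<close>

lemma rmean_big_hits_pair:
  assumes V: "finite V" "v \<in> V" "w \<in> V" "v \<noteq> w" and r: "r \<ge> 1"
  shows "rprob (rsub r V) p (\<lambda>E. one_to_zero (big_hits V K v w E) = j \<and> one_to_zero (big_hits V K w v E) = j)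
    = rmean (rsub r (V - {v, w})) p (\<lambda>E. (hit_prob r j (card V - 2) (card (big (V - {v, w}) E K)) p)\<^sup>2)" (is "?P = _")
    and "rprob (rsub r V) p (\<lambda>E. one_to_zero (big_hits V K v w E) = j)
    = rmean (rsub r (V - {v, w})) p (\<lambda>E. hit_prob r j (card V - 2) (card (big (V - {v, w}) E K)) p)" (is "?Q = _")
proof -
  let ?S0 = "rsub r (V - {v, w})" and ?Sv = "star r (V - {w}) v" and ?Sw = "star r (V - {v}) w"
  define f where "f x y F E = card {e \<in> F. e \<inter> big (V - {x, y}) E K \<noteq> {}}" for x y :: 'a and F E
  define q where "q E = hit_prob r j (card V - 2) (card (big (V - {v, w}) E K)) p" for E
  have wv: "{w, v} = {v, w}" by auto
  have sub: "?S0 \<union> (?Sv \<union> ?Sw) \<subseteq> rsub r V" by (auto simp: star_def rsub_def)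
  have fin: "finite ?S0" "finite ?Sv" "finite ?Sw" "finite (rsub r V)" using V by auto
  have dis: "?S0 \<inter> (?Sv \<union> ?Sw) = {}" "?Sv \<inter> ?Sw = {}" using V by (auto simp: star_def rsub_def)
  have eq: "big_hits V K v w (E \<union> (F \<union> G)) = f v w F E" "big_hits V K w v (E \<union> (F \<union> G)) = f v w G E"
    if "E \<subseteq> ?S0" "F \<subseteq> ?Sv" "G \<subseteq> ?Sw" for E F G
  proof -
    have nE: "v \<notin> e \<and> w \<notin> e" if "e \<in> E" for e using \<open>E \<subseteq> ?S0\<close> that by (auto simp: rsub_def)
    have nF: "v \<in> e \<and> w \<notin> e" if "e \<in> F" for e using \<open>F \<subseteq> ?Sv\<close> that by (auto simp: rsub_def star_def)
    have nG: "v \<notin> e \<and> w \<in> e" if "e \<in> G" for e using \<open>G \<subseteq> ?Sw\<close> that by (auto simp: rsub_def star_def)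
    have E0: "{e \<in> E \<union> (F \<union> G). v \<notin> e \<and> w \<notin> e} = E" "{e \<in> E \<union> (F \<union> G). w \<notin> e \<and> v \<notin> e} = E"
      using nE nF nG by blast+
    show "big_hits V K v w (E \<union> (F \<union> G)) = f v w F E" unfolding big_hits_def E0 f_def
      using nE nF nG by (intro arg_cong[where f = card]) blast
    show "big_hits V K w v (E \<union> (F \<union> G)) = f v w G E" unfolding big_hits_def E0 f_def wv
      using nE nF nG by (intro arg_cong[where f = card]) blast
  qed
  have loc: "big_hits V K v w (E \<inter> (?S0 \<union> (?Sv \<union> ?Sw))) = big_hits V K v w E"
    "big_hits V K w v (E \<inter> (?S0 \<union> (?Sv \<union> ?Sw))) = big_hits V K w v E" if "E \<subseteq> rsub r V" for E
  proof -
    have i: "e \<in> ?S0 \<union> (?Sv \<union> ?Sw)" if "e \<in> E" "\<not> (v \<in> e \<and> w \<in> e)" for e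
      using that \<open>E \<subseteq> rsub r V\<close> by (auto simp: star_def rsub_def)
    have E0: "{e \<in> E \<inter> (?S0 \<union> (?Sv \<union> ?Sw)). v \<notin> e \<and> w \<notin> e} = {e \<in> E. v \<notin> e \<and> w \<notin> e}"
      "{e \<in> E \<inter> (?S0 \<union> (?Sv \<union> ?Sw)). w \<notin> e \<and> v \<notin> e} = {e \<in> E. w \<notin> e \<and> v \<notin> e}"
      using i by blast+
    show "big_hits V K v w (E \<inter> (?S0 \<union> (?Sv \<union> ?Sw))) = big_hits V K v w E"
      unfolding big_hits_def E0 using i by (intro arg_cong[where f = card]) blast
    show "big_hits V K w v (E \<inter> (?S0 \<union> (?Sv \<union> ?Sw))) = big_hits V K w v E"
      unfolding big_hits_def E0 using i by (intro arg_cong[where f = card]) blast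
  qed
  have qv: "rprob ?Sv p (\<lambda>F. one_to_zero (f v w F E) = j) = q E" for E
  proof -
    \<comment> \<open>Edges at \<open>v\<close> without \<open>w\<close> choose their other vertices
      from \<open>card V - 2\<close> vertices.\<close>
    have "card (V - {w}) - 1 = card V - 2" using V by simp
    then show ?thesis using rprob_hits_star[of "V - {w}" v "big (V - {v, w}) E K" r p j] V r
      by (auto simp: f_def q_def big_def)
  qed
  have qw: "rprob ?Sw p (\<lambda>F. one_to_zero (f v w F E) = j) = q E" for E
  proof -
    have "card (V - {v}) - 1 = card V - 2" using V by simp
    then show ?thesis using rprob_hits_star[of "V - {v}" w "big (V - {v, w}) E K" r p j] V r
      by (auto simp: f_def q_def big_def)
  qed
  have split: "rprob (rsub r V) p (\<lambda>E. P (big_hits V K v w E) (big_hits V K w v E))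
      = rmean ?S0 p (\<lambda>E. rmean ?Sv p (\<lambda>F. rprob ?Sw p (\<lambda>G. P (f v w F E) (f v w G E))))" for P
  proof -
    have "rprob (rsub r V) p (\<lambda>E. P (big_hits V K v w E) (big_hits V K w v E))
        = rprob (rsub r V) p (\<lambda>E. P (big_hits V K v w (E \<inter> (?S0 \<union> (?Sv \<union> ?Sw)))) (big_hits V K w v (E \<inter> (?S0 \<union> (?Sv \<union> ?Sw)))))"
      by (rule rprob_cong) (simp only: loc)
    also have "\<dots> = rprob (?S0 \<union> (?Sv \<union> ?Sw)) p (\<lambda>E. P (big_hits V K v w E) (big_hits V K w v E))"
      by (rule rprob_restrict[OF fin(4) sub])
    also have "\<dots> = rmean ?S0 p (\<lambda>E. rmean ?Sv p (\<lambda>F. rmean ?Sw p (\<lambda>G.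
        of_bool (P (big_hits V K v w (E \<union> (F \<union> G))) (big_hits V K w v (E \<union> (F \<union> G)))))))"
      using fin dis unfolding rprob_def by (simp only: rmean_union finite_UnI)
    also have "\<dots> = rmean ?S0 p (\<lambda>E. rmean ?Sv p (\<lambda>F. rprob ?Sw p (\<lambda>G. P (f v w F E) (f v w G E))))"
      unfolding rprob_def by (intro rmean_cong) (simp only: eq)
    finally show ?thesis .
  qed
  have "?P = rmean ?S0 p (\<lambda>E. rmean ?Sv p (\<lambda>F. rprob ?Sw p (\<lambda>G. one_to_zero (f v w F E) = j \<and> one_to_zero (f v w G E) = j)))"
    by (rule split[of "\<lambda>x y. one_to_zero x = j \<and> one_to_zero y = j"])
  also have "\<dots> = rmean ?S0 p (\<lambda>E. rmean ?Sv p (\<lambda>F. q E * of_bool (one_to_zero (f v w F E) = j)))"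
  proof (intro rmean_cong)
    fix E F
    have "rprob ?Sw p (\<lambda>G. one_to_zero (f v w F E) = j \<and> one_to_zero (f v w G E) = j)
        = rmean ?Sw p (\<lambda>G. of_bool (one_to_zero (f v w F E) = j) * of_bool (one_to_zero (f v w G E) = j))"
      unfolding rprob_def by (rule rmean_cong) simp
    also have "\<dots> = of_bool (one_to_zero (f v w F E) = j) * rprob ?Sw p (\<lambda>G. one_to_zero (f v w G E) = j)"
      unfolding rprob_def by (rule rmean_cmult)
    finally show "rprob ?Sw p (\<lambda>G. one_to_zero (f v w F E) = j \<and> one_to_zero (f v w G E) = j)
        = q E * of_bool (one_to_zero (f v w F E) = j)" by (simp add: qw mult.commute)
  qed
  also have "\<dots> = rmean ?S0 p (\<lambda>E. (q E)\<^sup>2)"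
    unfolding rmean_cmult rprob_def[symmetric] qv power2_eq_square by simp
  finally show "?P = rmean ?S0 p (\<lambda>E. (hit_prob r j (card V - 2) (card (big (V - {v, w}) E K)) p)\<^sup>2)"
    by (simp add: q_def)
  have "?Q = rmean ?S0 p (\<lambda>E. rmean ?Sv p (\<lambda>F. rprob ?Sw p (\<lambda>G. one_to_zero (f v w F E) = j)))"
    by (rule split[of "\<lambda>x y. one_to_zero x = j"])
  also have "\<dots> = rmean ?S0 p (\<lambda>E. rprob ?Sv p (\<lambda>F. one_to_zero (f v w F E) = j))"
    using fin(3) unfolding rprob_def by (simp only: rmean_const)
  also have "\<dots> = rmean ?S0 p q" by (simp only: qv)
  finally show "?Q = rmean ?S0 p (\<lambda>E. hit_prob r j (card V - 2) (card (big (V - {v, w}) E K)) p)"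
    by (simp add: q_def[abs_def])
qed

text \<open>Here \<open>b\<close> stands for the size of a vertex set of asymptotic density \<open>t\<close>.\<close>

definition crit_density :: "nat \<Rightarrow> real \<Rightarrow> real \<Rightarrow> (('a set \<times> real) \<times> nat) filter" where
  "crit_density r d t = filtercomap (\<lambda>(x, b). (x, real b / real (card (fst x)))) (crit r d \<times>\<^sub>F nhds t)"

lemma filterlim_crit_density:
  "filterlim fst (crit r d) (crit_density r d t)"
  "((\<lambda>x. real (snd x) / real (card (fst (fst x)))) \<longlongrightarrow> t) (crit_density r d t)"
proof -
  have "filterlim (\<lambda>(x, b). (x, real b / real (card (fst x)))) (crit r d \<times>\<^sub>F nhds t) (crit_density r d t)"
    unfolding crit_density_def by (rule filterlim_filtercomap)
  from filterlim_compose[OF filterlim_fst this] filterlim_compose[OF filterlim_snd this]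
  show "filterlim fst (crit r d) (crit_density r d t)"
    "((\<lambda>x. real (snd x) / real (card (fst (fst x)))) \<longlongrightarrow> t) (crit_density r d t)"
    by (simp_all add: case_prod_unfold)
qed

text \<open>Extracts one tolerance that holds for all \<open>b\<close> simultaneously;
  \<open>b\<close> will be the random number of big vertices.\<close>

lemma evt_density:
  fixes f :: "'a set \<Rightarrow> real \<Rightarrow> nat \<Rightarrow> real"
  assumes "((\<lambda>x. f (fst (fst x)) (snd (fst x)) (snd x)) \<longlongrightarrow> l) (crit_density r d t)" "\<gamma> > 0"
  obtains \<epsilon> where "\<epsilon> > 0"
    "evt r d (\<lambda>V p. \<forall>b. \<bar>real b / real (card V) - t\<bar> < \<epsilon> \<longrightarrow> \<bar>f V p b - l\<bar> < \<gamma>)"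
proof -
  from tendstoD[OF assms] obtain Q where Q: "eventually Q (crit r d \<times>\<^sub>F nhds t)"
    "\<And>V p b. Q ((V, p), real b / real (card V)) \<Longrightarrow> \<bar>f V p b - l\<bar> < \<gamma>"
    unfolding crit_density_def eventually_filtercomap by (fastforce simp: dist_real_def)
  from Q(1) obtain A B where AB: "eventually A (crit r d)" "eventually B (nhds t)" "\<And>x y. A x \<Longrightarrow> B y \<Longrightarrow> Q (x, y)"
    unfolding eventually_prod_filter by auto
  from AB(2) obtain \<epsilon> where \<epsilon>: "\<epsilon> > 0" "\<And>y. \<bar>y - t\<bar> < \<epsilon> \<Longrightarrow> B y"
    unfolding eventually_nhds_metric dist_real_def by auto
  have "evt r d (\<lambda>V p. \<forall>b. \<bar>real b / real (card V) - t\<bar> < \<epsilon> \<longrightarrow> \<bar>f V p b - l\<bar> < \<gamma>)"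
    unfolding evt_def using AB(1)
    by (rule eventually_mono) (use \<epsilon>(2) AB(3) Q(2) in \<open>auto simp: case_prod_unfold\<close>)
  with \<epsilon>(1) show thesis by (rule that)
qed

lemma rho_star_less_1: "d > 0 \<Longrightarrow> rho_star r d < 1"
  using surv_bounds[of d "rho_star r d" r] surv_rho_star[of r d] rho_star_greatest(2,3)[of r d] by simp

lemma pmf_Po: "\<mu> \<ge> 0 \<Longrightarrow> pmf (Po \<mu>) i = \<mu> ^ i / fact i * exp (- \<mu>)"
  by (auto simp: Po_def indicator_def power_0_left)

lemma pmf_Po_tilde:
  "\<mu> \<ge> 0 \<Longrightarrow> pmf (Po_tilde \<mu>) j = (\<Sum>i\<in>preim j. \<mu> ^ i / fact i * exp (- \<mu>))"
  unfolding Po_tilde_def by (simp add: pmf_one_to_zero_sum pmf_Po)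

text \<open>Applied to \<open>V - {v, w}\<close>, with \<open>v\<close> outside the set: its edges
  choose \<open>r - 1\<close> vertices from all of the set, while \<open>crit\<close> normalises by
  one vertex less. The quotient \<open>r1\<close> shows that this does not change the limit.\<close>

lemma tendsto_hit_prob:
  assumes "r \<ge> 2" "d > 0"
  shows "((\<lambda>x. hit_prob r j (card (fst (fst x))) (snd x) (snd (fst x))) \<longlongrightarrow> pmf (Po_tilde (d * rho_hat_star r d)) j)
    (crit_density r d (rho_star r d) :: (('a set \<times> real) \<times> nat) filter)"
proof -
  let ?G = "crit_density r d (rho_star r d) :: (('a set \<times> real) \<times> nat) filter"
  define \<rho> where "\<rho> = rho_star r d"
  define n where "n x = card (fst (fst x))" for x :: "('a set \<times> real) \<times> nat"
  define p where "p x = snd (fst x)" for x :: "('a set \<times> real) \<times> nat"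
  have \<rho>: "0 \<le> \<rho>" "\<rho> < 1" using rho_star_greatest(2)[of r d] rho_star_less_1[OF assms(2), of r] by (auto simp: \<rho>_def)
  have n: "filterlim n at_top ?G"
    using filterlim_compose[OF filterlim_crit_card filterlim_crit_density(1)] unfolding n_def .
  have p: "(p \<longlongrightarrow> 0) ?G"
    using filterlim_compose[OF tendsto_snd_crit(1)[OF assms] filterlim_crit_density(1)] unfolding p_def .
  have p0: "\<forall>\<^sub>F x in ?G. 0 \<le> p x"
    using eventually_compose_filterlim[OF tendsto_snd_crit(2)[OF assms] filterlim_crit_density(1)] unfolding p_def .
  have pC: "((\<lambda>x. p x * real ((n x - 1) choose (r - 1))) \<longlongrightarrow> d) ?G"
    using filterlim_compose[OF tendsto_crit_p filterlim_crit_density(1)] unfolding p_def n_def .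
  have b: "((\<lambda>x. real (snd x) / real (n x)) \<longlongrightarrow> \<rho>) ?G"
    using filterlim_crit_density(2) unfolding n_def \<rho>_def .
  have nr: "filterlim (\<lambda>x. real (n x)) at_top ?G"
    using n by (rule filterlim_compose[OF filterlim_real_sequentially])
  have inv: "((\<lambda>x. 1 / real (n x)) \<longlongrightarrow> 0) ?G"
    by (rule real_tendsto_divide_at_top[OF tendsto_const nr])
  have n1: "\<forall>\<^sub>F x in ?G. 1 < n x" by (rule eventually_compose_filterlim[OF eventually_gt_at_top n])
  have bn: "\<forall>\<^sub>F x in ?G. real (snd x) / real (n x) < 1" using b \<rho>(2) by (rule order_tendstoD)
  have r1: "((\<lambda>x. real (n x) / real (n x - 1)) \<longlongrightarrow> 1) ?G"
  proof -
    have "((\<lambda>x. 1 / (1 - 1 / real (n x))) \<longlongrightarrow> 1 / (1 - 0)) ?G"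
      by (intro tendsto_intros inv) simp
    moreover have "\<forall>\<^sub>F x in ?G. 1 / (1 - 1 / real (n x)) = real (n x) / real (n x - 1)"
      using n1 by eventually_elim (simp add: field_simps of_nat_diff)
    ultimately show ?thesis by (auto elim: tendsto_cong[THEN iffD1, rotated])
  qed
  have r2: "((\<lambda>x. real (n x - snd x) / real (n x - 1)) \<longlongrightarrow> 1 - \<rho>) ?G"
  proof -
    have "((\<lambda>x. (1 - real (snd x) / real (n x)) / (1 - 1 / real (n x))) \<longlongrightarrow> (1 - \<rho>) / (1 - 0)) ?G"
      by (intro tendsto_intros inv b) simp
    moreover have "\<forall>\<^sub>F x in ?G. (1 - real (snd x) / real (n x)) / (1 - 1 / real (n x)) = real (n x - snd x) / real (n x - 1)"
      using n1 bn
    proof eventually_elim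
      case (elim x)
      then have "snd x < n x" by (simp add: field_simps)
      then show ?case using elim by (simp add: field_simps of_nat_diff)
    qed
    ultimately show ?thesis by (auto elim: tendsto_cong[THEN iffD1, rotated])
  qed
  have "((\<lambda>x. p x * real ((n x) choose (r - 1)) - p x * real ((n x - snd x) choose (r - 1)))
      \<longlongrightarrow> d * 1 ^ (r - 1) - d * (1 - \<rho>) ^ (r - 1)) ?G"
    by (intro tendsto_diff tendsto_mult_choose[OF filterlim_minus_const_nat[OF n] pC] r1 r2)
  moreover have "p x * real ((n x) choose (r - 1)) - p x * real ((n x - snd x) choose (r - 1))
      = p x * real (hits (r - 1) (n x) (snd x))" for x
    unfolding hits_def by (subst of_nat_diff) (auto simp: algebra_simps intro: binomial_right_mono)
  ultimately have h: "((\<lambda>x. p x * real (hits (r - 1) (n x) (snd x))) \<longlongrightarrow> d * rho_hat_star r d) ?G"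
    by (simp add: rho_hat_star_def \<rho>_def algebra_simps)
  have nonneg: "d * rho_hat_star r d \<ge> 0"
    using \<rho> assms by (auto simp: rho_hat_star_def \<rho>_def power_le_one)
  have "((\<lambda>x. hit_prob r j (n x) (snd x) (p x)) \<longlongrightarrow> pmf (Po_tilde (d * rho_hat_star r d)) j) ?G"
    unfolding hit_prob_def pmf_Po_tilde[OF nonneg]
    by (intro tendsto_sum tendsto_binomial_poisson[OF p p0 h])
  then show ?thesis by (simp add: n_def p_def)
qed

lemma hit_prob_bounds:
  assumes "0 \<le> p" "p \<le> 1"
  shows "0 \<le> hit_prob r j N b p" "hit_prob r j N b p \<le> 1"
proof -
  \<comment> \<open>A ground set of \<open>hits (r - 1) N b\<close> elements realises the value as a
    probability.\<close>
  let ?S = "{..<hits (r - 1) N b}"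
  have "rprob ?S p (\<lambda>E. card (E \<inter> ?S) \<in> preim j) = (\<Sum>i\<in>preim j. rprob ?S p (\<lambda>E. card (E \<inter> ?S) = i))"
    unfolding rprob_def rmean_sum[symmetric] by (rule rmean_cong) (simp add: of_bool_def)
  also have "\<dots> = hit_prob r j N b p"
    unfolding hit_prob_def by (rule sum.cong[OF refl]) (subst rprob_card_Int, auto)
  finally show "0 \<le> hit_prob r j N b p" "hit_prob r j N b p \<le> 1"
    using rprob_nonneg[OF assms, of ?S] rprob_le_1[OF _ assms, of ?S] by (metis finite_lessThan)+
qed

lemma rmean_approx:
  assumes "finite S" "0 \<le> p" "p \<le> 1" "0 \<le> \<gamma>"
    and "\<And>E. E \<subseteq> S \<Longrightarrow> \<bar>g E - c\<bar> \<le> 1" "\<And>E. E \<subseteq> S \<Longrightarrow> Q E \<Longrightarrow> \<bar>g E - c\<bar> \<le> \<gamma>"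
  shows "\<bar>rmean S p g - c\<bar> \<le> rprob S p (\<lambda>E. \<not> Q E) + \<gamma>"
proof -
  have "rmean S p (\<lambda>E. \<bar>g E - c\<bar>) \<le> rprob S p (\<lambda>E. \<not> Q E) + \<gamma>"
    using assms by (intro rmean_le_split) auto
  moreover have "rmean S p (\<lambda>E. g E - c) \<le> rmean S p (\<lambda>E. \<bar>g E - c\<bar>)"
    using assms(2,3) by (intro rmean_mono) auto
  moreover have "rmean S p (\<lambda>E. c - g E) \<le> rmean S p (\<lambda>E. \<bar>g E - c\<bar>)"
    using assms(2,3) by (intro rmean_mono) auto
  ultimately show ?thesis using assms(1) by (simp add: rmean_diff abs_le_iff)
qed

text \<open>The square is expanded about the constant \<open>\<pi>\<close> instead of the mean.
  Diagonal terms are at most 1, all others at most \<open>\<kappa>\<close>; the single probabilities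
  enter negatively, so lower bounds on them suffice.\<close>

lemma rmean_second_moment_le:
  assumes "finite S" "finite A" "0 \<le> p" "p \<le> 1" "0 \<le> \<pi>" "\<pi> \<le> 1" "0 \<le> \<kappa>"
    and pair: "\<And>x y. x \<in> A \<Longrightarrow> y \<in> A \<Longrightarrow> x \<noteq> y \<Longrightarrow>
      rprob S p (\<lambda>E. Q x E \<and> Q y E) - \<pi> * rprob S p (Q x) - \<pi> * rprob S p (Q y) + \<pi>\<^sup>2 \<le> \<kappa>"
  shows "rmean S p (\<lambda>E. (real (card {x \<in> A. Q x E}) - \<pi> * real (card A))\<^sup>2) \<le> real (card A) + \<kappa> * (real (card A))\<^sup>2"
proof -
  define h where "h x E = of_bool (Q x E) - \<pi>" for x E
  have "real (card {x \<in> A. Q x E}) - \<pi> * real (card A) = (\<Sum>x\<in>A. h x E)" for E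
    using assms(2) by (simp add: h_def sum_subtractf of_bool_def sum.If_cases Int_def mult.commute)
  then have "rmean S p (\<lambda>E. (real (card {x \<in> A. Q x E}) - \<pi> * real (card A))\<^sup>2)
      = rmean S p (\<lambda>E. \<Sum>x\<in>A. \<Sum>y\<in>A. h x E * h y E)"
    by (simp add: power2_eq_square sum_product)
  also have "\<dots> = (\<Sum>x\<in>A. \<Sum>y\<in>A. rmean S p (\<lambda>E. h x E * h y E))"
    by (simp only: rmean_sum)
  also have "\<dots> \<le> (\<Sum>x\<in>A. \<Sum>y\<in>A. (if x = y then 1 else 0) + \<kappa>)"
  proof (intro sum_mono)
    fix x y assume xy: "x \<in> A" "y \<in> A"
    show "rmean S p (\<lambda>E. h x E * h y E) \<le> (if x = y then 1 else 0) + \<kappa>"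
    proof (cases "x = y")
      case True
      have "h x E * h x E \<le> 1" for E
      proof -
        have "\<bar>h x E\<bar> \<le> 1" using assms(5,6) by (auto simp: h_def)
        then show ?thesis using abs_square_le_1[of "h x E"] by (simp add: power2_eq_square)
      qed
      then have "rmean S p (\<lambda>E. h x E * h x E) \<le> 1" using assms by (intro rmean_le_const) auto
      then show ?thesis using True assms(7) by simp
    next
      case False
      have "h x E * h y E = of_bool (Q x E \<and> Q y E) - (\<pi> * of_bool (Q x E) + (\<pi> * of_bool (Q y E) - \<pi>\<^sup>2))" for E
        by (simp add: h_def algebra_simps power2_eq_square)
      then have "rmean S p (\<lambda>E. h x E * h y E)
          = rprob S p (\<lambda>E. Q x E \<and> Q y E) - (\<pi> * rprob S p (Q x) + (\<pi> * rprob S p (Q y) - \<pi>\<^sup>2))"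
        using assms(1) by (simp add: rmean_diff rmean_add rmean_cmult rprob_def del: of_bool_conj)
      then show ?thesis using pair[OF xy False] False by simp
    qed
  qed
  also have "\<dots> = real (card A) + \<kappa> * (real (card A))\<^sup>2"
    using assms(2) by (simp add: sum.distrib power2_eq_square mult.commute mult.left_commute distrib_left)
  finally show ?thesis .
qed

lemma whp_variable:
  assumes "r \<ge> 3" "d > 0" "\<tau> > 0"
  shows "whp r d (\<lambda>(V :: 'a set) E. \<bar>real (card {v \<in> V. deg (core V E) (Inl v) = j}) / real (card V)
    - pmf (Po_tilde (d * rho_hat_star r d)) j\<bar> \<le> \<tau>)"
  unfolding whp_def
proof (intro allI impI)
  fix \<eta> :: real assume \<eta>: "\<eta> > 0"
  define \<pi> where "\<pi> = pmf (Po_tilde (d * rho_hat_star r d)) j"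
  have \<pi>: "0 \<le> \<pi>" "\<pi> \<le> 1" by (auto simp: \<pi>_def pmf_le_1)
  define \<rho> where "\<rho> = rho_star r d"
  \<comment> \<open>The second moment will be at most \<open>12 * \<gamma> * n\<^sup>2\<close>: 11
    from the pairs and 1 from the diagonal.\<close>
  define \<gamma> where "\<gamma> = \<tau>\<^sup>2 * \<eta> / 14"
  have \<gamma>: "\<gamma> > 0" using assms \<eta> by (simp add: \<gamma>_def)
  have r2: "r \<ge> 2" using assms by simp
  obtain c where c: "c > 0" "evt r d (\<lambda>(V :: 'a set) p. admissible r c V p)"
    by (rule evt_bound[OF r2 assms(2)])
  obtain \<epsilon>1 where \<epsilon>1: "\<epsilon>1 > 0" "evt r d (\<lambda>(V :: 'a set) p. \<forall>b. \<bar>real b / real (card V) - \<rho>\<bar> < \<epsilon>1 \<longrightarrow>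
      \<bar>hit_prob r j (card V) b p - \<pi>\<bar> < \<gamma>)"
    unfolding \<pi>_def \<rho>_def by (rule evt_density[OF tendsto_hit_prob[OF r2 assms(2), of j] \<gamma>])
  define \<epsilon> where "\<epsilon> = min (\<epsilon>1 / 2) (\<gamma> / (3 + 3 * c))"
  have \<epsilon>: "\<epsilon> > 0" "\<epsilon> < \<epsilon>1" "(3 + 3 * c) * \<epsilon> \<le> \<gamma>"
  proof -
    show "\<epsilon> > 0" "\<epsilon> < \<epsilon>1" using \<epsilon>1(1) \<gamma> c(1) by (auto simp: \<epsilon>_def)
    have "(3 + 3 * c) * \<epsilon> \<le> (3 + 3 * c) * (\<gamma> / (3 + 3 * c))" using c(1) by (intro mult_left_mono) (auto simp: \<epsilon>_def)
    also have "\<dots> = \<gamma>" using c(1) by simp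
    finally show "(3 + 3 * c) * \<epsilon> \<le> \<gamma>" .
  qed
  obtain K where K: "whp r d (giantlike r d \<epsilon> K :: 'a set \<Rightarrow> _)"
    using whp_giantlike[OF assms(1,2) \<epsilon>(1)] by blast
  have neq: "evt r d (\<lambda>(V :: 'a set) p. \<forall>v\<in>V. \<forall>w\<in>V. v \<noteq> w \<longrightarrow>
    rprob (rsub r V) p (\<lambda>E. deg (core V E) (Inl v) \<noteq> one_to_zero (big_hits V K v w E)) \<le> \<gamma>)"
    by (rule evt_mono[OF evt_deg_core_var_neq[OF assms(1,2) \<epsilon>(1) c(2) K]]) (use \<epsilon>(3) in fastforce)
  note D = evt_Diff[OF evt_conj[OF whpD[OF K \<gamma>] evt_conj[OF \<epsilon>1(2) evt_card[of _ _ 1]]], of 2]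
  show "evt r d (\<lambda>(V :: 'a set) p. rprob (rsub r V) p (\<lambda>E. \<not> \<bar>real (card {v \<in> V. deg (core V E) (Inl v) = j}) / real (card V)
    - pmf (Po_tilde (d * rho_hat_star r d)) j\<bar> \<le> \<tau>) \<le> \<eta>)"
  proof (rule evt_elim4[OF c(2) neq D evt_card_real[of _ _ "1 + 1 / \<gamma>"]])
    fix V :: "'a set" and p
    assume *: "admissible r c V p"
      and neq: "\<forall>v\<in>V. \<forall>w\<in>V. v \<noteq> w \<longrightarrow>
        rprob (rsub r V) p (\<lambda>E. deg (core V E) (Inl v) \<noteq> one_to_zero (big_hits V K v w E)) \<le> \<gamma>"
      and D: "\<forall>X\<subseteq>V. card X \<le> 2 \<longrightarrow> rprob (rsub r (V - X)) p (\<lambda>E. \<not> giantlike r d \<epsilon> K (V - X) E) \<le> \<gamma> \<and>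
        (\<forall>b. \<bar>real b / real (card (V - X)) - \<rho>\<bar> < \<epsilon>1 \<longrightarrow> \<bar>hit_prob r j (card (V - X)) b p - \<pi>\<bar> < \<gamma>) \<and> 1 \<le> card (V - X)"
      and large: "1 + 1 / \<gamma> \<le> real (card V)"
    define n where "n = real (card V)"
    have "0 < 1 / \<gamma>" using \<gamma> by simp
    then have n: "n > 0" "1 / \<gamma> \<le> n" using large unfolding n_def by linarith+
    let ?S = "rsub r V"
    define Q where "Q v E \<longleftrightarrow> deg (core V E) (Inl v) = j" for v E
    have approx: "\<bar>rprob ?S p (\<lambda>E. one_to_zero (big_hits V K v w E) = j) - \<pi>\<bar> \<le> 2 * \<gamma>"
      "\<bar>rprob ?S p (\<lambda>E. one_to_zero (big_hits V K v w E) = j \<and> one_to_zero (big_hits V K w v E) = j) - \<pi>\<^sup>2\<bar> \<le> 3 * \<gamma>"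
      if vw: "v \<in> V" "w \<in> V" "v \<noteq> w" for v w
    proof -
      define V0 where "V0 = V - {v, w}"
      have cV0: "card V0 = card V - 2" using vw * by (simp add: V0_def card_Diff_subset)
      have X: "{v, w} \<subseteq> V" "card {v, w} \<le> 2" using vw by auto
      have g: "rprob (rsub r V0) p (\<lambda>E. \<not> giantlike r d \<epsilon> K V0 E) \<le> \<gamma>"
        and dn: "\<And>b. \<bar>real b / real (card V0) - \<rho>\<bar> < \<epsilon>1 \<Longrightarrow> \<bar>hit_prob r j (card V0) b p - \<pi>\<bar> < \<gamma>"
        and V0: "1 \<le> card V0" using D X unfolding V0_def by blast+
      have finV0: "finite V0" using * by (simp add: V0_def)
      define q where "q E = hit_prob r j (card V - 2) (card (big V0 E K)) p" for E
      have q: "0 \<le> q E" "q E \<le> 1" for E using hit_prob_bounds[of p] * by (auto simp: q_def)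
      have close: "\<bar>q E - \<pi>\<bar> \<le> \<gamma>" if gl: "giantlike r d \<epsilon> K V0 E" for E
      proof -
        have up: "real (card (big V0 E K)) \<le> (\<rho> + \<epsilon>) * real (card V0)" using gl by (simp add: giantlike_def \<rho>_def)
        obtain L where L: "L \<subseteq> big V0 E K" "(\<rho> - \<epsilon>) * real (card V0) \<le> real (card L)"
          using gl unfolding giantlike_def \<rho>_def by blast
        have "card L \<le> card (big V0 E K)" using L(1) by (intro card_mono finite_subset[OF big_subset finV0])
        then have "(\<rho> - \<epsilon>) * real (card V0) \<le> real (card (big V0 E K))" using L(2) by linarith
        then have "\<bar>real (card (big V0 E K)) / real (card V0) - \<rho>\<bar> \<le> \<epsilon>"
          using up V0 by (simp add: abs_le_iff field_simps)
        then have "\<bar>real (card (big V0 E K)) / real (card V0) - \<rho>\<bar> < \<epsilon>1" using \<epsilon>(2) by linarith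
        from dn[OF this] show ?thesis unfolding q_def cV0 by linarith
      qed
      have "\<bar>rmean (rsub r V0) p q - \<pi>\<bar> \<le> rprob (rsub r V0) p (\<lambda>E. \<not> giantlike r d \<epsilon> K V0 E) + \<gamma>"
      proof (rule rmean_approx)
        show "\<bar>q E - \<pi>\<bar> \<le> 1" for E using q[of E] \<pi> by (simp add: abs_le_iff)
      qed (use * finV0 \<gamma> close in auto)
      then show "\<bar>rprob ?S p (\<lambda>E. one_to_zero (big_hits V K v w E) = j) - \<pi>\<bar> \<le> 2 * \<gamma>"
        using rmean_big_hits_pair(2)[of V v w r p K j] * vw assms(1) g unfolding q_def V0_def by simp
      have "\<bar>rmean (rsub r V0) p (\<lambda>E. (q E)\<^sup>2) - \<pi>\<^sup>2\<bar> \<le> rprob (rsub r V0) p (\<lambda>E. \<not> giantlike r d \<epsilon> K V0 E) + 2 * \<gamma>"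
      proof (rule rmean_approx)
        fix E
        have "(q E)\<^sup>2 \<le> 1" "\<pi>\<^sup>2 \<le> 1" "0 \<le> (q E)\<^sup>2" "0 \<le> \<pi>\<^sup>2" using q[of E] \<pi> by (auto simp: power_le_one)
        then show "\<bar>(q E)\<^sup>2 - \<pi>\<^sup>2\<bar> \<le> 1" by linarith
        assume "giantlike r d \<epsilon> K V0 E"
        then have "\<bar>q E - \<pi>\<bar> * \<bar>q E + \<pi>\<bar> \<le> \<gamma> * 2" using close[of E] q[of E] \<pi> \<gamma> by (intro mult_mono) auto
        moreover have "(q E)\<^sup>2 - \<pi>\<^sup>2 = (q E - \<pi>) * (q E + \<pi>)" by (simp add: algebra_simps power2_eq_square)
        ultimately show "\<bar>(q E)\<^sup>2 - \<pi>\<^sup>2\<bar> \<le> 2 * \<gamma>" by (simp add: abs_mult)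
      qed (use * finV0 \<gamma> in auto)
      then show "\<bar>rprob ?S p (\<lambda>E. one_to_zero (big_hits V K v w E) = j \<and> one_to_zero (big_hits V K w v E) = j) - \<pi>\<^sup>2\<bar> \<le> 3 * \<gamma>"
        using rmean_big_hits_pair(1)[of V v w r p K j] * vw assms(1) g unfolding q_def V0_def by simp
    qed
    have low: "\<pi> - 3 * \<gamma> \<le> rprob ?S p (Q v)" if vw: "v \<in> V" "w \<in> V" "v \<noteq> w" for v w
    proof -
      have "rprob ?S p (\<lambda>E. one_to_zero (big_hits V K v w E) = j)
          \<le> rprob ?S p (Q v) + rprob ?S p (\<lambda>E. deg (core V E) (Inl v) \<noteq> one_to_zero (big_hits V K v w E))"
        by (rule rprob_subadd) (use * in \<open>auto simp: Q_def\<close>)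
      then show ?thesis using approx(1)[OF vw] neq vw by fastforce
    qed
    \<comment> \<open>The pair probability contributes \<open>3 * \<gamma>\<close> and two exchanges
      of core degree and hit count, the single ones \<open>3 * \<gamma>\<close> each.\<close>
    have pair: "rprob ?S p (\<lambda>E. Q v E \<and> Q w E) - \<pi> * rprob ?S p (Q v) - \<pi> * rprob ?S p (Q w) + \<pi>\<^sup>2 \<le> 11 * \<gamma>"
      if vw: "v \<in> V" "w \<in> V" "v \<noteq> w" for v w
    proof -
      have "rprob ?S p (\<lambda>E. Q v E \<and> Q w E)
          \<le> rprob ?S p (\<lambda>E. one_to_zero (big_hits V K v w E) = j \<and> one_to_zero (big_hits V K w v E) = j)
            + rprob ?S p (\<lambda>E. deg (core V E) (Inl v) \<noteq> one_to_zero (big_hits V K v w E)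
                \<or> deg (core V E) (Inl w) \<noteq> one_to_zero (big_hits V K w v E))"
        by (rule rprob_subadd) (use * in \<open>auto simp: Q_def\<close>)
      also have "rprob ?S p (\<lambda>E. deg (core V E) (Inl v) \<noteq> one_to_zero (big_hits V K v w E)
                \<or> deg (core V E) (Inl w) \<noteq> one_to_zero (big_hits V K w v E))
          \<le> rprob ?S p (\<lambda>E. deg (core V E) (Inl v) \<noteq> one_to_zero (big_hits V K v w E))
            + rprob ?S p (\<lambda>E. deg (core V E) (Inl w) \<noteq> one_to_zero (big_hits V K w v E))"
        by (rule rprob_subadd) (use * in auto)
      also have "\<dots> \<le> \<gamma> + \<gamma>" using neq vw by (intro add_mono) auto
      also have "rprob ?S p (\<lambda>E. one_to_zero (big_hits V K v w E) = j \<and> one_to_zero (big_hits V K w v E) = j) \<le> \<pi>\<^sup>2 + 3 * \<gamma>"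
        using approx(2)[OF vw] by (simp add: abs_le_iff)
      finally have 1: "rprob ?S p (\<lambda>E. Q v E \<and> Q w E) \<le> \<pi>\<^sup>2 + 5 * \<gamma>" by simp
      have 2: "\<pi> * rprob ?S p (Q x) \<ge> \<pi>\<^sup>2 - 3 * \<gamma>" if "\<pi> - 3 * \<gamma> \<le> rprob ?S p (Q x)" for x
      proof -
        have "\<pi> * (\<pi> - 3 * \<gamma>) \<le> \<pi> * rprob ?S p (Q x)" using that \<pi> by (intro mult_left_mono)
        moreover have "\<pi> * (3 * \<gamma>) \<le> 1 * (3 * \<gamma>)" using \<pi> \<gamma> by (intro mult_right_mono) auto
        ultimately show ?thesis by (simp add: algebra_simps power2_eq_square)
      qed
      show ?thesis using 1 2[OF low[OF vw]] 2[OF low[OF vw(2,1) vw(3)[symmetric]]] by linarith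
    qed
    have "rmean ?S p (\<lambda>E. (real (card {v \<in> V. Q v E}) - \<pi> * n)\<^sup>2) \<le> n + 11 * \<gamma> * n\<^sup>2"
      unfolding n_def by (rule rmean_second_moment_le) (use * \<pi> \<gamma> pair in auto)
    moreover have "n \<le> \<gamma> * n\<^sup>2" using n \<gamma> by (simp add: field_simps power2_eq_square)
    ultimately have sm: "rmean ?S p (\<lambda>E. (real (card {v \<in> V. Q v E}) - \<pi> * n)\<^sup>2) \<le> 12 * \<gamma> * n\<^sup>2" by linarith
    have "rprob ?S p (\<lambda>E. \<not> \<bar>real (card {v \<in> V. Q v E}) / n - \<pi>\<bar> \<le> \<tau>)
        \<le> rprob ?S p (\<lambda>E. \<tau> * n \<le> \<bar>real (card {v \<in> V. Q v E}) - \<pi> * n\<bar>)"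
    proof (rule rprob_mono)
      fix E assume "\<not> \<bar>real (card {v \<in> V. Q v E}) / n - \<pi>\<bar> \<le> \<tau>"
      then have "\<tau> * n \<le> \<bar>real (card {v \<in> V. Q v E}) / n - \<pi>\<bar> * n" using n by (intro mult_right_mono) auto
      also have "\<dots> = \<bar>(real (card {v \<in> V. Q v E}) / n - \<pi>) * n\<bar>" using n by (simp add: abs_mult)
      also have "(real (card {v \<in> V. Q v E}) / n - \<pi>) * n = real (card {v \<in> V. Q v E}) - \<pi> * n"
        using n by (simp add: field_simps)
      finally show "\<tau> * n \<le> \<bar>real (card {v \<in> V. Q v E}) - \<pi> * n\<bar>" .
    qed (use * in auto)
    also have "\<dots> \<le> 12 * \<gamma> * n\<^sup>2 / (\<tau> * n)\<^sup>2" using * n assms sm by (intro rchebyshev) auto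
    also have "\<dots> = 12 / 14 * \<eta>" using n assms by (simp add: \<gamma>_def power_mult_distrib)
    also have "\<dots> \<le> \<eta>" using \<eta> by simp
    finally show "rprob ?S p (\<lambda>E. \<not> \<bar>real (card {v \<in> V. deg (core V E) (Inl v) = j}) / real (card V)
      - pmf (Po_tilde (d * rho_hat_star r d)) j\<bar> \<le> \<tau>) \<le> \<eta>"
      by (simp add: Q_def n_def \<pi>_def)
  qed
qed

section \<open>Degrees of factor nodes\<close>

lemma rmean_abs_le:
  assumes "finite S" "0 \<le> p" "p \<le> 1" "\<And>E. E \<subseteq> S \<Longrightarrow> \<bar>h E\<bar> \<le> c"
  shows "\<bar>rmean S p h\<bar> \<le> c"
  using rmean_le_const[OF assms(1-3), of h c] rmean_ge_const[OF assms(1-3), of "- c" h] assms(4)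
  by (simp add: abs_le_iff minus_le_iff)

text \<open>Conditioning on the absence of \<open>a\<close>, an event of probability at least 1/2,
  at most doubles a nonnegative mean.\<close>

lemma rmean_remove_le:
  assumes "finite S" "a \<in> S" "0 \<le> p" "p \<le> 1 / 2" "\<And>E. E \<subseteq> S \<Longrightarrow> 0 \<le> h E"
  shows "rmean (S - {a}) p h \<le> 2 * rmean S p h"
proof -
  have "rmean S p h = p * rmean (S - {a}) p (\<lambda>E. h (insert a E)) + (1 - p) * rmean (S - {a}) p h"
    using rmean_insert[of "S - {a}" a p h] assms(1,2) by (simp add: insert_absorb)
  moreover have "0 \<le> rmean (S - {a}) p (\<lambda>E. h (insert a E))" "0 \<le> rmean (S - {a}) p h"
    using assms(2-4) by (auto intro!: rmean_nonneg assms(5))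
  moreover have "(1 / 2) * rmean (S - {a}) p h \<le> (1 - p) * rmean (S - {a}) p h"
    using assms(4) \<open>0 \<le> rmean (S - {a}) p h\<close> by (intro mult_right_mono) auto
  moreover have "0 \<le> p * rmean (S - {a}) p (\<lambda>E. h (insert a E))"
    using assms(3) \<open>0 \<le> rmean (S - {a}) p (\<lambda>E. h (insert a E))\<close> by simp
  ultimately show ?thesis by linarith
qed

text \<open>The additive counterpart for signed functions, where a factor 2 would destroy
  cancellation.\<close>

lemma rmean_remove_diff:
  assumes "finite S" "a \<in> S" "0 \<le> p" "p \<le> 1" "\<And>E. E \<subseteq> S \<Longrightarrow> \<bar>h E\<bar> \<le> 1"
  shows "rmean (S - {a}) p h \<le> rmean S p h + 2 * p"
proof -
  have eq: "rmean S p h = p * rmean (S - {a}) p (\<lambda>E. h (insert a E)) + (1 - p) * rmean (S - {a}) p h"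
    using rmean_insert[of "S - {a}" a p h] assms(1,2) by (simp add: insert_absorb)
  have "\<bar>rmean (S - {a}) p (\<lambda>E. h (insert a E))\<bar> \<le> 1" "\<bar>rmean (S - {a}) p h\<bar> \<le> 1"
    using assms(1-4) by (auto intro!: rmean_abs_le assms(5))
  then have "p * (rmean (S - {a}) p h - rmean (S - {a}) p (\<lambda>E. h (insert a E))) \<le> p * 2"
    using assms(3) by (intro mult_left_mono) auto
  then show ?thesis unfolding eq by (simp add: algebra_simps)
qed

text \<open>In the second moment, two distinct edges \<open>a\<close> and \<open>b\<close> contribute \<open>p\<^sup>2\<close> times a mean over the
  other edges, which hardly changes when \<open>a\<close> and \<open>b\<close> are made random again.\<close>

lemma rmean_sum_edges_sq_le:
  assumes S: "finite S" and p: "0 \<le> p" "p \<le> 1 / 2"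
    and g: "\<And>a E. \<bar>g a E\<bar> \<le> 1"
    and D: "\<And>b E. E \<subseteq> S \<Longrightarrow> b \<in> S \<Longrightarrow> (\<Sum>a\<in>S. \<bar>g a (insert b E) - g a E\<bar>) \<le> D"
  shows "rmean S p (\<lambda>E. (\<Sum>a\<in>E. g a (E - {a}))\<^sup>2)
    \<le> p * real (card S) + 8 * p\<^sup>2 * real (card S) * D + 4 * p ^ 3 * (real (card S))\<^sup>2
      + p\<^sup>2 * rmean S p (\<lambda>E. (\<Sum>a\<in>S. g a E)\<^sup>2)"
proof -
  have p1: "p \<le> 1" using p by simp
  have gg: "\<bar>g a E * g b F\<bar> \<le> 1" for a b E F
    using mult_mono[OF g[of a E] g[of b F]] by (simp add: abs_mult)
  define \<delta> where "\<delta> a b E = \<bar>g a (insert b E) - g a E\<bar>" for a b E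
  \<comment> \<open>The two summands as functions of the hypergraph that lacks both edges: each of
    them sees the other edge.\<close>
  define h where "h a b E = g a (insert b E) * g b (insert a E)" for a b E
  have sq: "(\<Sum>a\<in>E. g a (E - {a}))\<^sup>2 \<le> real (card E) + (\<Sum>a\<in>E. \<Sum>b\<in>E - {a}. h a b (E - {a} - {b}))"
    if "E \<subseteq> S" for E
  proof -
    have fE: "finite E" using that S by (rule finite_subset)
    have "(\<Sum>a\<in>E. g a (E - {a}))\<^sup>2 = (\<Sum>a\<in>E. \<Sum>b\<in>E. g a (E - {a}) * g b (E - {b}))"
      by (simp add: power2_eq_square sum_product)
    also have "\<dots> = (\<Sum>a\<in>E. g a (E - {a}) * g a (E - {a}) + (\<Sum>b\<in>E - {a}. g a (E - {a}) * g b (E - {b})))"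
      using fE by (intro sum.cong[OF refl] sum.remove) auto
    also have "\<dots> \<le> (\<Sum>a\<in>E. 1 + (\<Sum>b\<in>E - {a}. h a b (E - {a} - {b})))"
    proof (rule sum_mono, rule add_mono)
      fix a assume a: "a \<in> E"
      show "g a (E - {a}) * g a (E - {a}) \<le> 1" using gg[of a "E - {a}" a "E - {a}"] by simp
      have "(\<Sum>b\<in>E - {a}. g a (E - {a}) * g b (E - {b})) = (\<Sum>b\<in>E - {a}. h a b (E - {a} - {b}))"
      proof (rule sum.cong[OF refl])
        fix b assume b: "b \<in> E - {a}"
        have "insert b (E - {a} - {b}) = E - {a}" "insert a (E - {a} - {b}) = E - {b}" using a b by auto
        then show "g a (E - {a}) * g b (E - {b}) = h a b (E - {a} - {b})" by (simp add: h_def)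
      qed
      then show "(\<Sum>b\<in>E - {a}. g a (E - {a}) * g b (E - {b})) \<le> (\<Sum>b\<in>E - {a}. h a b (E - {a} - {b}))" by simp
    qed
    finally show ?thesis by (simp add: sum.distrib)
  qed
  have "rmean S p (\<lambda>E. (\<Sum>a\<in>E. g a (E - {a}))\<^sup>2)
      \<le> rmean S p (\<lambda>E. real (card E) + (\<Sum>a\<in>E. \<Sum>b\<in>E - {a}. h a b (E - {a} - {b})))"
    using p p1 sq by (intro rmean_mono) auto
  also have "\<dots> = p * real (card S) + rmean S p (\<lambda>E. \<Sum>a\<in>E. \<Sum>b\<in>E - {a}. h a b (E - {a} - {b}))"
    using S by (simp add: rmean_add rmean_card_edges)
  also have "rmean S p (\<lambda>E. \<Sum>a\<in>E. \<Sum>b\<in>E - {a}. h a b (E - {a} - {b}))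
      = (\<Sum>a\<in>S. p * (\<Sum>b\<in>S - {a}. p * rmean (S - {a} - {b}) p (h a b)))"
    using rmean_sum_edges[OF S, of p "\<lambda>a E. \<Sum>b\<in>E. h a b (E - {b})"] S
    by (simp add: rmean_sum_edges)
  also have "\<dots> \<le> (\<Sum>a\<in>S. p * (\<Sum>b\<in>S - {a}. p * (rmean S p (\<lambda>E. g a E * g b E) + 4 * p
      + 4 * rmean S p (\<lambda>E. \<delta> a b E) + 4 * rmean S p (\<lambda>E. \<delta> b a E))))"
  proof (intro sum_mono mult_left_mono p(1))
    fix a b assume ab: "a \<in> S" "b \<in> S - {a}"
    let ?S1 = "S - {a}" and ?S2 = "S - {a} - {b}"
    \<comment> \<open>Removing \<open>a\<close> and then \<open>b\<close> costs a factor 4 for the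
      nonnegative corrections \<open>\<delta>\<close>, but only \<open>4 * p\<close> for the product
      of centred terms, whose smallness on average must be kept.\<close>
    have rm2: "rmean ?S2 p u \<le> 4 * rmean S p u" if "\<And>E. 0 \<le> u E" for u
      using rmean_remove_le[of ?S1 b p u] rmean_remove_le[of S a p u] S ab p that by simp
    have rd2: "rmean ?S2 p u \<le> rmean S p u + 4 * p" if "\<And>E. \<bar>u E\<bar> \<le> 1" for u
      using rmean_remove_diff[of ?S1 b p u] rmean_remove_diff[of S a p u] S ab p that by simp
    have "h a b E \<le> g a E * g b E + (\<delta> a b E + \<delta> b a E)" for E
    proof -
      have "h a b E - g a E * g b E = (g a (insert b E) - g a E) * g b (insert a E) + g a E * (g b (insert a E) - g b E)"
        by (simp add: h_def algebra_simps)
      also have "\<dots> \<le> \<bar>g a (insert b E) - g a E\<bar> * \<bar>g b (insert a E)\<bar> + \<bar>g a E\<bar> * \<bar>g b (insert a E) - g b E\<bar>"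
        by (metis abs_ge_self abs_mult add_mono)
      also have "\<dots> \<le> \<delta> a b E * 1 + 1 * \<delta> b a E"
        using g by (intro add_mono mult_mono) (auto simp: \<delta>_def)
      finally show ?thesis by simp
    qed
    then have "rmean ?S2 p (h a b) \<le> rmean ?S2 p (\<lambda>E. g a E * g b E + (\<delta> a b E + \<delta> b a E))"
      using p p1 by (intro rmean_mono) auto
    also have "\<dots> = rmean ?S2 p (\<lambda>E. g a E * g b E) + (rmean ?S2 p (\<delta> a b) + rmean ?S2 p (\<delta> b a))"
      by (simp only: rmean_add)
    also have "\<dots> \<le> (rmean S p (\<lambda>E. g a E * g b E) + 4 * p) + (4 * rmean S p (\<delta> a b) + 4 * rmean S p (\<delta> b a))"
      by (intro add_mono rm2 rd2 gg) (auto simp: \<delta>_def)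
    finally show "rmean ?S2 p (h a b) \<le> rmean S p (\<lambda>E. g a E * g b E) + 4 * p
      + 4 * rmean S p (\<lambda>E. \<delta> a b E) + 4 * rmean S p (\<lambda>E. \<delta> b a E)" by simp
  qed
  also have "\<dots> = p\<^sup>2 * (\<Sum>a\<in>S. \<Sum>b\<in>S - {a}. rmean S p (\<lambda>E. g a E * g b E))
      + p\<^sup>2 * (\<Sum>a\<in>S. \<Sum>b\<in>S - {a}. 4 * p + 4 * rmean S p (\<delta> a b) + 4 * rmean S p (\<delta> b a))"
    by (simp add: sum_distrib_left sum.distrib algebra_simps power2_eq_square)
  also have "\<dots> \<le> p\<^sup>2 * rmean S p (\<lambda>E. (\<Sum>a\<in>S. g a E)\<^sup>2) + p\<^sup>2 * (4 * p * (real (card S))\<^sup>2 + 8 * (real (card S) * D))"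
  proof (intro add_mono mult_left_mono)
    have "(\<Sum>a\<in>S. \<Sum>b\<in>S - {a}. rmean S p (\<lambda>E. g a E * g b E)) = rmean S p (\<lambda>E. \<Sum>a\<in>S. \<Sum>b\<in>S - {a}. g a E * g b E)"
      by (simp only: rmean_sum)
    also have "\<dots> \<le> rmean S p (\<lambda>E. (\<Sum>a\<in>S. g a E)\<^sup>2)"
    proof (rule rmean_mono[OF p(1) p1])
      fix E
      have "(\<Sum>a\<in>S. \<Sum>b\<in>S - {a}. g a E * g b E) \<le> (\<Sum>a\<in>S. \<Sum>b\<in>S. g a E * g b E)"
      proof (rule sum_mono)
        fix a assume "a \<in> S"
        then have "(\<Sum>b\<in>S. g a E * g b E) = g a E * g a E + (\<Sum>b\<in>S - {a}. g a E * g b E)"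
          using S by (intro sum.remove) auto
        then show "(\<Sum>b\<in>S - {a}. g a E * g b E) \<le> (\<Sum>b\<in>S. g a E * g b E)" by simp
      qed
      then show "(\<Sum>a\<in>S. \<Sum>b\<in>S - {a}. g a E * g b E) \<le> (\<Sum>a\<in>S. g a E)\<^sup>2"
        by (simp add: power2_eq_square sum_product)
    qed
    finally show "(\<Sum>a\<in>S. \<Sum>b\<in>S - {a}. rmean S p (\<lambda>E. g a E * g b E)) \<le> rmean S p (\<lambda>E. (\<Sum>a\<in>S. g a E)\<^sup>2)" .
    have nn: "0 \<le> rmean S p (\<delta> a b)" for a b using p p1 by (intro rmean_nonneg) (auto simp: \<delta>_def)
    have "(\<Sum>a\<in>S. \<Sum>b\<in>S - {a}. 4 * p + 4 * rmean S p (\<delta> a b) + 4 * rmean S p (\<delta> b a))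
        \<le> (\<Sum>a\<in>S. \<Sum>b\<in>S. 4 * p + 4 * rmean S p (\<delta> a b) + 4 * rmean S p (\<delta> b a))"
      using S p nn by (intro sum_mono sum_mono2) auto
    also have "\<dots> = 4 * p * (real (card S))\<^sup>2 + (4 * (\<Sum>a\<in>S. \<Sum>b\<in>S. rmean S p (\<delta> a b)) + 4 * (\<Sum>a\<in>S. \<Sum>b\<in>S. rmean S p (\<delta> b a)))"
      by (simp add: sum.distrib sum_distrib_left power2_eq_square)
    also have "(\<Sum>a\<in>S. \<Sum>b\<in>S. rmean S p (\<delta> a b)) = (\<Sum>a\<in>S. \<Sum>b\<in>S. rmean S p (\<delta> b a))" by (rule sum.swap)
    also have "(\<Sum>b\<in>S. \<Sum>a\<in>S. rmean S p (\<delta> a b)) = (\<Sum>b\<in>S. rmean S p (\<lambda>E. \<Sum>a\<in>S. \<delta> a b E))"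
      by (simp only: rmean_sum)
    also have "\<dots> \<le> (\<Sum>b\<in>S. D)"
      using S p p1 D unfolding \<delta>_def by (intro sum_mono rmean_le_const) auto
    finally show "(\<Sum>a\<in>S. \<Sum>b\<in>S - {a}. 4 * p + 4 * rmean S p (\<delta> a b) + 4 * rmean S p (\<delta> b a))
        \<le> 4 * p * (real (card S))\<^sup>2 + 8 * (real (card S) * D)" by (simp add: mult.commute)
  qed auto
  finally show ?thesis by (simp add: algebra_simps power2_eq_square power3_eq_cube)
qed

section \<open>Hypergeometric counts and their binomial limit\<close>

lemma card_rsub_Int:
  assumes "finite V" "B \<subseteq> V" "i \<le> r"
  shows "card {a \<in> rsub r V. card (a \<inter> B) = i} = (card B choose i) * ((card V - card B) choose (r - i))"
proof -
  have fB: "finite B" by (rule finite_subset[OF assms(2,1)])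
  have "bij_betw (\<lambda>(X, Y). X \<union> Y) (rsub i B \<times> rsub (r - i) (V - B)) {a \<in> rsub r V. card (a \<inter> B) = i}"
  proof (rule bij_betwI[where g = "\<lambda>a. (a \<inter> B, a - B)"])
    show "(\<lambda>(X, Y). X \<union> Y) \<in> rsub i B \<times> rsub (r - i) (V - B) \<rightarrow> {a \<in> rsub r V. card (a \<inter> B) = i}"
    proof
      fix z assume "z \<in> rsub i B \<times> rsub (r - i) (V - B)"
      then obtain X Y where z: "z = (X, Y)" "X \<subseteq> B" "card X = i" "Y \<subseteq> V - B" "card Y = r - i" by (auto simp: rsub_def)
      have "finite X" "finite Y" using z fB assms(1) by (auto intro: finite_subset)
      moreover have "X \<inter> Y = {}" "(X \<union> Y) \<inter> B = X" using z by auto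
      ultimately show "(case z of (X, Y) \<Rightarrow> X \<union> Y) \<in> {a \<in> rsub r V. card (a \<inter> B) = i}"
        using z assms by (auto simp: rsub_def card_Un_disjoint)
    qed
    show "(\<lambda>a. (a \<inter> B, a - B)) \<in> {a \<in> rsub r V. card (a \<inter> B) = i} \<rightarrow> rsub i B \<times> rsub (r - i) (V - B)"
    proof
      fix a assume a: "a \<in> {a \<in> rsub r V. card (a \<inter> B) = i}"
      then have "finite a" using assms(1) by (auto simp: rsub_def intro: finite_subset)
      then have "card (a - B) = r - i" using a card_Diff_subset_Int[of a B] by (auto simp: rsub_def)
      then show "(a \<inter> B, a - B) \<in> rsub i B \<times> rsub (r - i) (V - B)" using a by (auto simp: rsub_def)
    qed
  qed (auto simp: rsub_def)
  then have "card {a \<in> rsub r V. card (a \<inter> B) = i} = card (rsub i B \<times> rsub (r - i) (V - B))"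
    by (simp add: bij_betw_same_card)
  then show ?thesis using assms fB by (simp add: card_cartesian_product card_rsub card_Diff_subset)
qed

text \<open>The hypergeometric distribution of \<open>r\<close> draws from \<open>n\<close>
  elements, \<open>b\<close> of them marked, with its value 1 moved to 0.\<close>

definition hypergeo :: "nat \<Rightarrow> nat \<Rightarrow> nat \<Rightarrow> nat \<Rightarrow> real" where
  "hypergeo r j n b = (\<Sum>i\<in>preim j \<inter> {..r}. real (b choose i) * real ((n - b) choose (r - i))) / real (n choose r)"

lemma card_rsub_one_to_zero:
  assumes "finite V" "B \<subseteq> V" "r \<le> card V"
  shows "real (card {a \<in> rsub r V. one_to_zero (card (a \<inter> B)) = j}) = hypergeo r j (card V) (card B) * real (card (rsub r V))"
proof -
  have le: "card (a \<inter> B) \<le> r" if "a \<in> rsub r V" for a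
    using that assms(1) card_mono[of a "a \<inter> B"] by (auto simp: rsub_def intro: finite_subset)
  have "{a \<in> rsub r V. one_to_zero (card (a \<inter> B)) = j} = (\<Union>i\<in>preim j \<inter> {..r}. {a \<in> rsub r V. card (a \<inter> B) = i})"
    using le by (auto simp: one_to_zero_eq_iff)
  also have "card \<dots> = (\<Sum>i\<in>preim j \<inter> {..r}. card {a \<in> rsub r V. card (a \<inter> B) = i})"
    using assms(1) by (intro card_UN_disjoint) auto
  also have "\<dots> = (\<Sum>i\<in>preim j \<inter> {..r}. (card B choose i) * ((card V - card B) choose (r - i)))"
    using assms by (intro sum.cong) (auto simp: card_rsub_Int)
  finally show ?thesis using assms by (simp add: hypergeo_def card_rsub)
qed

lemma tendsto_binomial_div_power:
  assumes N: "filterlim N at_top G" and m: "((\<lambda>x. real (m x) / real (N x)) \<longlongrightarrow> t) G"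
  shows "((\<lambda>x. real (m x choose k) / real (N x) ^ k) \<longlongrightarrow> t ^ k / fact k) G"
proof -
  have N': "filterlim (\<lambda>x. real (N x)) at_top G"
    using N by (rule filterlim_compose[OF filterlim_real_sequentially])
  have "((\<lambda>x. (\<Prod>i=0..<k. real (m x) / real (N x) - real i / real (N x)) / fact k) \<longlongrightarrow> (\<Prod>i=0..<k. t - 0) / fact k) G"
    by (intro tendsto_intros m real_tendsto_divide_at_top[OF tendsto_const N']) auto
  moreover have "(\<Prod>i=0..<k. real (m x) / real (N x) - real i / real (N x)) / fact k = real (m x choose k) / real (N x) ^ k" for x
    by (simp add: binomial_gbinomial gbinomial_prod_rev prod_dividef diff_divide_distrib[symmetric] field_simps)
  ultimately show ?thesis by simp
qed

lemma pmf_Bi_tilde: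
  assumes "0 \<le> q" "q \<le> 1"
  shows "pmf (Bi_tilde r q) j = (\<Sum>i\<in>preim j \<inter> {..r}. real (r choose i) * q ^ i * (1 - q) ^ (r - i))"
proof -
  have "pmf (Bi_tilde r q) j = (\<Sum>i\<in>preim j. real (r choose i) * q ^ i * (1 - q) ^ (r - i))"
    unfolding Bi_tilde_def using assms by (simp add: pmf_one_to_zero_sum)
  also have "\<dots> = (\<Sum>i\<in>preim j \<inter> {..r}. real (r choose i) * q ^ i * (1 - q) ^ (r - i))"
    by (intro sum.mono_neutral_right) (auto simp: binomial_eq_0)
  finally show ?thesis .
qed

text \<open>Each binomial coefficient is divided by its own power of \<open>n\<close>; the exponents
  \<open>i\<close> and \<open>r - i\<close> add up to the \<open>r\<close> of the
  denominator.\<close>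

lemma tendsto_hypergeo:
  assumes "d > 0"
  shows "((\<lambda>x. hypergeo r j (card (fst (fst x))) (snd x)) \<longlongrightarrow> pmf (Bi_tilde r (rho_star r d)) j)
    (crit_density r d (rho_star r d) :: (('a set \<times> real) \<times> nat) filter)"
proof -
  let ?G = "crit_density r d (rho_star r d) :: (('a set \<times> real) \<times> nat) filter"
  define \<rho> where "\<rho> = rho_star r d"
  define n where "n x = card (fst (fst x))" for x :: "('a set \<times> real) \<times> nat"
  have \<rho>: "0 \<le> \<rho>" "\<rho> < 1" using rho_star_greatest(2)[of r d] rho_star_less_1[OF assms, of r] by (auto simp: \<rho>_def)
  have n: "filterlim n at_top ?G"
    using filterlim_compose[OF filterlim_crit_card filterlim_crit_density(1)] unfolding n_def .
  have b: "((\<lambda>x. real (snd x) / real (n x)) \<longlongrightarrow> \<rho>) ?G"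
    using filterlim_crit_density(2) unfolding n_def \<rho>_def .
  have n1: "\<forall>\<^sub>F x in ?G. r < n x" by (rule eventually_compose_filterlim[OF eventually_gt_at_top n])
  have bn: "\<forall>\<^sub>F x in ?G. real (snd x) / real (n x) < 1" using b \<rho>(2) by (rule order_tendstoD)
  have one: "((\<lambda>x. real (n x) / real (n x)) \<longlongrightarrow> 1) ?G"
    using n1 by (intro tendsto_eventually) (auto elim: eventually_mono)
  have nb: "((\<lambda>x. real (n x - snd x) / real (n x)) \<longlongrightarrow> 1 - \<rho>) ?G"
  proof -
    have "((\<lambda>x. 1 - real (snd x) / real (n x)) \<longlongrightarrow> 1 - \<rho>) ?G" by (intro tendsto_intros b)
    moreover have "\<forall>\<^sub>F x in ?G. 1 - real (snd x) / real (n x) = real (n x - snd x) / real (n x)"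
      using n1 bn
    proof eventually_elim
      case (elim x)
      then have "snd x < n x" by (simp add: field_simps)
      then show ?case using elim by (simp add: field_simps of_nat_diff)
    qed
    ultimately show ?thesis by (auto elim: tendsto_cong[THEN iffD1, rotated])
  qed
  have summand: "((\<lambda>x. real (snd x choose i) * real ((n x - snd x) choose (r - i)) / real (n x choose r))
      \<longlongrightarrow> real (r choose i) * \<rho> ^ i * (1 - \<rho>) ^ (r - i)) ?G" if i: "i \<le> r" for i
  proof -
    have "((\<lambda>x. (real (snd x choose i) / real (n x) ^ i) * (real ((n x - snd x) choose (r - i)) / real (n x) ^ (r - i))
        / (real (n x choose r) / real (n x) ^ r)) \<longlongrightarrow> (\<rho> ^ i / fact i) * ((1 - \<rho>) ^ (r - i) / fact (r - i)) / (1 ^ r / fact r)) ?G"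
      by (intro tendsto_intros tendsto_binomial_div_power n b nb one) simp
    moreover have "(\<rho> ^ i / fact i) * ((1 - \<rho>) ^ (r - i) / fact (r - i)) / (1 ^ r / fact r) = real (r choose i) * \<rho> ^ i * (1 - \<rho>) ^ (r - i)"
      using binomial_fact[OF i, where ?'a = real] by simp
    moreover have "\<forall>\<^sub>F x in ?G. (real (snd x choose i) / real (n x) ^ i) * (real ((n x - snd x) choose (r - i)) / real (n x) ^ (r - i))
        / (real (n x choose r) / real (n x) ^ r) = real (snd x choose i) * real ((n x - snd x) choose (r - i)) / real (n x choose r)"
      using n1
    proof eventually_elim
      case (elim x)
      have "real (n x) ^ r = real (n x) ^ i * real (n x) ^ (r - i)" using i by (simp add: power_add[symmetric])
      then show ?case using elim by simp
    qed
    ultimately show ?thesis by (auto elim: tendsto_cong[THEN iffD1, rotated])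
  qed
  have "((\<lambda>x. \<Sum>i\<in>preim j \<inter> {..r}. real (snd x choose i) * real ((n x - snd x) choose (r - i)) / real (n x choose r))
      \<longlongrightarrow> (\<Sum>i\<in>preim j \<inter> {..r}. real (r choose i) * \<rho> ^ i * (1 - \<rho>) ^ (r - i))) ?G"
    by (intro tendsto_sum summand) auto
  then show ?thesis using \<rho> by (simp add: hypergeo_def pmf_Bi_tilde n_def \<rho>_def sum_divide_distrib)
qed

text \<open>The expected number of dense sets of each bounded size is bounded, and each spans at
  most \<open>2 ^ M\<close> edges; an exceptional edge lies inside one of them.\<close>

lemma evt_nonsparse_edges:
  assumes "r \<ge> 2" "d > 0"
  obtains C where "C > 0" "evt r d (\<lambda>(V :: 'a set) p.
    rmean (rsub r V) p (\<lambda>E. real (card {a \<in> E. \<not> sparse_near r V E K a})) \<le> C)"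
proof -
  define M where "M = r + (r - 1) * K"
  obtain c where c: "c > 0" "evt r d (\<lambda>(V :: 'a set) p. admissible r c V p)"
    by (rule evt_bound[OF assms])
  obtain C where C: "C > 0" "evt r d (\<lambda>(V :: 'a set) p. \<forall>W\<subseteq>V. card W \<le> M \<longrightarrow>
      rprob (rsub r V) p (\<lambda>E. dense r E W) \<le> C / real (card V) ^ card W)"
    by (rule evt_dense[OF assms])
  define C' where "C' = real (Suc M) * (2 ^ M * C)"
  have "C' > 0" using C by (simp add: C'_def)
  moreover have "evt r d (\<lambda>(V :: 'a set) p.
    rmean (rsub r V) p (\<lambda>E. real (card {a \<in> E. \<not> sparse_near r V E K a})) \<le> C')"
  proof (rule evt_elim3[OF c(2) C(2) evt_card[of _ _ 1]])
    fix V :: "'a set" and p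
    assume *: "admissible r c V p"
      and dn: "\<forall>W\<subseteq>V. card W \<le> M \<longrightarrow> rprob (rsub r V) p (\<lambda>E. dense r E W) \<le> C / real (card V) ^ card W"
      and n1: "1 \<le> card V"
    define n where "n = real (card V)"
    have n: "n \<ge> 1" using n1 by (simp add: n_def)
    define A where "A = (SIGMA k:{..M}. rsub k V)"
    have finA: "finite A" using * by (simp add: A_def)
    have "rmean (rsub r V) p (\<lambda>E. real (card {a \<in> E. \<not> sparse_near r V E K a}))
        \<le> rmean (rsub r V) p (\<lambda>E. \<Sum>x\<in>A. 2 ^ M * of_bool (dense r E (snd x)))"
    proof (rule rmean_mono)
      fix E assume E: "E \<subseteq> rsub r V"
      have finE: "finite E" by (rule finite_subset[OF E]) (use * in simp)
      have "{a \<in> E. \<not> sparse_near r V E K a} \<subseteq> (\<Union>x\<in>{x \<in> A. dense r E (snd x)}. {e \<in> E. e \<subseteq> snd x})"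
      proof
        fix a assume a: "a \<in> {a \<in> E. \<not> sparse_near r V E K a}"
        then obtain W where W: "W \<subseteq> V" "a \<subseteq> W" "card W \<le> M" "dense r E W"
          by (auto simp: sparse_near_def M_def)
        then have "(card W, W) \<in> A" by (auto simp: A_def rsub_def)
        then show "a \<in> (\<Union>x\<in>{x \<in> A. dense r E (snd x)}. {e \<in> E. e \<subseteq> snd x})"
          using W a by (intro UN_I[of "(card W, W)"]) auto
      qed
      then have "card {a \<in> E. \<not> sparse_near r V E K a} \<le> card (\<Union>x\<in>{x \<in> A. dense r E (snd x)}. {e \<in> E. e \<subseteq> snd x})"
        using finA finE by (intro card_mono) auto
      also have "\<dots> \<le> (\<Sum>x\<in>{x \<in> A. dense r E (snd x)}. card {e \<in> E. e \<subseteq> snd x})"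
        using finA by (intro card_UN_le) auto
      also have "\<dots> \<le> (\<Sum>x\<in>{x \<in> A. dense r E (snd x)}. 2 ^ M)"
      proof (rule sum_mono)
        fix x assume "x \<in> {x \<in> A. dense r E (snd x)}"
        then have x: "snd x \<subseteq> V" "card (snd x) \<le> M" by (auto simp: A_def rsub_def)
        have fx: "finite (snd x)" by (rule finite_subset[OF x(1)]) (use * in simp)
        have "card {e \<in> E. e \<subseteq> snd x} \<le> card (Pow (snd x))" using fx by (intro card_mono) auto
        also have "\<dots> \<le> 2 ^ M" using fx x by (simp add: card_Pow)
        finally show "card {e \<in> E. e \<subseteq> snd x} \<le> 2 ^ M" .
      qed
      finally have "real (card {a \<in> E. \<not> sparse_near r V E K a}) \<le> real (\<Sum>x\<in>{x \<in> A. dense r E (snd x)}. 2 ^ M)"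
        by (simp only: of_nat_le_iff)
      also have "\<dots> = (\<Sum>x\<in>A. 2 ^ M * of_bool (dense r E (snd x)))"
        using finA by (simp add: of_bool_def sum.If_cases Int_def if_distrib[of "\<lambda>x. _ * x"] mult.commute cong: if_cong)
      finally show "real (card {a \<in> E. \<not> sparse_near r V E K a}) \<le> (\<Sum>x\<in>A. 2 ^ M * of_bool (dense r E (snd x)))" .
    qed (use * in auto)
    also have "\<dots> = (\<Sum>x\<in>A. 2 ^ M * rprob (rsub r V) p (\<lambda>E. dense r E (snd x)))"
      unfolding rmean_sum rmean_cmult rprob_def ..
    also have "\<dots> = (\<Sum>k\<le>M. \<Sum>W\<in>rsub k V. 2 ^ M * rprob (rsub r V) p (\<lambda>E. dense r E W))"
      using * unfolding A_def by (subst sum.Sigma) (auto simp: case_prod_unfold)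
    also have "\<dots> \<le> (\<Sum>k\<le>M. 2 ^ M * C)"
    proof (rule sum_mono)
      fix k assume k: "k \<in> {..M}"
      have "(\<Sum>W\<in>rsub k V. 2 ^ M * rprob (rsub r V) p (\<lambda>E. dense r E W)) \<le> (\<Sum>W\<in>rsub k V. 2 ^ M * (C / n ^ k))"
        using dn k by (intro sum_mono mult_left_mono) (auto simp: rsub_def n_def)
      also have "\<dots> = 2 ^ M * C * (real (card V choose k) / n ^ k)" using * by (simp add: card_rsub)
      also have "\<dots> \<le> 2 ^ M * C * 1"
      proof (intro mult_left_mono)
        have "real (card V choose k) \<le> n ^ k" using binomial_le_power[of "card V" k] by (simp add: n_def flip: of_nat_power)
        then show "real (card V choose k) / n ^ k \<le> 1" using n by simp
      qed (use C in auto)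
      finally show "(\<Sum>W\<in>rsub k V. 2 ^ M * rprob (rsub r V) p (\<lambda>E. dense r E W)) \<le> 2 ^ M * C" by simp
    qed
    also have "\<dots> = C'" by (simp add: C'_def)
    finally show "rmean (rsub r V) p (\<lambda>E. real (card {a \<in> E. \<not> sparse_near r V E K a})) \<le> C'" .
  qed
  ultimately show thesis by (rule that)
qed

lemma card_rsub_meeting_le:
  assumes "finite V" "T \<subseteq> V" "r \<ge> 1"
  shows "card {a \<in> rsub r V. a \<inter> T \<noteq> {}} \<le> card T * card V ^ (r - 1)"
proof -
  have fT: "finite T" by (rule finite_subset[OF assms(2,1)])
  have "card {a \<in> rsub r V. a \<inter> T \<noteq> {}} \<le> card (\<Union>t\<in>T. star r V t)"
    using assms fT by (intro card_mono) (auto simp: star_def)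
  also have "\<dots> \<le> (\<Sum>t\<in>T. card (star r V t))" using fT by (rule card_UN_le)
  also have "\<dots> \<le> (\<Sum>t\<in>T. card V ^ (r - 1))"
  proof (rule sum_mono)
    fix t assume "t \<in> T"
    then have "card (star r V t) = (card V - 1) choose (r - 1)" using assms by (intro card_star) auto
    also have "\<dots> \<le> (card V - 1) ^ (r - 1)" by (rule binomial_le_power)
    also have "\<dots> \<le> card V ^ (r - 1)" by (intro power_mono) auto
    finally show "card (star r V t) \<le> card V ^ (r - 1)" .
  qed
  finally show ?thesis by simp
qed

text \<open>The target \<open>T (E - {a})\<close> is independent of the presence of
  \<open>a\<close>. Making \<open>a\<close> random again costs a factor 2, after which the possible
  edges meeting the target are counted.\<close>

lemma rmean_meeting_edges_le:
  assumes "finite V" "r \<ge> 1" "0 \<le> p" "p \<le> 1 / 2" "\<And>E. T E \<subseteq> V"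
  shows "rmean (rsub r V) p (\<lambda>E. real (card {a \<in> E. a \<inter> T (E - {a}) \<noteq> {}}))
    \<le> 2 * (p * real (card V) ^ (r - 1)) * rmean (rsub r V) p (\<lambda>E. real (card (T E)))"
proof -
  let ?S = "rsub r V"
  have S: "finite ?S" using assms by simp
  have "rmean ?S p (\<lambda>E. real (card {a \<in> E. a \<inter> T (E - {a}) \<noteq> {}}))
      = rmean ?S p (\<lambda>E. \<Sum>a\<in>E. of_bool (a \<inter> T (E - {a}) \<noteq> {}))"
  proof (rule rmean_cong)
    fix E assume "E \<subseteq> ?S"
    then have "finite E" using S by (rule finite_subset)
    then show "real (card {a \<in> E. a \<inter> T (E - {a}) \<noteq> {}}) = (\<Sum>a\<in>E. of_bool (a \<inter> T (E - {a}) \<noteq> {}))"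
      by (simp add: of_bool_def sum.If_cases Int_def)
  qed
  also have "\<dots> = (\<Sum>a\<in>?S. p * rmean (?S - {a}) p (\<lambda>E. of_bool (a \<inter> T E \<noteq> {})))"
    by (rule rmean_sum_edges[OF S])
  also have "\<dots> \<le> (\<Sum>a\<in>?S. p * (2 * rmean ?S p (\<lambda>E. of_bool (a \<inter> T E \<noteq> {}))))"
    using assms S by (intro sum_mono mult_left_mono rmean_remove_le) auto
  also have "\<dots> = 2 * p * rmean ?S p (\<lambda>E. \<Sum>a\<in>?S. of_bool (a \<inter> T E \<noteq> {}))"
    by (simp add: rmean_sum sum_distrib_left mult_ac)
  also have "\<dots> \<le> 2 * p * rmean ?S p (\<lambda>E. real (card V) ^ (r - 1) * real (card (T E)))"
  proof (intro mult_left_mono rmean_mono)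
    fix E
    have "(\<Sum>a\<in>?S. of_bool (a \<inter> T E \<noteq> {}) :: real) = real (card {a \<in> ?S. a \<inter> T E \<noteq> {}})"
      using S by (simp add: of_bool_def sum.If_cases Int_def)
    also have "\<dots> \<le> real (card (T E) * card V ^ (r - 1))"
      using card_rsub_meeting_le[OF assms(1,5,2)] by (simp only: of_nat_le_iff)
    finally show "(\<Sum>a\<in>?S. of_bool (a \<inter> T E \<noteq> {})) \<le> real (card V) ^ (r - 1) * real (card (T E))"
      by (simp add: mult.commute)
  qed (use assms in auto)
  finally show ?thesis unfolding rmean_cmult by (simp add: mult_ac)
qed

text \<open>Used with the edges other than \<open>a\<close> for \<open>E\<close>, so that the value
  does not depend on whether \<open>a\<close> is present.\<close>

definition factor_centered :: "'a set \<Rightarrow> nat \<Rightarrow> nat \<Rightarrow> real \<Rightarrow> 'a set \<Rightarrow> 'a set set \<Rightarrow> real" where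
  "factor_centered V K j \<pi> a E = of_bool (one_to_zero (card (a \<inter> big V E K)) = j) - \<pi>"

text \<open>In \<open>rmean_sum_edges_sq_le\<close> the first three terms are of order
  \<open>n\<close>. In the last one, the sum over all possible edges is the number of these edges
  times the deviation of \<open>hypergeo\<close> from \<open>\<pi>\<close>, which is small whenever
  \<open>giantlike\<close> holds.\<close>

lemma rmean_factor_centered_sq_le:
  assumes V: "finite V" "r \<le> card V" and p: "0 < p" "p \<le> 1 / 2" "p * n ^ (r - 1) \<le> c" and r: "r \<ge> 2"
    and n: "n = real (card V)" and \<pi>: "0 \<le> \<pi>" "\<pi> \<le> 1" and \<gamma>: "0 \<le> \<gamma>" "\<gamma> \<le> 1"
    and gl: "rprob (rsub r V) p (\<lambda>E. \<not> giantlike r d \<epsilon> K V E) \<le> \<gamma>"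
    and close: "\<And>E. E \<subseteq> rsub r V \<Longrightarrow> giantlike r d \<epsilon> K V E \<Longrightarrow> \<bar>hypergeo r j (card V) (card (big V E K)) - \<pi>\<bar> \<le> \<gamma>"
  shows "rmean (rsub r V) p (\<lambda>E. (\<Sum>a\<in>E. factor_centered V K j \<pi> a (E - {a}))\<^sup>2)
    \<le> (c + 8 * c\<^sup>2 * real (r * K) + 4 * c ^ 3) * n + 2 * c\<^sup>2 * \<gamma> * n\<^sup>2"
proof -
  let ?S = "rsub r V" and ?g = "factor_centered V K j \<pi>"
  define s where "s = real (card ?S)"
  have S: "finite ?S" using V by simp
  have n1: "n \<ge> 1" using V r n by simp
  have ps: "p * s \<le> c * n"
  proof -
    have "s \<le> n ^ r" using binomial_le_power[of "card V" r] V by (simp add: s_def card_rsub n flip: of_nat_power)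
    also have "n ^ r = n ^ (r - 1) * n" using r by (cases r) auto
    finally have "p * s \<le> p * (n ^ (r - 1) * n)" using p by (intro mult_left_mono) auto
    also have "\<dots> = p * n ^ (r - 1) * n" by simp
    also have "\<dots> \<le> c * n" using p n1 by (intro mult_right_mono) auto
    finally show ?thesis .
  qed
  have pn: "p * n \<le> c"
  proof -
    have "p * n \<le> p * n ^ (r - 1)" using p n1 r by (intro mult_left_mono self_le_power) auto
    then show ?thesis using p by linarith
  qed
  have c0: "0 \<le> c" using pn p n1 by (smt (verit) mult_nonneg_nonneg)
  have s0: "0 \<le> s" by (simp add: s_def)
  \<comment> \<open>A new edge makes at most \<open>r * K\<close> vertices big, and each lies in at
    most \<open>n ^ (r - 1)\<close> possible edges.\<close>
  define D where "D = real (r * K) * n ^ (r - 1)"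
  have "rmean ?S p (\<lambda>E. (\<Sum>a\<in>E. ?g a (E - {a}))\<^sup>2)
      \<le> p * real (card ?S) + 8 * p\<^sup>2 * real (card ?S) * D + 4 * p ^ 3 * (real (card ?S))\<^sup>2
        + p\<^sup>2 * rmean ?S p (\<lambda>E. (\<Sum>a\<in>?S. ?g a E)\<^sup>2)"
  proof (rule rmean_sum_edges_sq_le[OF S])
    show "\<bar>?g a E\<bar> \<le> 1" for a E using \<pi> by (auto simp: factor_centered_def of_bool_def)
    fix b E assume E: "E \<subseteq> ?S" "b \<in> ?S"
    define T where "T = big V (insert b E) K - big V E K"
    have sub: "big V E K \<subseteq> big V (insert b E) K" using V E by (intro big_mono[where r = r]) auto
    have "(\<Sum>a\<in>?S. \<bar>?g a (insert b E) - ?g a E\<bar>) \<le> (\<Sum>a\<in>?S. of_bool (a \<inter> T \<noteq> {}))"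
    proof (rule sum_mono)
      fix a
      show "\<bar>?g a (insert b E) - ?g a E\<bar> \<le> of_bool (a \<inter> T \<noteq> {})"
      proof (cases "a \<inter> T = {}")
        case True
        then have "a \<inter> big V (insert b E) K = a \<inter> big V E K" using sub by (auto simp: T_def)
        then show ?thesis by (simp add: factor_centered_def)
      qed (simp add: factor_centered_def of_bool_def)
    qed
    also have "\<dots> = real (card {a \<in> ?S. a \<inter> T \<noteq> {}})" using S by (simp add: of_bool_def sum.If_cases Int_def)
    also have "\<dots> \<le> real (card T * card V ^ (r - 1))"
      using card_rsub_meeting_le[of V T r] V r by (simp only: of_nat_le_iff) (auto simp: T_def big_def)
    also have "\<dots> \<le> real (r * K * card V ^ (r - 1))"
      using card_big_insert[OF V(1) E, of K] by (simp only: of_nat_le_iff T_def) (intro mult_right_mono, auto)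
    also have "\<dots> = D" by (simp add: D_def n)
    finally show "(\<Sum>a\<in>?S. \<bar>?g a (insert b E) - ?g a E\<bar>) \<le> D" .
  qed (use p in auto)
  also have "p * real (card ?S) \<le> c * n" using ps by (simp add: s_def)
  also have "8 * p\<^sup>2 * real (card ?S) * D \<le> 8 * c\<^sup>2 * real (r * K) * n"
  proof -
    have "8 * p\<^sup>2 * s * D = 8 * real (r * K) * ((p * s) * (p * n ^ (r - 1)))"
      by (simp add: D_def power2_eq_square)
    also have "\<dots> \<le> 8 * real (r * K) * ((c * n) * c)"
    proof (rule mult_left_mono)
      show "(p * s) * (p * n ^ (r - 1)) \<le> (c * n) * c"
        by (rule mult_mono[OF ps p(3)]) (use p c0 n1 in auto)
    qed simp
    finally show ?thesis by (simp add: s_def power2_eq_square mult_ac)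
  qed
  also have "4 * p ^ 3 * (real (card ?S))\<^sup>2 \<le> 4 * c ^ 3 * n"
  proof -
    have "4 * p ^ 3 * s\<^sup>2 = 4 * (p * ((p * s) * (p * s)))" by (simp add: power2_eq_square power3_eq_cube)
    also have "\<dots> \<le> 4 * (p * ((c * n) * (c * n)))" 
    proof (intro mult_left_mono)
      show "(p * s) * (p * s) \<le> (c * n) * (c * n)"
        by (rule mult_mono[OF ps ps]) (use p s0 c0 n1 in auto)
    qed (use p in auto)
    also have "\<dots> = 4 * (p * n) * (c * c * n)" by simp
    also have "\<dots> \<le> 4 * c * (c * c * n)" using pn c0 n1 by (intro mult_right_mono) auto
    finally show ?thesis by (simp add: s_def power3_eq_cube mult_ac)
  qed
  also have "p\<^sup>2 * rmean ?S p (\<lambda>E. (\<Sum>a\<in>?S. ?g a E)\<^sup>2) \<le> 2 * c\<^sup>2 * \<gamma> * n\<^sup>2"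
  proof -
    have sum: "(\<Sum>a\<in>?S. ?g a E) = (hypergeo r j (card V) (card (big V E K)) - \<pi>) * s" for E
    proof -
      have "(\<Sum>a\<in>?S. ?g a E) = real (card {a \<in> ?S. one_to_zero (card (a \<inter> big V E K)) = j}) - \<pi> * s"
        using S by (simp add: factor_centered_def sum_subtractf of_bool_def sum.If_cases Int_def s_def mult.commute)
      then show ?thesis using card_rsub_one_to_zero[OF V(1) big_subset V(2)] by (simp add: s_def algebra_simps)
    qed
    have "rmean ?S p (\<lambda>E. (\<Sum>a\<in>?S. ?g a E)\<^sup>2) \<le> rmean ?S p (\<lambda>E. s\<^sup>2 * (of_bool (\<not> giantlike r d \<epsilon> K V E) + \<gamma>))"
    proof (rule rmean_mono)
      fix E assume E: "E \<subseteq> ?S"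
      show "(\<Sum>a\<in>?S. ?g a E)\<^sup>2 \<le> s\<^sup>2 * (of_bool (\<not> giantlike r d \<epsilon> K V E) + \<gamma>)"
      proof (cases "giantlike r d \<epsilon> K V E")
        case True
        have "(hypergeo r j (card V) (card (big V E K)) - \<pi>)\<^sup>2 \<le> \<gamma>\<^sup>2"
          using close[OF E True] \<gamma> by (simp add: abs_le_square_iff[symmetric])
        also have "\<dots> \<le> \<gamma>" using \<gamma> by (simp add: power2_eq_square mult_left_le)
        finally have "s\<^sup>2 * (hypergeo r j (card V) (card (big V E K)) - \<pi>)\<^sup>2 \<le> s\<^sup>2 * \<gamma>" by (rule mult_left_mono) simp
        then show ?thesis using True by (simp add: sum power_mult_distrib mult.commute)
      next
        case False
        have "\<bar>\<Sum>a\<in>?S. ?g a E\<bar> \<le> (\<Sum>a\<in>?S. \<bar>?g a E\<bar>)" by (rule sum_abs)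
        also have "\<dots> \<le> (\<Sum>a\<in>?S. 1)" using \<pi> by (intro sum_mono) (auto simp: factor_centered_def of_bool_def)
        also have "\<dots> = s" by (simp add: s_def)
        finally have "(\<Sum>a\<in>?S. ?g a E)\<^sup>2 \<le> s\<^sup>2" using s0 by (simp add: abs_le_square_iff[symmetric])
        moreover have "s\<^sup>2 * 1 \<le> s\<^sup>2 * (1 + \<gamma>)" using \<gamma> by (intro mult_left_mono) auto
        ultimately show ?thesis using False by simp
      qed
    qed (use p in auto)
    also have "\<dots> = s\<^sup>2 * (rprob ?S p (\<lambda>E. \<not> giantlike r d \<epsilon> K V E) + \<gamma>)"
      using S by (simp only: rmean_cmult rmean_add rmean_const rprob_def)
    also have "\<dots> \<le> s\<^sup>2 * (2 * \<gamma>)" using gl by (intro mult_left_mono) auto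
    finally have "p\<^sup>2 * rmean ?S p (\<lambda>E. (\<Sum>a\<in>?S. ?g a E)\<^sup>2) \<le> p\<^sup>2 * (s\<^sup>2 * (2 * \<gamma>))"
      by (intro mult_left_mono) auto
    also have "\<dots> = (p * s)\<^sup>2 * (2 * \<gamma>)" by (simp add: power_mult_distrib)
    also have "\<dots> \<le> (c * n)\<^sup>2 * (2 * \<gamma>)" using ps p s0 \<gamma> by (intro mult_right_mono power_mono) auto
    finally show ?thesis by (simp add: power_mult_distrib mult_ac)
  qed
  finally show ?thesis by (simp add: algebra_simps)
qed

lemma rprob_few_edges_le:
  assumes "finite S" "0 < p" "p \<le> 1" "S \<noteq> {}"
  shows "rprob S p (\<lambda>E. real (card E) < p * real (card S) / 2) \<le> 4 / (p * real (card S))"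
proof -
  define \<mu> where "\<mu> = p * real (card S)"
  have \<mu>: "\<mu> > 0" using assms by (simp add: \<mu>_def card_gt_0_iff)
  have m: "rmean S p (\<lambda>E. real (card E)) = \<mu>" unfolding \<mu>_def by (rule rmean_card_edges[OF assms(1)])
  have "rmean S p (\<lambda>E. (real (card E) - rmean S p (\<lambda>E. real (card E)))\<^sup>2) \<le> p * real (card S) * 1\<^sup>2"
  proof (rule rmean_efron_stein)
    fix E e assume "E \<subseteq> S" "e \<in> S" "e \<notin> E"
    then show "\<bar>real (card (insert e E)) - real (card E)\<bar> \<le> 1"
      using assms(1) by (simp add: finite_subset)
  qed (use assms in auto)
  then have var: "rmean S p (\<lambda>E. (real (card E) - \<mu>)\<^sup>2) \<le> \<mu>" unfolding m by (simp add: \<mu>_def)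
  have "rprob S p (\<lambda>E. real (card E) < \<mu> / 2) \<le> rprob S p (\<lambda>E. \<mu> / 2 \<le> \<bar>real (card E) - \<mu>\<bar>)"
    using assms by (intro rprob_mono) (auto simp: abs_if)
  also have "\<dots> \<le> \<mu> / (\<mu> / 2)\<^sup>2" using assms \<mu> var by (intro rchebyshev) auto
  also have "\<dots> = 4 / \<mu>" using \<mu> by (simp add: power2_eq_square field_simps)
  finally show ?thesis by (simp add: \<mu>_def)
qed

text \<open>An exceptional edge is near a dense set or meets a big vertex outside \<open>L\<close>
  of the hypergraph without this edge. The mean number of such vertices is at most
  \<open>3 * \<epsilon> * n\<close>.\<close>

lemma rmean_deg_core_factor_neq_le:
  assumes V: "finite V" and r: "r \<ge> 2" and p: "0 < p" "p \<le> 1 / 2" "p * real (card V) ^ (r - 1) \<le> c"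
    and \<epsilon>: "0 < \<epsilon>" and gl: "rprob (rsub r V) p (\<lambda>E. \<not> giantlike r d \<epsilon> K V E) \<le> \<epsilon>"
    and C: "rmean (rsub r V) p (\<lambda>E. real (card {a \<in> E. \<not> sparse_near r V E K a})) \<le> C"
  shows "rmean (rsub r V) p (\<lambda>E. real (card {a \<in> E. deg (core V E) (Inr a) \<noteq> one_to_zero (card (a \<inter> big V (E - {a}) K))}))
    \<le> C + 6 * c * \<epsilon> * real (card V)"
proof -
  let ?S = "rsub r V"
  have S: "finite ?S" using V by simp
  obtain L where L: "\<And>E. L E \<subseteq> big V E K" "\<And>E u w. u \<in> L E \<Longrightarrow> w \<in> L E \<Longrightarrow> w \<in> component E u"
    "\<And>E. giantlike r d \<epsilon> K V E \<Longrightarrow> (rho_star r d - \<epsilon>) * real (card V) \<le> real (card (L E))"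
    using giant_part_exists[where V = V and K = K and \<epsilon> = \<epsilon> and r = r and d = d] by metis
  define T where "T E = big V E K - L E" for E
  have TV: "T E \<subseteq> V" for E by (auto simp: T_def big_def)
  have "rmean ?S p (\<lambda>E. real (card {a \<in> E. deg (core V E) (Inr a) \<noteq> one_to_zero (card (a \<inter> big V (E - {a}) K))}))
      \<le> rmean ?S p (\<lambda>E. real (card {a \<in> E. \<not> sparse_near r V E K a}) + real (card {a \<in> E. a \<inter> T (E - {a}) \<noteq> {}}))"
  proof (rule rmean_mono)
    fix E assume E: "E \<subseteq> ?S"
    have fE: "finite E" using E S by (rule finite_subset)
    have "{a \<in> E. deg (core V E) (Inr a) \<noteq> one_to_zero (card (a \<inter> big V (E - {a}) K))}
        \<subseteq> {a \<in> E. \<not> sparse_near r V E K a} \<union> {a \<in> E. a \<inter> T (E - {a}) \<noteq> {}}"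
    proof
      fix a assume a: "a \<in> {a \<in> E. deg (core V E) (Inr a) \<noteq> one_to_zero (card (a \<inter> big V (E - {a}) K))}"
      show "a \<in> {a \<in> E. \<not> sparse_near r V E K a} \<union> {a \<in> E. a \<inter> T (E - {a}) \<noteq> {}}"
      proof (rule ccontr)
        assume "\<not> ?thesis"
        then have s: "sparse_near r V E K a" and h: "a \<inter> (big V (E - {a}) K - L (E - {a})) = {}"
          using a by (auto simp: T_def)
        have "deg (core V E) (Inr a) = one_to_zero (card (a \<inter> big V (E - {a}) K))"
          using a by (intro deg_core_factor_eq[OF V E r _ s L(2) h]) auto
        then show False using a by simp
      qed
    qed
    then have "card {a \<in> E. deg (core V E) (Inr a) \<noteq> one_to_zero (card (a \<inter> big V (E - {a}) K))}
        \<le> card ({a \<in> E. \<not> sparse_near r V E K a} \<union> {a \<in> E. a \<inter> T (E - {a}) \<noteq> {}})"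
      using fE by (intro card_mono) auto
    also have "\<dots> \<le> card {a \<in> E. \<not> sparse_near r V E K a} + card {a \<in> E. a \<inter> T (E - {a}) \<noteq> {}}"
      by (rule card_Un_le)
    finally show "real (card {a \<in> E. deg (core V E) (Inr a) \<noteq> one_to_zero (card (a \<inter> big V (E - {a}) K))})
        \<le> real (card {a \<in> E. \<not> sparse_near r V E K a}) + real (card {a \<in> E. a \<inter> T (E - {a}) \<noteq> {}})" by linarith
  qed (use p in auto)
  also have "\<dots> = rmean ?S p (\<lambda>E. real (card {a \<in> E. \<not> sparse_near r V E K a}))
      + rmean ?S p (\<lambda>E. real (card {a \<in> E. a \<inter> T (E - {a}) \<noteq> {}}))"
    by (rule rmean_add)
  also note C
  also have "rmean ?S p (\<lambda>E. real (card {a \<in> E. a \<inter> T (E - {a}) \<noteq> {}}))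
      \<le> 2 * (p * real (card V) ^ (r - 1)) * rmean ?S p (\<lambda>E. real (card (T E)))"
    using V r p TV by (intro rmean_meeting_edges_le) auto
  also have "\<dots> \<le> 2 * c * (3 * \<epsilon> * real (card V))"
  proof (intro mult_mono)
    have "rmean ?S p (\<lambda>E. real (card (T E)))
        \<le> rmean ?S p (\<lambda>E. real (card V) * (of_bool (\<not> giantlike r d \<epsilon> K V E) + 2 * \<epsilon>))"
    proof (rule rmean_mono)
      fix E
      have finB: "finite (big V E K)" by (rule finite_subset[OF big_subset V])
      show "real (card (T E)) \<le> real (card V) * (of_bool (\<not> giantlike r d \<epsilon> K V E) + 2 * \<epsilon>)"
      proof (cases "giantlike r d \<epsilon> K V E")
        case True
        have "card (T E) = card (big V E K) - card (L E)"
          unfolding T_def by (rule card_Diff_subset[OF finite_subset[OF L(1) finB] L(1)])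
        moreover have "card (L E) \<le> card (big V E K)" by (rule card_mono[OF finB L(1)])
        ultimately have "real (card (T E)) = real (card (big V E K)) - real (card (L E))" by simp
        also have "\<dots> \<le> (rho_star r d + \<epsilon>) * real (card V) - (rho_star r d - \<epsilon>) * real (card V)"
          using L(3)[OF True] True by (intro diff_mono) (auto simp: giantlike_def)
        also have "\<dots> = real (card V) * (2 * \<epsilon>)" by (simp add: algebra_simps)
        finally show ?thesis using True by simp
      next
        case False
        have "card (T E) \<le> card V" by (rule card_mono[OF V TV])
        moreover have "real (card V) * 1 \<le> real (card V) * (1 + 2 * \<epsilon>)" using \<epsilon> by (intro mult_left_mono) auto
        ultimately show ?thesis using False by simp
      qed
    qed (use p in auto)
    also have "\<dots> = real (card V) * (rprob ?S p (\<lambda>E. \<not> giantlike r d \<epsilon> K V E) + 2 * \<epsilon>)"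
      using S by (simp only: rmean_cmult rmean_add rmean_const rprob_def)
    also have "\<dots> \<le> real (card V) * (\<epsilon> + 2 * \<epsilon>)" using gl by (intro mult_left_mono add_mono) auto
    finally show "rmean ?S p (\<lambda>E. real (card (T E))) \<le> 3 * \<epsilon> * real (card V)" by (simp add: mult.commute)
    show "0 \<le> rmean ?S p (\<lambda>E. real (card (T E)))" using p by (intro rmean_nonneg) auto
    show "0 \<le> 2 * c" using p by (smt (verit) mult_nonneg_nonneg of_nat_0_le_iff zero_le_power)
  qed (use p in auto)
  finally show ?thesis by (simp add: mult_ac)
qed

lemma whp_factor:
  assumes "r \<ge> 3" "d > 0" "\<tau> > 0"
  shows "whp r d (\<lambda>(V :: 'a set) E. \<bar>real (card {a \<in> E. deg (core V E) (Inr a) = j}) / real (card E)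
    - pmf (Bi_tilde r (rho_star r d)) j\<bar> \<le> \<tau>)"
  unfolding whp_def
proof (intro allI impI)
  fix \<eta> :: real assume \<eta>: "\<eta> > 0"
  define \<pi> where "\<pi> = pmf (Bi_tilde r (rho_star r d)) j"
  have \<pi>: "0 \<le> \<pi>" "\<pi> \<le> 1" by (auto simp: \<pi>_def pmf_le_1)
  define \<rho> where "\<rho> = rho_star r d"
  have r2: "r \<ge> 2" using assms by simp
  \<comment> \<open>With high probability there are at least \<open>d * n / (4 * r)\<close> edges,
    so an absolute deviation below \<open>t * n\<close> is a relative one below
    \<open>\<tau>\<close>.\<close>
  define t where "t = \<tau> * d / (4 * real r)"
  have t: "t > 0" using assms by (simp add: t_def)
  obtain c where c: "c > 0" "evt r d (\<lambda>(V :: 'a set) p. admissible r c V p)"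
    by (rule evt_bound[OF r2 assms(2)])
  \<comment> \<open>Makes the main term \<open>8 * c\<^sup>2 * \<gamma> / t\<^sup>2\<close> of
    Chebyshev's bound at most \<open>\<eta> / 8\<close>; the cap 1 gives
    \<open>\<gamma>\<^sup>2 \<le> \<gamma>\<close>.\<close>
  define \<gamma> where "\<gamma> = min 1 (t\<^sup>2 * \<eta> / (64 * c\<^sup>2))"
  have \<gamma>: "0 < \<gamma>" "\<gamma> \<le> 1" "64 * c\<^sup>2 * \<gamma> \<le> t\<^sup>2 * \<eta>"
  proof -
    show "0 < \<gamma>" "\<gamma> \<le> 1" using t \<eta> c by (auto simp: \<gamma>_def)
    have "64 * c\<^sup>2 * \<gamma> \<le> 64 * c\<^sup>2 * (t\<^sup>2 * \<eta> / (64 * c\<^sup>2))" by (intro mult_left_mono) (auto simp: \<gamma>_def)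
    also have "\<dots> = t\<^sup>2 * \<eta>" using c(1) by simp
    finally show "64 * c\<^sup>2 * \<gamma> \<le> t\<^sup>2 * \<eta>" .
  qed
  obtain \<epsilon>1 where \<epsilon>1: "\<epsilon>1 > 0" "evt r d (\<lambda>(V :: 'a set) p. \<forall>b. \<bar>real b / real (card V) - \<rho>\<bar> < \<epsilon>1 \<longrightarrow>
      \<bar>hypergeo r j (card V) b - \<pi>\<bar> < \<gamma>)"
    unfolding \<pi>_def \<rho>_def by (rule evt_density[OF tendsto_hypergeo[OF assms(2), of r j] \<gamma>(1)])
  \<comment> \<open>The last entry makes the main term \<open>12 * c * \<epsilon> / t\<close> of
    Markov's bound on \<open>X\<close> at most \<open>\<eta> / 8\<close>.\<close>
  define \<epsilon> where "\<epsilon> = min (\<epsilon>1 / 2) (min \<gamma> (t * \<eta> / (96 * c)))"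
  have \<epsilon>: "\<epsilon> > 0" "\<epsilon> < \<epsilon>1" "\<epsilon> \<le> \<gamma>" "96 * c * \<epsilon> \<le> t * \<eta>"
  proof -
    show "\<epsilon> > 0" "\<epsilon> < \<epsilon>1" "\<epsilon> \<le> \<gamma>" using \<epsilon>1(1) \<gamma> c(1) t \<eta> by (auto simp: \<epsilon>_def)
    have "96 * c * \<epsilon> \<le> 96 * c * (t * \<eta> / (96 * c))" using c(1) by (intro mult_left_mono) (auto simp: \<epsilon>_def)
    also have "\<dots> = t * \<eta>" using c(1) by simp
    finally show "96 * c * \<epsilon> \<le> t * \<eta>" .
  qed
  obtain K where K: "whp r d (giantlike r d \<epsilon> K :: 'a set \<Rightarrow> _)"
    using whp_giantlike[OF assms(1,2) \<epsilon>(1)] by blast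
  obtain C where C: "C > 0" "evt r d (\<lambda>(V :: 'a set) p.
    rmean (rsub r V) p (\<lambda>E. real (card {a \<in> E. \<not> sparse_near r V E K a})) \<le> C)"
    by (rule evt_nonsparse_edges[OF r2 assms(2)])
  define C2 where "C2 = c + 8 * c\<^sup>2 * real (r * K) + 4 * c ^ 3"
  have C2: "C2 > 0" using c(1) by (simp add: C2_def add_pos_nonneg)
  have pd: "evt r d (\<lambda>(V :: 'a set) p. \<bar>p * real ((card V - 1) choose (r - 1)) - d\<bar> < d / 2)"
    by (rule evt_tendsto[OF tendsto_crit_p]) (use assms in simp)
  \<comment> \<open>The first two terms give \<open>r \<le> card V\<close> and
    \<open>p \<le> 1 / 2\<close>; the others make the remaining terms in the bounds for
    \<open>X\<close>, \<open>Y\<close> and the number of edges small.\<close>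
  define N0 where "N0 = real r + 2 * c + 16 * C / (t * \<eta>) + 32 * C2 / (t\<^sup>2 * \<eta>) + 32 * real r / (d * \<eta>)"
  note ev = evt_conj[OF whpD[OF K \<epsilon>(1)] evt_conj[OF \<epsilon>1(2) evt_conj[OF C(2) pd]]]
  show "evt r d (\<lambda>(V :: 'a set) p. rprob (rsub r V) p (\<lambda>E. \<not> \<bar>real (card {a \<in> E. deg (core V E) (Inr a) = j}) / real (card E)
    - pmf (Bi_tilde r (rho_star r d)) j\<bar> \<le> \<tau>) \<le> \<eta>)"
  proof (rule evt_elim3[OF c(2) ev evt_card_real[of _ _ N0]])
    fix V :: "'a set" and p
    assume *: "admissible r c V p"
      and **: "rprob (rsub r V) p (\<lambda>E. \<not> giantlike r d \<epsilon> K V E) \<le> \<epsilon> \<and>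
        (\<forall>b. \<bar>real b / real (card V) - \<rho>\<bar> < \<epsilon>1 \<longrightarrow> \<bar>hypergeo r j (card V) b - \<pi>\<bar> < \<gamma>) \<and>
        rmean (rsub r V) p (\<lambda>E. real (card {a \<in> E. \<not> sparse_near r V E K a})) \<le> C \<and>
        \<bar>p * real ((card V - 1) choose (r - 1)) - d\<bar> < d / 2"
      and large: "N0 \<le> real (card V)"
    define n where "n = real (card V)"
    have pos: "0 \<le> 2 * c" "0 \<le> 16 * C / (t * \<eta>)" "0 \<le> 32 * C2 / (t\<^sup>2 * \<eta>)" "0 \<le> 32 * real r / (d * \<eta>)"
      using c C C2 t \<eta> assms by auto
    have n: "real r \<le> n" "2 * c \<le> n" "16 * C / (t * \<eta>) \<le> n" "32 * C2 / (t\<^sup>2 * \<eta>) \<le> n" "32 * real r / (d * \<eta>) \<le> n"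
      using large pos unfolding N0_def n_def by linarith+
    have n1: "n \<ge> 3" using n(1) assms by linarith
    have rV: "r \<le> card V" using n(1) by (simp add: n_def)
    let ?S = "rsub r V"
    have S: "finite ?S" using * by simp
    have p2: "p \<le> 1 / 2"
    proof -
      have "p * n \<le> p * n ^ (r - 1)" using * n1 assms by (intro mult_left_mono self_le_power) auto
      then have "p * n \<le> n / 2" using * n(2) unfolding n_def by linarith
      then show ?thesis using n1 by (simp add: field_simps)
    qed
    define Q where "Q a E \<longleftrightarrow> deg (core V E) (Inr a) = j" for a E
    \<comment> \<open>The deviation splits into the edges whose core degree is mispredicted, counted
      by \<open>X\<close>, and the centred sum \<open>Y\<close> over the predictions.\<close>
    define X where "X E = real (card {a \<in> E. deg (core V E) (Inr a) \<noteq> one_to_zero (card (a \<inter> big V (E - {a}) K))})" for E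
    define Y where "Y E = (\<Sum>a\<in>E. factor_centered V K j \<pi> a (E - {a}))" for E
    have dev: "\<bar>real (card {a \<in> E. Q a E}) - \<pi> * real (card E)\<bar> \<le> \<bar>Y E\<bar> + X E" if "E \<subseteq> ?S" for E
    proof -
      have fE: "finite E" using that S by (rule finite_subset)
      define u where "u a = one_to_zero (card (a \<inter> big V (E - {a}) K))" for a
      have "real (card {a \<in> E. Q a E}) - \<pi> * real (card E) = (\<Sum>a\<in>E. of_bool (Q a E) - \<pi>)"
        using fE by (simp add: sum_subtractf of_bool_def sum.If_cases Int_def mult.commute)
      also have "\<dots> = Y E + (\<Sum>a\<in>E. of_bool (Q a E) - of_bool (u a = j))"
        unfolding Y_def sum.distrib[symmetric] by (intro sum.cong) (auto simp: factor_centered_def u_def)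
      finally have "\<bar>real (card {a \<in> E. Q a E}) - \<pi> * real (card E)\<bar>
          \<le> \<bar>Y E\<bar> + \<bar>\<Sum>a\<in>E. of_bool (Q a E) - of_bool (u a = j)\<bar>" by linarith
      also have "\<bar>\<Sum>a\<in>E. of_bool (Q a E) - of_bool (u a = j) :: real\<bar> \<le> (\<Sum>a\<in>E. \<bar>of_bool (Q a E) - of_bool (u a = j)\<bar>)"
        by (rule sum_abs)
      also have "\<dots> \<le> (\<Sum>a\<in>E. of_bool (deg (core V E) (Inr a) \<noteq> u a))"
        by (intro sum_mono) (auto simp: Q_def)
      also have "\<dots> = X E" using fE by (simp add: X_def u_def of_bool_def sum.If_cases Int_def)
      finally show ?thesis by simp
    qed
    have PX: "rprob ?S p (\<lambda>E. t * n / 2 \<le> X E) \<le> \<eta> / 4"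
    proof -
      have "rprob ?S p (\<lambda>E. t * n / 2 \<le> X E) \<le> rmean ?S p X / (t * n / 2)"
        using S * t n1 by (intro rmarkov) (auto simp: X_def)
      also have "\<dots> \<le> (C + 6 * c * \<epsilon> * n) / (t * n / 2)"
      proof (rule divide_right_mono)
        show "rmean ?S p X \<le> C + 6 * c * \<epsilon> * n"
          unfolding X_def n_def using * ** p2 \<epsilon>(1) r2 by (intro rmean_deg_core_factor_neq_le) auto
      qed (use t n1 in auto)
      also have "\<dots> = 2 * C / (t * n) + 12 * c * \<epsilon> / t" using t n1 by (simp add: field_simps)
      also have "\<dots> \<le> \<eta> / 8 + \<eta> / 8"
      proof (rule add_mono)
        show "2 * C / (t * n) \<le> \<eta> / 8" using n(3) t \<eta> n1 by (simp add: field_simps)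
        show "12 * c * \<epsilon> / t \<le> \<eta> / 8" using \<epsilon>(4) t by (simp add: field_simps)
      qed
      finally show ?thesis by simp
    qed
    have PY: "rprob ?S p (\<lambda>E. t * n / 2 \<le> \<bar>Y E - 0\<bar>) \<le> \<eta> / 4"
    proof -
      have "rmean ?S p (\<lambda>E. (\<Sum>a\<in>E. factor_centered V K j \<pi> a (E - {a}))\<^sup>2)
          \<le> (c + 8 * c\<^sup>2 * real (r * K) + 4 * c ^ 3) * n + 2 * c\<^sup>2 * \<gamma> * n\<^sup>2"
      proof (rule rmean_factor_centered_sq_le)
        show "rprob ?S p (\<lambda>E. \<not> giantlike r d \<epsilon> K V E) \<le> \<gamma>" using ** \<epsilon>(3) by linarith
        fix E assume gl: "giantlike r d \<epsilon> K V E"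
        have up: "real (card (big V E K)) \<le> (\<rho> + \<epsilon>) * n" using gl by (simp add: giantlike_def \<rho>_def n_def)
        obtain L where L: "L \<subseteq> big V E K" "(\<rho> - \<epsilon>) * n \<le> real (card L)"
          using gl unfolding giantlike_def \<rho>_def n_def by blast
        have "card L \<le> card (big V E K)" using L(1) * by (intro card_mono finite_subset[OF big_subset]) auto
        then have "(\<rho> - \<epsilon>) * n \<le> real (card (big V E K))" using L(2) by linarith
        then have "\<bar>real (card (big V E K)) / n - \<rho>\<bar> \<le> \<epsilon>"
          using up n1 by (simp add: abs_le_iff field_simps)
        then have "\<bar>real (card (big V E K)) / real (card V) - \<rho>\<bar> < \<epsilon>1" using \<epsilon>(2) unfolding n_def by linarith
        then show "\<bar>hypergeo r j (card V) (card (big V E K)) - \<pi>\<bar> \<le> \<gamma>" using ** by (meson less_imp_le)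
      qed (use * rV p2 r2 \<pi> \<gamma> in \<open>auto simp: n_def\<close>)
      then have "rmean ?S p (\<lambda>E. (Y E - 0)\<^sup>2) \<le> C2 * n + 2 * c\<^sup>2 * \<gamma> * n\<^sup>2" by (simp add: Y_def C2_def)
      then have "rprob ?S p (\<lambda>E. t * n / 2 \<le> \<bar>Y E - 0\<bar>) \<le> (C2 * n + 2 * c\<^sup>2 * \<gamma> * n\<^sup>2) / (t * n / 2)\<^sup>2"
        using S * t n1 by (intro rchebyshev) auto
      also have "\<dots> = 4 * C2 / (t\<^sup>2 * n) + 8 * c\<^sup>2 * \<gamma> / t\<^sup>2"
        using t n1 by (simp add: field_simps power2_eq_square)
      also have "\<dots> \<le> \<eta> / 8 + \<eta> / 8"
      proof (rule add_mono)
        show "4 * C2 / (t\<^sup>2 * n) \<le> \<eta> / 8" using n(4) t \<eta> n1 by (simp add: field_simps)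
        show "8 * c\<^sup>2 * \<gamma> / t\<^sup>2 \<le> \<eta> / 8" using \<gamma>(3) t by (simp add: field_simps)
      qed
      finally show ?thesis by simp
    qed
    define \<mu> where "\<mu> = p * real (card ?S)"
    \<comment> \<open>By absorption \<open>r * (n choose r) = n * ((n - 1) choose (r - 1))\<close>,
      so the mean is near \<open>d * n / r\<close>; half of it is kept.\<close>
    have \<mu>: "d * n / (2 * real r) \<le> \<mu>"
    proof -
      have "r * (card V choose r) = card V * ((card V - 1) choose (r - 1))"
        using binomial_absorption[of "r - 1" "card V"] assms(1) by simp
      then have "real r * real (card V choose r) = n * real ((card V - 1) choose (r - 1))"
        unfolding n_def by (metis of_nat_mult)
      then have "real r * \<mu> = n * (p * real ((card V - 1) choose (r - 1)))"
        using * by (simp add: \<mu>_def card_rsub mult.left_commute)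
      moreover have "d / 2 \<le> p * real ((card V - 1) choose (r - 1))" using ** by linarith
      then have "n * (d / 2) \<le> n * (p * real ((card V - 1) choose (r - 1)))" using n1 by (intro mult_left_mono) auto
      ultimately show ?thesis using assms(1) by (simp add: field_simps)
    qed
    have dn: "0 < d * n / (2 * real r)" using assms n1 by simp
    have PE: "rprob ?S p (\<lambda>E. real (card E) < \<mu> / 2) \<le> \<eta> / 4"
    proof -
      have "?S \<noteq> {}" using \<mu> dn by (auto simp: \<mu>_def)
      then have "rprob ?S p (\<lambda>E. real (card E) < \<mu> / 2) \<le> 4 / \<mu>"
        unfolding \<mu>_def using S * by (intro rprob_few_edges_le) auto
      also have "\<dots> \<le> 4 / (d * n / (2 * real r))" using \<mu> dn by (intro divide_left_mono mult_pos_pos) linarith+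
      also have "\<dots> = 8 * real r / (d * n)" by simp
      also have "\<dots> \<le> \<eta> / 4" using n(5) assms \<eta> n1 by (simp add: field_simps)
      finally show ?thesis .
    qed
    have "rprob ?S p (\<lambda>E. \<not> \<bar>real (card {a \<in> E. Q a E}) / real (card E) - \<pi>\<bar> \<le> \<tau>)
        \<le> rprob ?S p (\<lambda>E. real (card E) < \<mu> / 2) + rprob ?S p (\<lambda>E. t * n / 2 \<le> \<bar>Y E - 0\<bar> \<or> t * n / 2 \<le> X E)"
    proof (rule rprob_subadd)
      fix E assume E: "E \<subseteq> ?S" and bad: "\<not> \<bar>real (card {a \<in> E. Q a E}) / real (card E) - \<pi>\<bar> \<le> \<tau>"
      show "real (card E) < \<mu> / 2 \<or> (t * n / 2 \<le> \<bar>Y E - 0\<bar> \<or> t * n / 2 \<le> X E)"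
      proof (rule ccontr)
        assume no: "\<not> ?thesis"
        define m where "m = real (card E)"
        have m: "d * n / (4 * real r) \<le> m" using no \<mu> by (simp add: m_def field_simps)
        have m0: "m > 0" using m dn by (simp add: field_simps)
        have "\<tau> * m < \<bar>real (card {a \<in> E. Q a E}) / m - \<pi>\<bar> * m" using bad m0 by (simp add: m_def)
        also have "\<dots> = \<bar>(real (card {a \<in> E. Q a E}) / m - \<pi>) * m\<bar>" using m0 by (simp add: abs_mult)
        also have "(real (card {a \<in> E. Q a E}) / m - \<pi>) * m = real (card {a \<in> E. Q a E}) - \<pi> * m"
          using m0 by (simp add: field_simps)
        also have "\<bar>\<dots>\<bar> \<le> \<bar>Y E\<bar> + X E" unfolding m_def by (rule dev[OF E])
        also have "\<dots> < t * n" using no by simp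
        also have "\<dots> = \<tau> * (d * n / (4 * real r))" by (simp add: t_def)
        also have "\<dots> \<le> \<tau> * m" using m assms by (intro mult_left_mono) auto
        finally show False by simp
      qed
    qed (use * in auto)
    also have "rprob ?S p (\<lambda>E. t * n / 2 \<le> \<bar>Y E - 0\<bar> \<or> t * n / 2 \<le> X E)
        \<le> rprob ?S p (\<lambda>E. t * n / 2 \<le> \<bar>Y E - 0\<bar>) + rprob ?S p (\<lambda>E. t * n / 2 \<le> X E)"
      by (rule rprob_subadd) (use * in auto)
    finally have "rprob ?S p (\<lambda>E. \<not> \<bar>real (card {a \<in> E. Q a E}) / real (card E) - \<pi>\<bar> \<le> \<tau>) \<le> \<eta>"
      using PX PY PE \<eta> by linarith
    then show "rprob ?S p (\<lambda>E. \<not> \<bar>real (card {a \<in> E. deg (core V E) (Inr a) = j}) / real (card E)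
      - pmf (Bi_tilde r (rho_star r d)) j\<bar> \<le> \<tau>) \<le> \<eta>"
      by (simp add: Q_def \<pi>_def)
  qed
qed

text \<open>Diagonal argument: for each \<open>m\<close>, the error \<open>s m\<close> works for all
  \<open>j \<le> m\<close> with failure at most \<open>s m\<close> once \<open>n\<close> is large.
  \<open>M n\<close> is the largest \<open>m \<le> n\<close> that works at \<open>n\<close>. It
  tends to infinity, and \<open>s (M n)\<close> is the common error.\<close>

lemma common_rate:
  fixes b :: "nat \<Rightarrow> real \<Rightarrow> nat \<Rightarrow> real"
  assumes lim: "\<And>j \<tau>. \<tau> > 0 \<Longrightarrow> (\<lambda>n. b j \<tau> n) \<longlonglongrightarrow> 1" and le1: "\<And>j \<tau> n. b j \<tau> n \<le> 1"
  shows "\<exists>\<epsilon> :: nat \<Rightarrow> real. \<epsilon> \<longlonglongrightarrow> 0 \<and> (\<forall>j. (\<lambda>n. b j (\<epsilon> n) n) \<longlonglongrightarrow> 1)"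
proof -
  define s where "s m = 1 / real (Suc m)" for m
  \<comment> \<open>Admitting \<open>m = 0\<close> unconditionally and bounding \<open>m\<close> by
    \<open>n\<close> guarantees that the maximum exists.\<close>
  define G where "G n = {m. m \<le> n \<and> (m = 0 \<or> (\<forall>j\<le>m. 1 - s m \<le> b j (s m) n))}" for n
  define M where "M n = Max (G n)" for n
  have G: "finite (G n)" "G n \<noteq> {}" for n by (auto simp: G_def)
  have MG: "M n \<in> G n" for n unfolding M_def by (rule Max_in[OF G])
  have M_lim: "filterlim M at_top sequentially"
    unfolding filterlim_at_top
  proof
    fix m
    have "\<forall>\<^sub>F n in sequentially. \<forall>j\<in>{..m}. 1 - s m \<le> b j (s m) n"
    proof (rule eventually_ball_finite)
      show "\<forall>j\<in>{..m}. \<forall>\<^sub>F n in sequentially. 1 - s m \<le> b j (s m) n"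
      proof
        fix j
        have "\<forall>\<^sub>F n in sequentially. 1 - s m < b j (s m) n"
          by (rule order_tendstoD(1)[OF lim]) (auto simp: s_def)
        then show "\<forall>\<^sub>F n in sequentially. 1 - s m \<le> b j (s m) n" by (rule eventually_mono) simp
      qed
    qed simp
    with eventually_ge_at_top[of m] show "\<forall>\<^sub>F n in sequentially. m \<le> M n"
    proof eventually_elim
      case (elim n)
      then have "m \<in> G n" by (auto simp: G_def)
      then show ?case unfolding M_def by (rule Max_ge[OF G(1)])
    qed
  qed
  have "s \<longlonglongrightarrow> 0" unfolding s_def by (rule LIMSEQ_Suc[OF lim_1_over_n])
  then have sM: "(\<lambda>n. s (M n)) \<longlonglongrightarrow> 0" by (rule filterlim_compose[OF _ M_lim])
  moreover have "(\<lambda>n. b j (s (M n)) n) \<longlonglongrightarrow> 1" for j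
  proof (rule tendsto_sandwich)
    show "\<forall>\<^sub>F n in sequentially. 1 - s (M n) \<le> b j (s (M n)) n"
      using eventually_compose_filterlim[OF eventually_ge_at_top[of "Suc j"] M_lim]
    proof eventually_elim
      case (elim n)
      then show ?case using MG[of n] by (auto simp: G_def)
    qed
    show "(\<lambda>n. 1 - s (M n)) \<longlonglongrightarrow> 1" using tendsto_diff[OF tendsto_const sM, of 1] by simp
  qed (use le1 in auto)
  ultimately show ?thesis by (intro exI[of _ "\<lambda>n. s (M n)"]) auto
qed

theorem theorem3p9:
  fixes r :: nat and d :: real and ds :: "nat \<Rightarrow> real"
  assumes "r \<ge> 3" and "d > 0" and "ds \<longlonglongrightarrow> d"
  defines "p \<equiv> \<lambda>n. ds n / real ((n - 1) choose (r - 1))"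
  shows "\<exists>\<epsilon> :: nat \<Rightarrow> real. \<epsilon> \<longlonglongrightarrow> 0 \<and>
           (\<forall>j :: nat.
              (\<lambda>n. measure_pmf.prob (random_hypergraph r n (p n))
                 {H. \<bar>variable_proportion H j - pmf (Po_tilde (d * rho_hat_star r d)) j\<bar> \<le> \<epsilon> n \<and>
                     \<bar>factor_proportion H j - pmf (Bi_tilde r (rho_star r d)) j\<bar> \<le> \<epsilon> n})
              \<longlonglongrightarrow> 1)"
proof (rule common_rate)
  have r2: "r \<ge> 2" using assms by simp
  have filt: "filterlim (\<lambda>n. ({1..n}, p n)) (crit r d) sequentially"
    unfolding filterlim_crit_iff
  proof
    show "filterlim (\<lambda>n. card {1..n}) at_top sequentially" by (simp add: filterlim_ident)
    have "\<forall>\<^sub>F n in sequentially. ds n = p n * real ((card {1..n} - 1) choose (r - 1))"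
      using eventually_gt_at_top[of r] by eventually_elim (simp add: p_def)
    then show "(\<lambda>n. p n * real ((card {1..n} - 1) choose (r - 1))) \<longlonglongrightarrow> d"
      using assms(3) by (rule tendsto_cong[THEN iffD1])
  qed
  have transfer: "\<forall>\<^sub>F n in sequentially. P {1..n} (p n)" if "evt r d P" for P :: "nat set \<Rightarrow> real \<Rightarrow> bool"
    using eventually_compose_filterlim[OF that[unfolded evt_def] filt] by simp
  \<comment> \<open>Supplies \<open>0 < p n < 1\<close> for large \<open>n\<close>, so that the
    clamping in \<open>bernoulli_pmf\<close> has no effect.\<close>
  obtain c where c: "evt r d (\<lambda>(V :: nat set) p. admissible r c V p)"
    by (rule evt_bound[OF r2 assms(2)])
  fix j :: nat and \<tau> :: real assume \<tau>: "\<tau> > 0"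
  define A where "A V E \<longleftrightarrow> \<bar>real (card {v \<in> V. deg (core V E) (Inl v) = j}) / real (card V)
      - pmf (Po_tilde (d * rho_hat_star r d)) j\<bar> \<le> \<tau> \<and>
    \<bar>real (card {a \<in> E. deg (core V E) (Inr a) = j}) / real (card E)
      - pmf (Bi_tilde r (rho_star r d)) j\<bar> \<le> \<tau>" for V :: "nat set" and E
  have "whp r d A"
    by (rule whp_elim2[OF r2 assms(2) whp_variable[OF assms(1,2) \<tau>, of j] whp_factor[OF assms(1,2) \<tau>, of j] c])
      (auto simp: A_def)
  have "(\<lambda>n. 1 - measure_pmf.prob (random_hypergraph r n (p n))
                 {H. \<bar>variable_proportion H j - pmf (Po_tilde (d * rho_hat_star r d)) j\<bar> \<le> \<tau> \<and>
                     \<bar>factor_proportion H j - pmf (Bi_tilde r (rho_star r d)) j\<bar> \<le> \<tau>}) \<longlonglongrightarrow> 0"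
  proof (rule tendstoI)
    fix e :: real assume e: "e > 0"
    have "\<forall>\<^sub>F n in sequentially. rprob (rsub r {1..n}) (p n) (\<lambda>E. \<not> A {1..n} E) \<le> e / 2"
      by (rule transfer[OF whpD[OF \<open>whp r d A\<close>]]) (use e in simp)
    with transfer[OF c] show "\<forall>\<^sub>F n in sequentially. dist (1 - measure_pmf.prob (random_hypergraph r n (p n))
                 {H. \<bar>variable_proportion H j - pmf (Po_tilde (d * rho_hat_star r d)) j\<bar> \<le> \<tau> \<and>
                     \<bar>factor_proportion H j - pmf (Bi_tilde r (rho_star r d)) j\<bar> \<le> \<tau>}) 0 < e"
    proof eventually_elim
      case (elim n)
      have "measure_pmf.prob (random_hypergraph r n (p n))
                 {H. \<bar>variable_proportion H j - pmf (Po_tilde (d * rho_hat_star r d)) j\<bar> \<le> \<tau> \<and>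
                     \<bar>factor_proportion H j - pmf (Bi_tilde r (rho_star r d)) j\<bar> \<le> \<tau>}
          = rprob (rsub r {1..n}) (p n) (A {1..n})"
        using elim(1) by (subst prob_random_hypergraph)
          (auto simp: A_def[abs_def] r_subsets_def rsub_def variable_proportion_def factor_proportion_def)
      also have "1 - \<dots> = rprob (rsub r {1..n}) (p n) (\<lambda>E. \<not> A {1..n} E)"
        by (simp add: rprob_not)
      finally have eq: "1 - measure_pmf.prob (random_hypergraph r n (p n))
                 {H. \<bar>variable_proportion H j - pmf (Po_tilde (d * rho_hat_star r d)) j\<bar> \<le> \<tau> \<and>
                     \<bar>factor_proportion H j - pmf (Bi_tilde r (rho_star r d)) j\<bar> \<le> \<tau>}
          = rprob (rsub r {1..n}) (p n) (\<lambda>E. \<not> A {1..n} E)" .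
      have "0 \<le> rprob (rsub r {1..n}) (p n) (\<lambda>E. \<not> A {1..n} E)"
        using elim(1) by (intro rprob_nonneg) auto
      then show ?case unfolding eq using elim(2) e by (simp add: dist_real_def)
    qed
  qed
  from tendsto_diff[OF tendsto_const this, of 1]
  show "(\<lambda>n. measure_pmf.prob (random_hypergraph r n (p n))
                 {H. \<bar>variable_proportion H j - pmf (Po_tilde (d * rho_hat_star r d)) j\<bar> \<le> \<tau> \<and>
                     \<bar>factor_proportion H j - pmf (Bi_tilde r (rho_star r d)) j\<bar> \<le> \<tau>}) \<longlonglongrightarrow> 1"
    by simp
qed simp

end
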